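(* Let $1<p<\infty$ and let $G$ be a second countable locally compact group such that $A_p(G)$ has a multiplier bounded approximate identity. If for some $1\le t\le\infty$ the Banach space $A_p^t(G)$ has the Radon–Nikodym property (RNP), then so does $A_p^r(G)$ for all $1\le r\le t$. In particular, if $A_p(G)$ has the RNP, then $A_p^r(G)$ has the RNP for all $1\le r<\infty$.
   Context: $G$ is a locally compact group with a fixed left Haar measure $dx$; functions are complex valued; $L^q(G)$ is taken with respect to $dx$; $v^{\vee}(x)=v(x^{-1})$; $1/p+1/p'=1$. $A_p(G)$ (the Figa-Talamanca–Herz algebra) is the set of functions $u=\sum_n u_n*v_n^{\vee}$ with $u_n\in L^{p'}(G)$, $v_n\in L^p(G)$, $\sum_n\|u_n\|_{L^{p'}}\|v_n\|_{L^p}<\infty$, where $(u_n*v_n^\vee)(x)=\int u_n(y)v_n(x^{-1}y)\,dy$. The norm $\|u\|_{A_p}$ is the infimum of the last sum over all such representations of $u$. It is a Banach algebra under pointwise multiplication. For $1\le r\le\infty$, $A_p^r(G)=A_p(G)\cap L^r(G)$ with norm $\|u\|_{A_p^r}=\|u\|_{A_p}+\|u\|_{L^r}$ for $r<\infty$, and $A_p^\infty(G)=A_p(G)$ with its own norm. A multiplier bounded approximate identity of $A_p(G)$ is a net $(u_\alpha)$ in $A_p(G)$ with $\|u_\alpha v-v\|_{A_p}\to0$ for all $v\in A_p(G)$ and $\sup_\alpha\sup\{\|u_\alpha v\|_{A_p}: v\in A_p(G),\ \|v\|_{A_p}\le1\}<\infty$. RNP: a point $b$ of a bounded subset $B$ of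 a Banach space $X$ is strongly exposed if there is $b^*\in X^*$ with $\operatorname{Re} b^*(x)<\operatorname{Re} b^*(b)$ for all $x\in B$, $x\ne b$, and such that $x_n\in B$, $\operatorname{Re} b^*(x_n)\to\operatorname{Re} b^*(b)$ imply $\|x_n-b\|\to0$. $X$ has the RNP if each norm closed convex bounded subset of $X$ is the norm closed convex hull of its strongly exposed points. *)

theory Defs
  imports "HOL-Analysis.Analysis"
begin

text \<open>
  A locally compact group is a type of class \<^class>\<open>topological_group_add\<close> and
  \<^class>\<open>t2_space\<close> whose topology is locally compact. The group operation is therefore written
  \<open>x + y\<close>, the inverse \<open>- x\<close>; this class does \<^emph>\<open>not\<close> make the group commutative.
\<close>

definition left_haar_measure :: "'g::{topological_group_add, t2_space} measure \<Rightarrow> bool" where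
  "left_haar_measure \<mu> \<longleftrightarrow>
     sets \<mu> = sets borel \<and>
     emeasure \<mu> UNIV \<noteq> 0 \<and>
     (\<forall>K. compact K \<longrightarrow> emeasure \<mu> K < \<infinity>) \<and>
     (\<forall>A\<in>sets borel. emeasure \<mu> A = (INF U\<in>{U. open U \<and> A \<subseteq> U}. emeasure \<mu> U)) \<and>
     (\<forall>U. open U \<longrightarrow> emeasure \<mu> U = (SUP K\<in>{K. compact K \<and> K \<subseteq> U}. emeasure \<mu> K)) \<and>
     (\<forall>a. \<forall>A\<in>sets borel. emeasure \<mu> ((\<lambda>x. a + x) ` A) = emeasure \<mu> A)"


text \<open>\<open>L\<^sup>q\<close> for finite real \<open>q\<close>, as a set of functions (not of classes modulo null sets).\<close>

definition Lspace :: "'a measure \<Rightarrow> real \<Rightarrow> ('a \<Rightarrow> complex) set" where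
  "Lspace \<mu> q = {f \<in> borel_measurable \<mu>. integrable \<mu> (\<lambda>x. cmod (f x) powr q)}"

definition Lnorm :: "'a measure \<Rightarrow> real \<Rightarrow> ('a \<Rightarrow> complex) \<Rightarrow> real" where
  "Lnorm \<mu> q f = (LINT x|\<mu>. cmod (f x) powr q) powr (1 / q)"

definition conjugate_exponent :: "real \<Rightarrow> real" where
  "conjugate_exponent p = p / (p - 1)"


definition check_convolution ::
    "'g::topological_group_add measure \<Rightarrow> ('g \<Rightarrow> complex) \<Rightarrow> ('g \<Rightarrow> complex) \<Rightarrow> 'g \<Rightarrow> complex" where
  "check_convolution \<mu> f g x = (LINT y|\<mu>. f y * g (- x + y))"

text \<open>
  For \<open>f\<^sub>n \<in> L\<^bsup>p'\<^esup>\<close> and \<open>g\<^sub>n \<in> L\<^sup>p\<close> with summable product of norms, the series of the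
  continuous functions \<open>f\<^sub>n * g\<^sub>n\<^sup>\<or>\<close> converges absolutely and uniformly by Hoelder's inequality,
  so that its sum is determined pointwise.
\<close>

definition Ap_representations ::
    "'g::topological_group_add measure \<Rightarrow> real \<Rightarrow> ('g \<Rightarrow> complex)
     \<Rightarrow> ((nat \<Rightarrow> 'g \<Rightarrow> complex) \<times> (nat \<Rightarrow> 'g \<Rightarrow> complex)) set" where
  "Ap_representations \<mu> p u =
     {(f, g). (\<forall>n. f n \<in> Lspace \<mu> (conjugate_exponent p)) \<and>
              (\<forall>n. g n \<in> Lspace \<mu> p) \<and>
              summable (\<lambda>n. Lnorm \<mu> (conjugate_exponent p) (f n) * Lnorm \<mu> p (g n)) \<and>
              (\<forall>x. (\<lambda>n. check_convolution \<mu> (f n) (g n) x) sums u x)}"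

definition Ap :: "'g::topological_group_add measure \<Rightarrow> real \<Rightarrow> ('g \<Rightarrow> complex) set" where
  "Ap \<mu> p = {u. Ap_representations \<mu> p u \<noteq> {}}"

definition Ap_norm :: "'g::topological_group_add measure \<Rightarrow> real \<Rightarrow> ('g \<Rightarrow> complex) \<Rightarrow> real" where
  "Ap_norm \<mu> p u =
     (INF (f, g)\<in>Ap_representations \<mu> p u.
        \<Sum>n. Lnorm \<mu> (conjugate_exponent p) (f n) * Lnorm \<mu> p (g n))"

definition Apr ::
    "'g::topological_group_add measure \<Rightarrow> real \<Rightarrow> ennreal \<Rightarrow> ('g \<Rightarrow> complex) set" where
  "Apr \<mu> p r = (if r = \<infinity> then Ap \<mu> p else Ap \<mu> p \<inter> Lspace \<mu> (enn2real r))"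

definition Apr_norm ::
    "'g::topological_group_add measure \<Rightarrow> real \<Rightarrow> ennreal \<Rightarrow> ('g \<Rightarrow> complex) \<Rightarrow> real" where
  "Apr_norm \<mu> p r u =
     (if r = \<infinity> then Ap_norm \<mu> p u else Ap_norm \<mu> p u + Lnorm \<mu> (enn2real r) u)"


text \<open>A net is given by its index set \<open>I\<close>, the preorder \<open>le\<close> directing it and the family itself.\<close>

definition directed_by :: "'i set \<Rightarrow> ('i \<Rightarrow> 'i \<Rightarrow> bool) \<Rightarrow> bool" where
  "directed_by I le \<longleftrightarrow>
     I \<noteq> {} \<and>
     (\<forall>a\<in>I. le a a) \<and>
     (\<forall>a\<in>I. \<forall>b\<in>I. \<forall>c\<in>I. le a b \<longrightarrow> le b c \<longrightarrow> le a c) \<and>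
     (\<forall>a\<in>I. \<forall>b\<in>I. \<exists>c\<in>I. le a c \<and> le b c)"

definition multiplier_bai ::
    "'g::topological_group_add measure \<Rightarrow> real
     \<Rightarrow> 'i set \<Rightarrow> ('i \<Rightarrow> 'i \<Rightarrow> bool) \<Rightarrow> ('i \<Rightarrow> 'g \<Rightarrow> complex) \<Rightarrow> bool" where
  "multiplier_bai \<mu> p I le u \<longleftrightarrow>
     directed_by I le \<and>
     (\<forall>a\<in>I. u a \<in> Ap \<mu> p) \<and>
     (\<forall>v\<in>Ap \<mu> p. \<forall>e>0. \<exists>a\<in>I. \<forall>b\<in>I. le a b \<longrightarrow> Ap_norm \<mu> p (\<lambda>x. u b x * v x - v x) < e) \<and>
     (\<exists>C. \<forall>a\<in>I. \<forall>v\<in>Ap \<mu> p. Ap_norm \<mu> p v \<le> 1 \<longrightarrow> Ap_norm \<mu> p (\<lambda>x. u a x * v x) \<le> C)"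


text \<open>
  In the following, \<open>X\<close> is a complex vector space of functions and \<open>N\<close> a complete norm on \<open>X\<close>;
  the values of \<open>N\<close> outside \<open>X\<close> are irrelevant.
\<close>

definition dual_space :: "('a \<Rightarrow> complex) set \<Rightarrow> (('a \<Rightarrow> complex) \<Rightarrow> real)
    \<Rightarrow> (('a \<Rightarrow> complex) \<Rightarrow> complex) set" where
  "dual_space X N =
     {\<phi>. (\<forall>f\<in>X. \<forall>g\<in>X. \<phi> (\<lambda>x. f x + g x) = \<phi> f + \<phi> g) \<and>
         (\<forall>c. \<forall>f\<in>X. \<phi> (\<lambda>x. c * f x) = c * \<phi> f) \<and>
         (\<exists>C. \<forall>f\<in>X. cmod (\<phi> f) \<le> C * N f)}"

definition norm_bounded :: "(('a \<Rightarrow> complex) \<Rightarrow> real) \<Rightarrow> ('a \<Rightarrow> complex) set \<Rightarrow> bool" where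
  "norm_bounded N B \<longleftrightarrow> (\<exists>C. \<forall>f\<in>B. N f \<le> C)"

definition closed_convex_in :: "('a \<Rightarrow> complex) set \<Rightarrow> (('a \<Rightarrow> complex) \<Rightarrow> real)
    \<Rightarrow> ('a \<Rightarrow> complex) set \<Rightarrow> bool" where
  "closed_convex_in X N B \<longleftrightarrow>
     B \<subseteq> X \<and>
     (\<forall>s l. (\<forall>n. s n \<in> B) \<and> l \<in> X \<and> (\<lambda>n::nat. N (\<lambda>x. s n x - l x)) \<longlonglongrightarrow> 0 \<longrightarrow> l \<in> B) \<and>
     (\<forall>f\<in>B. \<forall>g\<in>B. \<forall>\<tau>\<in>{0..1::real}.
        (\<lambda>x. complex_of_real (1 - \<tau>) * f x + complex_of_real \<tau> * g x) \<in> B)"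

definition strongly_exposed_points :: "('a \<Rightarrow> complex) set \<Rightarrow> (('a \<Rightarrow> complex) \<Rightarrow> real)
    \<Rightarrow> ('a \<Rightarrow> complex) set \<Rightarrow> ('a \<Rightarrow> complex) set" where
  "strongly_exposed_points X N B =
     {b \<in> B. \<exists>\<phi>\<in>dual_space X N.
        (\<forall>f\<in>B. f \<noteq> b \<longrightarrow> Re (\<phi> f) < Re (\<phi> b)) \<and>
        (\<forall>s. (\<forall>n. s n \<in> B) \<and> (\<lambda>n::nat. Re (\<phi> (s n))) \<longlonglongrightarrow> Re (\<phi> b) \<longrightarrow>
             (\<lambda>n. N (\<lambda>x. s n x - b x)) \<longlonglongrightarrow> 0)}"

definition RNP :: "('a \<Rightarrow> complex) set \<Rightarrow> (('a \<Rightarrow> complex) \<Rightarrow> real) \<Rightarrow> bool" where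
  "RNP X N \<longleftrightarrow>
     (\<forall>B. closed_convex_in X N B \<and> norm_bounded N B \<longrightarrow>
          B = closed_convex_in X N hull strongly_exposed_points X N B)"

end

theory Submission
  imports Defs "HOL-Library.Function_Algebras"
begin

text \<open>
  Write \<open>X = A\<^sub>p\<^sup>r\<close> and \<open>Y = A\<^sub>p\<^sup>t\<close> with \<open>r \<le> t\<close>. Since elements of \<open>A\<^sub>p\<close> are bounded by their norm, \<open>X\<close> embeds
  into \<open>Y\<close>, and by Fatou's lemma the balls of \<open>X\<close> are closed in \<open>Y\<close> (a semi-embedding). Let \<open>C\<close> be the
  \<open>Y\<close>-closed convex hull of a bounded set in \<open>X\<close> and \<open>E\<close> the set of its strongly exposed points in \<open>Y\<close>.
  As \<open>L\<^sup>r\<close> is separable and the \<open>A\<^sub>p\<close> norm is dominated by that of \<open>Y\<close>, Baire's theorem provides a point \<open>e\<close>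
  of \<open>E\<close> near which \<open>E\<close> has small \<open>X\<close>-diameter; because \<open>C\<close> is the closed convex hull of \<open>E\<close>, a functional
  exposing \<open>e\<close> cuts a slice of small \<open>X\<close>-diameter off \<open>C\<close>, so \<open>X\<close> is dentable. Dentability of all bounded
  sets gives strongly exposed points: by the Bishop--Phelps--Bollobas theorem and the monotonicity of the
  subdifferential the functionals having a slice of diameter \<open>\<epsilon>\<close> are dense, hence so are the strongly
  exposing ones, and the Hahn--Banach theorem finishes the proof.
\<close>

section \<open>The Hahn--Banach theorem on a subspace\<close>

text \<open>A functional that strongly exposes \<open>e\<close> in \<open>Y\<close> cuts slices that
  are small for \<open>NY\<close> only; nothing makes them small for \<open>NX\<close>. The gap is
  bridged by testing the hull property of \<open>C\<close> on a sublevel set of the convex function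
  \<open>NX (x - e) + L * \<phi> x\<close>. That set is \<open>Y\<close>-closed because
  \<open>NX\<close> is lower semicontinuous with respect to \<open>NY\<close>, so it contains all of
  \<open>C\<close> once it contains the exposed points. A bounded set that is closed in
  \<open>X\<close> may fail to be closed in \<open>Y\<close>, so the RNP of \<open>Y\<close> can be
  invoked only for hulls taken in \<open>Y\<close>. What is transferred is therefore dentability,
  which speaks of arbitrary bounded sets, and the way back from dentability to exposed points is
  carried out inside \<open>X\<close>. The norms live on sets of functions and their values
  elsewhere are arbitrary. All functional analysis is therefore developed relative to a subspace of
  a real vector space, with real functionals; complex functionals enter only when the result is
  compared with the definition of the RNP.\<close>

definition sublinear_on :: "'v::real_vector set \<Rightarrow> ('v \<Rightarrow> real) \<Rightarrow> bool" where
  "sublinear_on X p \<longleftrightarrow> p 0 = 0 \<and> (\<forall>x\<in>X. \<forall>y\<in>X. p (x + y) \<le> p x + p y) \<and>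
     (\<forall>c>0. \<forall>x\<in>X. p (c *\<^sub>R x) \<le> c * p x)"

definition linear_functional_on :: "'v::real_vector set \<Rightarrow> ('v \<Rightarrow> real) \<Rightarrow> bool" where
  "linear_functional_on X f \<longleftrightarrow> (\<forall>x\<in>X. \<forall>y\<in>X. f (x + y) = f x + f y) \<and>
     (\<forall>c. \<forall>x\<in>X. f (c *\<^sub>R x) = c * f x)"

context
  fixes X :: "'v::real_vector set" and p :: "'v \<Rightarrow> real"
  assumes X: "subspace X" and p: "sublinear_on X p"
begin

lemma sublinear_zero: "p 0 = 0"
  and sublinear_add: "x \<in> X \<Longrightarrow> y \<in> X \<Longrightarrow> p (x + y) \<le> p x + p y"
  using p by (auto simp: sublinear_on_def)

text \<open>The definition demands only \<open>\<le>\<close>; the reverse inequality is the same one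
  applied with \<open>inverse c\<close>.\<close>

lemma sublinear_scale:
  assumes "0 \<le> c" "x \<in> X"
  shows "p (c *\<^sub>R x) = c * p x"
proof (cases "c = 0")
  case True
  then show ?thesis by (simp add: sublinear_zero)
next
  case False
  then have c0: "c > 0" using assms by simp
  have "p (c *\<^sub>R x) \<le> c * p x"
    using p c0 assms by (auto simp: sublinear_on_def)
  moreover have "c *\<^sub>R x \<in> X"
    using X assms by (simp add: subspace_scale)
  then have "p (inverse c *\<^sub>R (c *\<^sub>R x)) \<le> inverse c * p (c *\<^sub>R x)"
    using p c0 unfolding sublinear_on_def by (metis positive_imp_inverse_positive)
  then have "c * p x \<le> p (c *\<^sub>R x)" using c0 by (simp add: field_simps)
  ultimately show ?thesis by simp
qed

lemma sublinear_minus: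
  assumes "x \<in> X" shows "- p (- x) \<le> p x"
  using sublinear_add[of x "- x"] assms X by (simp add: sublinear_zero subspace_neg)

text \<open>This is the device behind the Mazur-Orlicz theorem: every linear functional below
  \<open>r\<close> is dominated by \<open>p\<close> on \<open>X\<close> and dominates
  \<open>h\<close> on \<open>Q\<close>. The hypothesis \<open>h \<le> p\<close> keeps the infimum
  finite, and concavity of \<open>h\<close> makes it subadditive.\<close>

lemma sublinear_hull:
  fixes Q :: "'v set" and h :: "'v \<Rightarrow> real"
  assumes Q: "Q \<subseteq> X" "Q \<noteq> {}" "concave_on Q h" and h: "\<And>q. q \<in> Q \<Longrightarrow> h q \<le> p q"
  obtains r where "sublinear_on X r" "\<And>x. x \<in> X \<Longrightarrow> r x \<le> p x" "\<And>q. q \<in> Q \<Longrightarrow> r (- q) \<le> - h q"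
proof -
  \<comment> \<open>The pair \<open>z\<close> is a weight and a point of \<open>Q\<close>. Weight 0
    gives \<open>r \<le> p\<close>; weight 1 at \<open>v = - q\<close> gives
    \<open>r (- q) \<le> - h q\<close>, since \<open>p 0 = 0\<close>.\<close>
  define F where "F v z = p (v + fst z *\<^sub>R snd z) - fst z * h (snd z)" for v and z :: "real \<times> 'v"
  define S where "S = {0::real..} \<times> Q"
  define r where "r v = (INF z\<in>S. F v z)" for v
  obtain q0 where q0: "q0 \<in> Q" using Q by blast
  have S0: "(0, q0) \<in> S" using q0 by (simp add: S_def)
  then have Sne: "S \<noteq> {}" by blast
  have lb: "- p (- v) \<le> F v z" if "v \<in> X" "z \<in> S" for v z
  proof -
    have z: "0 \<le> fst z" "snd z \<in> Q" "snd z \<in> X" using that Q by (auto simp: S_def)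
    have i1: "v + fst z *\<^sub>R snd z \<in> X" using that z X by (simp add: subspace_add subspace_scale)
    have "fst z * h (snd z) \<le> fst z * p (snd z)" using z h by (simp add: mult_left_mono)
    also have "\<dots> = p (fst z *\<^sub>R snd z)" using z by (simp add: sublinear_scale)
    also have "\<dots> = p ((v + fst z *\<^sub>R snd z) + (- v))" by simp
    also have "\<dots> \<le> p (v + fst z *\<^sub>R snd z) + p (- v)"
      using i1 that X by (intro sublinear_add) (auto simp: subspace_neg)
    finally show ?thesis by (simp add: F_def)
  qed
  have bdd: "bdd_below (F v ` S)" if "v \<in> X" for v
    using lb[OF that] by (intro bdd_belowI2) blast
  have le: "r v \<le> F v z" if "v \<in> X" "z \<in> S" for v z
    unfolding r_def using bdd that by (intro cINF_lower) auto
  have ge: "a \<le> r v" if "v \<in> X" "\<And>z. z \<in> S \<Longrightarrow> a \<le> F v z" for v a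
    unfolding r_def using that Sne by (intro cINF_greatest) auto
  have X0: "0 \<in> X" using X by (simp add: subspace_0)
  have "r 0 = 0"
  proof (rule antisym)
    show "r 0 \<le> 0" using le[OF X0 S0] by (simp add: F_def sublinear_zero)
    show "0 \<le> r 0" using lb[OF X0] by (intro ge X0) (simp add: sublinear_zero)
  qed
  moreover have "r (x + y) \<le> r x + r y" if x: "x \<in> X" and y: "y \<in> X" for x y
  proof -
    have xy: "x + y \<in> X" using x y X by (simp add: subspace_add)
    have "r (x + y) \<le> F x z + F y w" if z: "z \<in> S" and w: "w \<in> S" for z w
    proof (cases "fst z + fst w = 0")
      case True
      then have "fst z = 0" "fst w = 0" using z w by (auto simp: S_def)
      then have "F x z + F y w = p x + p y" by (simp add: F_def)
      moreover have "F (x + y) (0, q0) = p (x + y)" by (simp add: F_def)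
      ultimately show ?thesis using le[OF xy S0] sublinear_add[OF x y] by simp
    next
      case False
      \<comment> \<open>Two weighted points merge into one: \<open>s\<close> is the total weight and
        \<open>q\<close> the barycentre, so the weighted shifts of \<open>x\<close> and
        \<open>y\<close> add up to the shift of \<open>x + y\<close> by \<open>s\<close> times
        \<open>q\<close>.\<close>
      define s where "s = fst z + fst w"
      have s: "s > 0" using False z w by (auto simp: S_def s_def)
      define q where "q = (fst z / s) *\<^sub>R snd z + (fst w / s) *\<^sub>R snd w"
      have zw: "snd z \<in> Q" "snd w \<in> Q" "0 \<le> fst z" "0 \<le> fst w" using z w by (auto simp: S_def)
      have one: "fst z / s + fst w / s = 1" using s by (simp add: s_def add_divide_distrib[symmetric])
      have co: "convex Q" "\<forall>x\<in>Q. \<forall>y\<in>Q. \<forall>u\<ge>0. \<forall>v\<ge>0. u + v = 1 \<longrightarrow> - h (u *\<^sub>R x + v *\<^sub>R y) \<le> u * - h x + v * - h y"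
        using Q(3) unfolding concave_on_def convex_on_def by blast+
      have qQ: "q \<in> Q" unfolding q_def
        using co(1) zw one s by (intro convexD) auto
      have "- h q \<le> (fst z / s) * - h (snd z) + (fst w / s) * - h (snd w)"
        unfolding q_def using co(2) zw one s by (meson divide_nonneg_pos)
      then have "s * (- h q) \<le> s * ((fst z / s) * - h (snd z) + (fst w / s) * - h (snd w))"
        using s by (intro mult_left_mono) auto
      also have "\<dots> = - fst z * h (snd z) - fst w * h (snd w)"
        using s by (simp add: field_simps)
      finally have hq: "- (s * h q) \<le> - fst z * h (snd z) - fst w * h (snd w)" by simp
      have sq: "s *\<^sub>R q = fst z *\<^sub>R snd z + fst w *\<^sub>R snd w"
        using s by (simp add: q_def scaleR_add_right)
      have m: "x + fst z *\<^sub>R snd z \<in> X" "y + fst w *\<^sub>R snd w \<in> X"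
        using x y zw Q X by (auto intro!: subspace_add subspace_scale)
      have "r (x + y) \<le> F (x + y) (s, q)" using le[OF xy] qQ s by (simp add: S_def)
      also have "\<dots> = p ((x + fst z *\<^sub>R snd z) + (y + fst w *\<^sub>R snd w)) - s * h q"
        by (simp add: F_def sq algebra_simps)
      also have "\<dots> \<le> p (x + fst z *\<^sub>R snd z) + p (y + fst w *\<^sub>R snd w) - s * h q"
        using sublinear_add[OF m] by simp
      also have "\<dots> \<le> F x z + F y w" using hq by (simp add: F_def)
      finally show ?thesis .
    qed
    then have "r (x + y) - F y w \<le> r x" if "w \<in> S" for w
      using that by (intro ge x) (simp add: algebra_simps)
    then have "r (x + y) - r x \<le> r y"
      by (intro ge y) (simp add: algebra_simps)
    then show ?thesis by simp
  qed
  moreover have "r (c *\<^sub>R x) \<le> c * r x" if c: "c > 0" and x: "x \<in> X" for c x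
  proof -
    have "r (c *\<^sub>R x) / c \<le> F x z" if z: "z \<in> S" for z
    proof -
      have "r (c *\<^sub>R x) \<le> F (c *\<^sub>R x) (c * fst z, snd z)"
        using z c x X by (intro le) (auto simp: S_def subspace_scale)
      also have "\<dots> = p (c *\<^sub>R (x + fst z *\<^sub>R snd z)) - c * fst z * h (snd z)"
        by (simp add: F_def scaleR_add_right)
      also have "\<dots> = c * p (x + fst z *\<^sub>R snd z) - c * fst z * h (snd z)"
        using c x z Q X by (subst sublinear_scale) (auto intro!: subspace_add subspace_scale simp: S_def)
      also have "\<dots> = c * F x z" by (simp add: F_def algebra_simps)
      finally show ?thesis using c by (simp add: field_simps)
    qed
    then have "r (c *\<^sub>R x) / c \<le> r x" by (intro ge x)
    then show ?thesis using c by (simp add: field_simps)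
  qed
  ultimately have "sublinear_on X r" by (simp add: sublinear_on_def)
  moreover have "r x \<le> p x" if "x \<in> X" for x
    using le[OF that S0] by (simp add: F_def)
  moreover have "r (- q) \<le> - h q" if "q \<in> Q" for q
    using le[of "- q" "(1, q)"] that Q X by (auto simp: F_def sublinear_zero S_def subspace_neg)
  ultimately show ?thesis using that by blast
qed

end

lemma hahn_banach_dominated:
  fixes p :: "'v::real_vector \<Rightarrow> real"
  assumes X: "subspace X" and p: "sublinear_on X p"
  obtains f where "linear_functional_on X f" "\<And>x. x \<in> X \<Longrightarrow> f x \<le> p x"
proof -
  \<comment> \<open>A minimal sublinear functional below \<open>p\<close> is linear.\<close>
  define A where "A = {q. sublinear_on X q \<and> (\<forall>x\<in>X. q x \<le> p x) \<and> (\<forall>x. x \<notin> X \<longrightarrow> q x = 0)}"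
  \<comment> \<open>The order is reversed, so that a maximal element in Zorn's lemma is a minimal
    functional.\<close>
  define P where "P = (\<lambda>a b :: 'v \<Rightarrow> real. b \<le> a)"
  have po: "partial_order_on A (relation_of P A)"
    by (rule partial_order_on_relation_ofI) (auto simp: P_def)
  have X0: "0 \<in> X" using X by (simp add: subspace_0)
  \<comment> \<open>Members of \<open>A\<close> vanish off \<open>X\<close>, because the pointwise
    order compares values at all arguments and only those on \<open>X\<close> may matter.\<close>
  have restr: "(\<lambda>x. if x \<in> X then q x else 0) \<in> A"
    if "sublinear_on X q" "\<And>x. x \<in> X \<Longrightarrow> q x \<le> p x" for q
    using that X X0 by (auto simp: A_def sublinear_on_def subspace_add subspace_scale)
  have "\<exists>m\<in>A. \<forall>a\<in>A. P m a \<longrightarrow> a = m"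
  proof (rule predicate_Zorn[OF po])
    fix C assume C: "C \<in> Chains (relation_of P A)"
    then have CA: "C \<subseteq> A" by (auto simp: Chains_def relation_of_def)
    have tot: "a \<le> b \<or> b \<le> a" if "a \<in> C" "b \<in> C" for a b
      using C that by (auto simp: Chains_def relation_of_def P_def)
    show "\<exists>u\<in>A. \<forall>a\<in>C. P a u"
    proof (cases "C = {}")
      case True
      then show ?thesis using restr[OF p] by blast
    next
      case False
      define u where "u x = (INF q\<in>C. q x)" for x
      have lb: "- p (- x) \<le> q x" if "q \<in> C" "x \<in> X" for q x
      proof -
        have "sublinear_on X q" "q (- x) \<le> p (- x)"
          using that CA X by (auto simp: A_def subspace_neg)
        then show ?thesis using sublinear_minus[OF X _ that(2), of q] by simp
      qed
      have le: "u x \<le> q x" if "q \<in> C" "x \<in> X" for q x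
        unfolding u_def using that lb by (intro cINF_lower bdd_belowI2[where m = "- p (- x)"]) auto
      have ge: "a \<le> u x" if "\<And>q. q \<in> C \<Longrightarrow> a \<le> q x" for a x
        unfolding u_def using False that by (intro cINF_greatest) auto
      have sub: "sublinear_on X q" if "q \<in> C" for q using that CA by (auto simp: A_def)
      obtain q0 where q0: "q0 \<in> C" using False by blast
      have "sublinear_on X u" unfolding sublinear_on_def
      proof (intro conjI ballI allI impI)
        show "u 0 = 0"
          using le[OF q0 X0] sub[OF q0] ge[of 0 0] sub sublinear_zero[OF X]
          by (metis order.antisym order.refl)
      next
        fix x y assume x: "x \<in> X" and y: "y \<in> X"
        have xy: "x + y \<in> X" using X x y by (simp add: subspace_add)
        have "u (x + y) \<le> q1 x + q2 y" if q: "q1 \<in> C" "q2 \<in> C" for q1 q2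
        proof -
          \<comment> \<open>The smaller of two members of the chain serves for both
            arguments.\<close>
          have "\<exists>q\<in>C. q x \<le> q1 x \<and> q y \<le> q2 y"
            using tot[OF q] q by (auto simp: le_fun_def)
          then obtain q where "q \<in> C" "q x \<le> q1 x" "q y \<le> q2 y" by blast
          then show ?thesis
            using le[OF _ xy, of q] sublinear_add[OF X sub x y, of q] by linarith
        qed
        then have "u (x + y) - q2 y \<le> u x" if "q2 \<in> C" for q2
          using that by (intro ge) (simp add: algebra_simps)
        then have "u (x + y) - u x \<le> u y" by (intro ge) (simp add: algebra_simps)
        then show "u (x + y) \<le> u x + u y" by simp
      next
        fix c :: real and x assume c: "0 < c" and x: "x \<in> X"
        have "u (c *\<^sub>R x) / c \<le> u x"
        proof (rule ge)
          fix q assume q: "q \<in> C"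
          have "u (c *\<^sub>R x) \<le> c * q x"
            using le[OF q, of "c *\<^sub>R x"] sublinear_scale[OF X sub[OF q], of c x] c x X
            by (simp add: subspace_scale)
          then show "u (c *\<^sub>R x) / c \<le> q x" using c by (simp add: field_simps)
        qed
        then show "u (c *\<^sub>R x) \<le> c * u x" using c by (simp add: field_simps)
      qed
      moreover have "u x \<le> p x" if "x \<in> X" for x
        using le[OF q0 that] q0 CA that by (force simp: A_def)
      ultimately have "(\<lambda>x. if x \<in> X then u x else 0) \<in> A" by (rule restr)
      moreover have "P a (\<lambda>x. if x \<in> X then u x else 0)" if "a \<in> C" for a
        using that CA le by (auto simp: P_def A_def le_fun_def subset_iff)
      ultimately show ?thesis by blast
    qed
  qed
  then obtain m where m: "m \<in> A" and min: "\<And>a. a \<in> A \<Longrightarrow> a \<le> m \<Longrightarrow> a = m"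
    by (auto simp: P_def)
  have sm: "sublinear_on X m" using m by (simp add: A_def)
  \<comment> \<open>With \<open>Q = {w}\<close> and \<open>h = m\<close>, the construction above
    returns a sublinear functional below \<open>m\<close>. By minimality it equals \<open>m\<close>
    on \<open>X\<close>, hence \<open>m (- w) \<le> - m w\<close>. A sublinear functional that is
    odd is linear.\<close>
  have odd: "m (- w) = - m w" if w: "w \<in> X" for w
  proof -
    have "concave_on {w} m"
     proof -
      have "u * - m w + v * - m w = - m w" if "u + v = 1" for u v
        unfolding distrib_right[symmetric] that by simp
      then show ?thesis
        unfolding concave_on_def convex_on_def
        by (simp del: mult_minus_right add: scaleR_left.add[symmetric])
    qed
    then obtain r where r: "sublinear_on X r" "\<And>x. x \<in> X \<Longrightarrow> r x \<le> m x" "r (- w) \<le> - m w"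
      using sublinear_hull[OF X sm, of "{w}" m] w by auto
    have "r x \<le> p x" if "x \<in> X" for x using r(2) that m by (force simp: A_def)
    then have "(\<lambda>x. if x \<in> X then r x else 0) = m"
      using r m by (intro min restr) (auto simp: A_def le_fun_def)
    from fun_cong[OF this, of "- w"] have "r (- w) = m (- w)" using w X by (simp add: subspace_neg)
    then show ?thesis using r(3) sublinear_minus[OF X sm w] by simp
  qed
  have "linear_functional_on X m" unfolding linear_functional_on_def
  proof (intro conjI ballI allI)
    fix x y assume x: "x \<in> X" and y: "y \<in> X"
    have "m (- x + - y) \<le> m (- x) + m (- y)"
      using x y X by (intro sublinear_add[OF X sm]) (auto simp: subspace_neg)
    moreover have "m (- x + - y) = - m (x + y)"
      using odd[of "x + y"] x y X by (simp add: subspace_add)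
    ultimately show "m (x + y) = m x + m y"
      using sublinear_add[OF X sm x y] odd[OF x] odd[OF y] by simp
  next
    fix c x assume x: "x \<in> X"
    show "m (c *\<^sub>R x) = c * m x"
    proof (cases "c \<ge> 0")
      case True
      then show ?thesis using sublinear_scale[OF X sm _ x] by simp
    next
      case False
      then have "m ((- c) *\<^sub>R x) = - c * m x" using sublinear_scale[OF X sm _ x, of "- c"] by simp
      moreover have "m (- (c *\<^sub>R x)) = - m (c *\<^sub>R x)" using odd[of "c *\<^sub>R x"] x X by (simp add: subspace_scale)
      ultimately show ?thesis by simp
    qed
  qed
  moreover have "\<And>x. x \<in> X \<Longrightarrow> m x \<le> p x" using m by (simp add: A_def)
  ultimately show ?thesis using that by blast
qed

section \<open>Exposing functionals\<close>

text \<open>The norm is attached to a set and not to a type: the same functions carry several norms,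
  and nothing is assumed of \<open>N\<close> outside \<open>X\<close>.\<close>

locale normed_subspace =
  fixes X :: "'v::real_vector set" and N :: "'v \<Rightarrow> real"
  assumes subspace: "subspace X"
    and nonneg: "x \<in> X \<Longrightarrow> 0 \<le> N x"
    and triangle: "x \<in> X \<Longrightarrow> y \<in> X \<Longrightarrow> N (x + y) \<le> N x + N y"
    and scale: "x \<in> X \<Longrightarrow> N (c *\<^sub>R x) = \<bar>c\<bar> * N x"
    and definite: "x \<in> X \<Longrightarrow> N x = 0 \<Longrightarrow> x = 0"
begin

definition real_dual :: "('v \<Rightarrow> real) set" where
  "real_dual = {\<phi>. linear_functional_on X \<phi> \<and> (\<exists>C. \<forall>x\<in>X. \<bar>\<phi> x\<bar> \<le> C * N x)}"

definition seq_closed :: "'v set \<Rightarrow> bool" where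
  "seq_closed T \<longleftrightarrow> (\<forall>s l. (\<forall>n. s n \<in> T) \<longrightarrow> l \<in> X \<longrightarrow> (\<lambda>n::nat. N (s n - l)) \<longlonglongrightarrow> 0 \<longrightarrow> l \<in> T)"

text \<open>That \<open>\<phi> b\<close> is the maximum on \<open>D\<close> is not demanded; for
  \<open>D\<close> inside \<open>X\<close> it follows, see
  \<open>strongly_exposes_maximum\<close>.\<close>

definition strongly_exposes :: "('v \<Rightarrow> real) \<Rightarrow> 'v set \<Rightarrow> 'v \<Rightarrow> bool" where
  "strongly_exposes \<phi> D b \<longleftrightarrow> \<phi> \<in> real_dual \<and> b \<in> D \<and>
     (\<forall>\<rho>>0. \<exists>\<delta>>0. \<forall>x\<in>D. \<phi> x > \<phi> b - \<delta> \<longrightarrow> N (x - b) < \<rho>)"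

text \<open>A slice is given by a threshold \<open>\<tau>\<close> that some value exceeds, instead
  of a distance to the supremum, so no supremum has to exist or be computed.\<close>

definition small_slice :: "real \<Rightarrow> ('v \<Rightarrow> real) \<Rightarrow> 'v set \<Rightarrow> bool" where
  "small_slice \<epsilon> \<phi> D \<longleftrightarrow> (\<exists>\<tau>. (\<exists>x\<in>D. \<phi> x > \<tau>) \<and>
     (\<forall>x\<in>D. \<forall>y\<in>D. \<phi> x > \<tau> \<longrightarrow> \<phi> y > \<tau> \<longrightarrow> N (x - y) \<le> \<epsilon>))"

text \<open>Neither closedness nor convexity of \<open>A\<close> is asked. The set of supported
  points in \<open>small_slice_dense\<close>, to which this is applied, need have neither
  property.\<close>

definition dentable :: bool where
  "dentable \<longleftrightarrow> (\<forall>A \<epsilon> M. A \<subseteq> X \<longrightarrow> A \<noteq> {} \<longrightarrow> (\<forall>x\<in>A. N x \<le> M) \<longrightarrow> \<epsilon> > 0 \<longrightarrow>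
     (\<exists>\<phi>\<in>real_dual. small_slice \<epsilon> \<phi> A))"

section \<open>Norm estimates, bounded real functionals and separation\<close>

lemma zero_mem: "0 \<in> X" and add_mem: "x \<in> X \<Longrightarrow> y \<in> X \<Longrightarrow> x + y \<in> X"
  and diff_mem: "x \<in> X \<Longrightarrow> y \<in> X \<Longrightarrow> x - y \<in> X"
  and scale_mem: "x \<in> X \<Longrightarrow> c *\<^sub>R x \<in> X" and neg_mem: "x \<in> X \<Longrightarrow> - x \<in> X"
  using subspace by (auto simp: subspace_0 subspace_add subspace_diff subspace_scale subspace_neg)

lemma norm_zero_eq: "N 0 = 0"
  using scale[OF zero_mem, of 0] by simp

lemma norm_minus: "x \<in> X \<Longrightarrow> N (- x) = N x"
  using scale[of x "-1"] by simp

lemma norm_diff_commute: "x \<in> X \<Longrightarrow> y \<in> X \<Longrightarrow> N (x - y) = N (y - x)"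
  using norm_minus[OF diff_mem, of x y] by simp

lemma norm_diff_triangle: "x \<in> X \<Longrightarrow> y \<in> X \<Longrightarrow> z \<in> X \<Longrightarrow> N (x - z) \<le> N (x - y) + N (y - z)"
  using triangle[OF diff_mem diff_mem, of x y y z] by simp

lemma norm_diff_le: "x \<in> X \<Longrightarrow> y \<in> X \<Longrightarrow> N (x - y) \<le> N x + N y"
  using triangle[OF _ neg_mem, of x y] norm_minus[of y] by simp

lemma linear_functional_diff:
  assumes "linear_functional_on X \<phi>" "x \<in> X" "y \<in> X"
  shows "\<phi> (x - y) = \<phi> x - \<phi> y"
proof -
  have "\<phi> (x + (-1) *\<^sub>R y) = \<phi> x + (-1) * \<phi> y"
    using assms scale_mem[of y "-1"] unfolding linear_functional_on_def by metis
  then show ?thesis by simp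
qed

lemma dual_diff: "\<phi> \<in> real_dual \<Longrightarrow> x \<in> X \<Longrightarrow> y \<in> X \<Longrightarrow> \<phi> (x - y) = \<phi> x - \<phi> y"
  using linear_functional_diff by (auto simp: real_dual_def)

lemma dual_add: "\<phi> \<in> real_dual \<Longrightarrow> x \<in> X \<Longrightarrow> y \<in> X \<Longrightarrow> \<phi> (x + y) = \<phi> x + \<phi> y"
  and dual_scale: "\<phi> \<in> real_dual \<Longrightarrow> x \<in> X \<Longrightarrow> \<phi> (c *\<^sub>R x) = c * \<phi> x"
  by (auto simp: real_dual_def linear_functional_on_def)

lemma dual_bound:
  assumes "\<phi> \<in> real_dual"
  obtains C where "C > 0" "\<And>x. x \<in> X \<Longrightarrow> \<bar>\<phi> x\<bar> \<le> C * N x"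
proof -
  obtain C where C: "\<And>x. x \<in> X \<Longrightarrow> \<bar>\<phi> x\<bar> \<le> C * N x" using assms by (auto simp: real_dual_def)
  have "\<bar>\<phi> x\<bar> \<le> (\<bar>C\<bar> + 1) * N x" if "x \<in> X" for x
    using C[OF that] mult_right_mono[OF _ nonneg[OF that], of C "\<bar>C\<bar> + 1"] by linarith
  then show ?thesis using that[of "\<bar>C\<bar> + 1"] by simp
qed

lemma dual_combine:
  assumes "\<phi> \<in> real_dual" "\<psi> \<in> real_dual"
  shows "(\<lambda>x. \<phi> x + t * \<psi> x) \<in> real_dual"
proof -
  obtain C where C: "C > 0" "\<And>x. x \<in> X \<Longrightarrow> \<bar>\<phi> x\<bar> \<le> C * N x" using assms dual_bound by metis
  obtain C' where C': "C' > 0" "\<And>x. x \<in> X \<Longrightarrow> \<bar>\<psi> x\<bar> \<le> C' * N x" using assms dual_bound by metis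
  have "\<bar>\<phi> x + t * \<psi> x\<bar> \<le> (C + \<bar>t\<bar> * C') * N x" if "x \<in> X" for x
  proof -
    have "\<bar>\<phi> x + t * \<psi> x\<bar> \<le> \<bar>\<phi> x\<bar> + \<bar>t\<bar> * \<bar>\<psi> x\<bar>"
      by (metis abs_mult abs_triangle_ineq)
    also have "\<dots> \<le> C * N x + \<bar>t\<bar> * (C' * N x)"
      using C(2)[OF that] C'(2)[OF that] by (intro add_mono mult_left_mono) auto
    finally show ?thesis by (simp add: algebra_simps)
  qed
  moreover have "linear_functional_on X (\<lambda>x. \<phi> x + t * \<psi> x)" using assms
    by (auto simp: real_dual_def linear_functional_on_def algebra_simps)
  ultimately show ?thesis unfolding real_dual_def by blast
qed

lemma dual_tendsto:
  assumes "\<phi> \<in> real_dual" "\<And>n. s n \<in> X" "l \<in> X" "(\<lambda>n. N (s n - l)) \<longlonglongrightarrow> 0"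
  shows "(\<lambda>n. \<phi> (s n)) \<longlonglongrightarrow> \<phi> l"
proof -
  obtain C where C: "C > 0" "\<And>x. x \<in> X \<Longrightarrow> \<bar>\<phi> x\<bar> \<le> C * N x" using assms dual_bound by metis
  have lim: "(\<lambda>n. C * N (s n - l)) \<longlonglongrightarrow> 0" using tendsto_mult_right_zero[OF assms(4)] .
  have "\<bar>\<phi> (s n) - \<phi> l\<bar> \<le> C * N (s n - l)" for n
    using C(2)[OF diff_mem, OF assms(2,3)] dual_diff[OF assms(1,2,3)] by simp
  then have "(\<lambda>n. \<phi> (s n) - \<phi> l) \<longlonglongrightarrow> 0"
    by (intro Lim_null_comparison[OF _ lim]) auto
  then show ?thesis by (simp add: LIM_zero_iff)
qed

lemma norm_tendsto:
  assumes "\<And>n. s n \<in> X" "l \<in> X" "z \<in> X" "(\<lambda>n. N (s n - l)) \<longlonglongrightarrow> 0"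
  shows "(\<lambda>n. N (s n - z)) \<longlonglongrightarrow> N (l - z)"
proof -
  have "\<bar>N (s n - z) - N (l - z)\<bar> \<le> N (s n - l)" for n
    using norm_diff_triangle[of "s n" l z] norm_diff_triangle[of l "s n" z] norm_diff_commute[of l "s n"] assms
    by force
  then have "(\<lambda>n. N (s n - z) - N (l - z)) \<longlonglongrightarrow> 0"
    by (intro Lim_null_comparison[OF _ assms(4)]) auto
  then show ?thesis by (simp add: LIM_zero_iff)
qed

lemma sublinear_norm: "0 \<le> \<kappa> \<Longrightarrow> sublinear_on X (\<lambda>x. \<kappa> * N x)"
  using triangle by (auto simp: sublinear_on_def norm_zero_eq scale distrib_left[symmetric] intro!: mult_left_mono)

text \<open>Hahn-Banach below the auxiliary functional of \<open>sublinear_hull\<close> for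
  \<open>\<kappa> * N\<close>; since the norm is symmetric, the upper bound at \<open>x\<close> and
  at \<open>- x\<close> gives the two-sided one.\<close>

lemma dominated_functional:
  assumes "Q \<subseteq> X" "Q \<noteq> {}" "concave_on Q h" "0 \<le> \<kappa>" "\<And>q. q \<in> Q \<Longrightarrow> h q \<le> \<kappa> * N q"
  obtains \<phi> where "\<phi> \<in> real_dual" "\<And>x. x \<in> X \<Longrightarrow> \<bar>\<phi> x\<bar> \<le> \<kappa> * N x" "\<And>q. q \<in> Q \<Longrightarrow> h q \<le> \<phi> q"
proof -
  obtain r where r: "sublinear_on X r" "\<And>x. x \<in> X \<Longrightarrow> r x \<le> \<kappa> * N x" "\<And>q. q \<in> Q \<Longrightarrow> r (- q) \<le> - h q"
    using sublinear_hull[OF subspace sublinear_norm[OF assms(4)] assms(1-3) assms(5)] by metis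
  obtain \<phi> where \<phi>: "linear_functional_on X \<phi>" "\<And>x. x \<in> X \<Longrightarrow> \<phi> x \<le> r x"
    using hahn_banach_dominated[OF subspace r(1)] by metis
  have neg: "\<phi> (- x) = - \<phi> x" if "x \<in> X" for x
    using linear_functional_diff[OF \<phi>(1) zero_mem that] linear_functional_diff[OF \<phi>(1) that that] by simp
  have b: "\<bar>\<phi> x\<bar> \<le> \<kappa> * N x" if "x \<in> X" for x
    using order.trans[OF \<phi>(2)[OF that] r(2)[OF that]]
      order.trans[OF \<phi>(2)[OF neg_mem[OF that]] r(2)[OF neg_mem[OF that]]]
    unfolding neg[OF that] norm_minus[OF that] by linarith
  moreover have "h q \<le> \<phi> q" if "q \<in> Q" for q
    using r(3)[OF that] \<phi>(2)[of "- q"] neg[of q] that assms(1) neg_mem by force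
  moreover have "\<phi> \<in> real_dual" using b \<phi>(1) by (auto simp: real_dual_def)
  ultimately show ?thesis using that by blast
qed

text \<open>The translated set \<open>x - T\<close> stays at some distance \<open>d\<close> from the
  origin, so the constant concave function \<open>d\<close> lies below the norm there; a functional
  between the two separates.\<close>

lemma separation:
  assumes T: "T \<subseteq> X" "T \<noteq> {}" "convex T" "seq_closed T" and x: "x \<in> X" "x \<notin> T"
  obtains \<phi> d where "\<phi> \<in> real_dual" "d > 0" "\<And>y. y \<in> T \<Longrightarrow> \<phi> y \<le> \<phi> x - d"
proof -
  have "\<exists>d>0. \<forall>y\<in>T. d \<le> N (y - x)"
  proof (rule ccontr)
    assume "\<not> ?thesis"
    then have "\<exists>y\<in>T. N (y - x) < inverse (real (Suc n))" for n
      by (metis not_less inverse_positive_iff_positive of_nat_0_less_iff zero_less_Suc)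
    then obtain s where s: "\<And>n. s n \<in> T" "\<And>n. N (s n - x) < inverse (real (Suc n))" by metis
    have "(\<lambda>n. N (s n - x)) \<longlonglongrightarrow> 0"
      using s(2) nonneg[OF diff_mem] s(1) T(1) x(1)
      by (intro Lim_null_comparison[OF _ LIMSEQ_inverse_real_of_nat])
        (auto intro!: always_eventually simp: less_imp_le subset_iff)
    then show False using T(4) s x unfolding seq_closed_def by blast
  qed
  then obtain d where d: "d > 0" "\<And>y. y \<in> T \<Longrightarrow> d \<le> N (y - x)" by blast
  define Q where "Q = (\<lambda>y. x - y) ` T"
  have Q: "convex Q" unfolding Q_def using convex_affinity[OF T(3), of x "-1"] by simp
  obtain \<phi> where \<phi>: "\<phi> \<in> real_dual" "\<And>q. q \<in> Q \<Longrightarrow> d \<le> \<phi> q"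
  proof (rule dominated_functional[of Q "\<lambda>_. d" 1])
    show "concave_on Q (\<lambda>_. d)" using Q by (simp add: concave_on_const)
    show "d \<le> 1 * N q" if "q \<in> Q" for q
      using that d(2) norm_diff_commute x T by (force simp: Q_def)
  qed (use T x in \<open>auto simp: Q_def diff_mem\<close>)
  have "\<phi> y \<le> \<phi> x - d" if "y \<in> T" for y
    using \<phi>(2)[of "x - y"] dual_diff[OF \<phi>(1) x(1), of y] that T(1) by (auto simp: Q_def)
  then show ?thesis using that \<phi> d by blast
qed

end

section \<open>Variational principle, supporting functionals and the consequences of
  dentability\<close>

locale banach_subspace = normed_subspace +
  assumes complete: "(\<And>n::nat. s n \<in> X) \<Longrightarrow> (\<And>\<epsilon>. \<epsilon> > 0 \<Longrightarrow> \<exists>M. \<forall>m\<ge>M. \<forall>n\<ge>M. N (s m - s n) < \<epsilon>) \<Longrightarrow>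
     \<exists>l\<in>X. (\<lambda>n. N (s n - l)) \<longlonglongrightarrow> 0"
begin

text \<open>Ekeland's principle for a functional: the relation "\<open>\<psi>\<close> gains at least
  \<open>\<kappa>\<close> times the distance travelled" is transitive. Climbing along it, each step
  realising half of the possible gain, gives a Cauchy sequence because \<open>\<psi>\<close> is
  bounded above on \<open>D\<close>. Nothing better than the limit is reachable from it.\<close>

lemma ekeland:
  assumes D: "D \<subseteq> X" "seq_closed D" and \<psi>: "\<psi> \<in> real_dual" and bdd: "\<And>x. x \<in> D \<Longrightarrow> \<psi> x \<le> S"
    and z: "z \<in> D" and \<kappa>: "\<kappa> > 0"
  obtains z' where "z' \<in> D" "\<psi> z + \<kappa> * N (z' - z) \<le> \<psi> z'" "\<And>y. y \<in> D \<Longrightarrow> \<psi> y \<le> \<psi> z' + \<kappa> * N (y - z')"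
proof -
  define R where "R x = {y \<in> D. \<psi> x + \<kappa> * N (y - x) \<le> \<psi> y}" for x
  have R_trans: "w \<in> R x" if "x \<in> D" "y \<in> R x" "w \<in> R y" for x y w
  proof -
    have m: "x \<in> X" "y \<in> X" "w \<in> X" using that D by (auto simp: R_def)
    have "\<kappa> * N (w - x) \<le> \<kappa> * (N (w - y) + N (y - x))"
      using norm_diff_triangle[OF m(3,2,1)] \<kappa> by simp
    then show ?thesis using that by (auto simp: R_def distrib_left)
  qed
  have R_self: "x \<in> R x" if "x \<in> D" for x
    using that D by (auto simp: R_def norm_zero_eq)
  \<comment> \<open>The inequality says that \<open>\<psi> y\<close> is at least the mean of
    \<open>\<psi> x\<close> and any value still reachable from \<open>x\<close>.\<close>
  have step: "\<exists>y. y \<in> D \<and> (y \<in> R x \<and> (\<forall>w\<in>R x. \<psi> w \<le> 2 * \<psi> y - \<psi> x))" if x: "x \<in> D" for x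
  proof -
    define B where "B = Sup (\<psi> ` R x)"
    have ba: "bdd_above (\<psi> ` R x)" using bdd by (auto simp: R_def intro!: bdd_aboveI[of _ S])
    have up: "\<psi> w \<le> B" if "w \<in> R x" for w
      unfolding B_def using that ba by (intro cSup_upper) auto
    show ?thesis
    proof (cases "\<psi> x < B")
      case True
      then have "(\<psi> x + B) / 2 < B" by simp
      then obtain y where y: "y \<in> R x" "(\<psi> x + B) / 2 < \<psi> y"
        using less_cSup_iff[OF _ ba, of "(\<psi> x + B) / 2"] R_self[OF x] unfolding B_def by blast
      have "\<psi> w \<le> 2 * \<psi> y - \<psi> x" if "w \<in> R x" for w
        using up[OF that] y(2) by (simp add: field_simps)
      then show ?thesis using y(1) unfolding R_def by blast
    next
      case False
      then have "\<psi> w \<le> 2 * \<psi> x - \<psi> x" if "w \<in> R x" for w using up[OF that] by simp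
      then show ?thesis using R_self[OF x] x by blast
    qed
  qed
  have "\<exists>s. \<forall>n. (s n \<in> D \<and> (n = 0 \<longrightarrow> s n = z)) \<and>
      (s (Suc n) \<in> R (s n) \<and> (\<forall>w\<in>R (s n). \<psi> w \<le> 2 * \<psi> (s (Suc n)) - \<psi> (s n)))"
  proof (rule dependent_nat_choice)
    show "\<exists>x. x \<in> D \<and> ((0::nat) = 0 \<longrightarrow> x = z)" using z by blast
  qed (use step in blast)
  then obtain s where s: "\<And>n. s n \<in> D" "s 0 = z" "\<And>n. s (Suc n) \<in> R (s n)"
    "\<And>n w. w \<in> R (s n) \<Longrightarrow> \<psi> w \<le> 2 * \<psi> (s (Suc n)) - \<psi> (s n)"
    by blast
  have sX: "s n \<in> X" for n using s(1) D by blast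
  have tail: "s m \<in> R (s n)" if "n \<le> m" for m n
    using that
  proof (induction m rule: dec_induct)
    case base
    show ?case using R_self s(1) by blast
  next
    case (step m)
    then show ?case using R_trans s(1,3) by blast
  qed
  have "incseq (\<lambda>n. \<psi> (s n))"
  proof (rule monoI)
    fix n m :: nat assume "n \<le> m"
    from tail[OF this] have "\<psi> (s n) + \<kappa> * N (s m - s n) \<le> \<psi> (s m)" by (simp add: R_def)
    then show "\<psi> (s n) \<le> \<psi> (s m)"
      using \<kappa> nonneg[OF diff_mem[OF sX sX], of m n] by (smt (verit) mult_nonneg_nonneg)
  qed
  then obtain L where L: "(\<lambda>n. \<psi> (s n)) \<longlonglongrightarrow> L"
    using incseq_convergent[of "\<lambda>n. \<psi> (s n)" S] bdd s(1) by blast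
  then have cau: "Cauchy (\<lambda>n. \<psi> (s n))" by (simp add: LIMSEQ_imp_Cauchy)
  have "\<exists>M. \<forall>m\<ge>M. \<forall>n\<ge>M. N (s m - s n) < \<epsilon>" if \<epsilon>: "\<epsilon> > 0" for \<epsilon>
  proof -
    obtain M where M: "\<And>m n. m \<ge> M \<Longrightarrow> n \<ge> M \<Longrightarrow> \<bar>\<psi> (s m) - \<psi> (s n)\<bar> < \<kappa> * \<epsilon>"
      using cau[unfolded Cauchy_def dist_real_def, rule_format, of "\<kappa> * \<epsilon>"] \<epsilon> \<kappa> by auto
    have le: "N (s m - s n) < \<epsilon>" if "M \<le> n" "n \<le> m" for m n
    proof -
      have "\<kappa> * N (s m - s n) \<le> \<psi> (s m) - \<psi> (s n)" using tail[OF that(2)] by (simp add: R_def)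
      also have "\<dots> < \<kappa> * \<epsilon>" using M[of m n] that by simp
      finally show ?thesis using \<kappa> by simp
    qed
    have "N (s m - s n) < \<epsilon>" if "M \<le> n" "M \<le> m" for m n
      using le[of n m] le[of m n] that norm_diff_commute[OF sX sX, of m n] by (metis linear)
    then show ?thesis by blast
  qed
  then obtain l where l: "l \<in> X" "(\<lambda>n. N (s n - l)) \<longlonglongrightarrow> 0"
    using complete[of s] sX by blast
  have lD: "l \<in> D" using D(2) s(1) l unfolding seq_closed_def by blast
  have \<psi>l: "(\<lambda>n. \<psi> (s n)) \<longlonglongrightarrow> \<psi> l" using dual_tendsto[OF \<psi> sX l] .
  have lR: "l \<in> R (s n)" for n
  proof -
    have "(\<lambda>m. \<psi> (s n) + \<kappa> * N (s m - s n)) \<longlonglongrightarrow> \<psi> (s n) + \<kappa> * N (l - s n)"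
      by (intro tendsto_intros norm_tendsto[OF sX l(1) sX l(2)])
    moreover have "\<forall>m\<ge>n. \<psi> (s n) + \<kappa> * N (s m - s n) \<le> \<psi> (s m)"
      using tail by (simp add: R_def)
    ultimately have "\<psi> (s n) + \<kappa> * N (l - s n) \<le> \<psi> l"
      using \<psi>l by (intro LIMSEQ_le[of "\<lambda>m. \<psi> (s n) + \<kappa> * N (s m - s n)"]) auto
    then show ?thesis using lD by (simp add: R_def)
  qed
  \<comment> \<open>A point reachable from \<open>l\<close> is reachable from every
    \<open>s n\<close>. The half-gain inequality then bounds its value, in the limit, by
    \<open>\<psi> l\<close>.\<close>
  have "\<psi> y \<le> \<psi> l + \<kappa> * N (y - l)" if y: "y \<in> D" for y
  proof (rule ccontr)
    assume neg: "\<not> ?thesis"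
    then have "y \<in> R l" using y by (simp add: R_def)
    then have "\<psi> y \<le> 2 * \<psi> (s (Suc n)) - \<psi> (s n)" for n
      using R_trans[OF s(1) lR] s(4) by blast
    moreover have "(\<lambda>n. 2 * \<psi> (s (Suc n)) - \<psi> (s n)) \<longlonglongrightarrow> 2 * \<psi> l - \<psi> l"
      by (intro tendsto_intros \<psi>l LIMSEQ_Suc)
    ultimately have "\<psi> y \<le> 2 * \<psi> l - \<psi> l" by (intro LIMSEQ_le_const) auto
    moreover have "0 \<le> \<kappa> * N (y - l)" using \<kappa> nonneg[OF diff_mem] y D l by auto
    ultimately show False using neg by simp
  qed
  moreover have "\<psi> z + \<kappa> * N (l - z) \<le> \<psi> l" using lR[of 0] s(2) by (simp add: R_def)
  ultimately show ?thesis using that lD by blast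
qed

text \<open>At the point given by \<open>ekeland\<close>, \<open>\<psi>\<close> stays below
  \<open>\<kappa> * N\<close> on the translate of \<open>D\<close> by \<open>- z'\<close>. A
  functional \<open>f\<close> between the two has size at most \<open>\<kappa>\<close>, and
  \<open>\<psi> - f\<close> attains its maximum over \<open>D\<close> at \<open>z'\<close>. The
  slack \<open>\<kappa> * \<kappa>\<close> is what buys both the distance \<open>\<kappa>\<close>
  and the perturbation \<open>\<kappa>\<close>.\<close>

lemma bishop_phelps_bollobas:
  assumes D: "D \<subseteq> X" "seq_closed D" "convex D" and \<psi>: "\<psi> \<in> real_dual" and \<kappa>: "\<kappa> > 0"
    and z: "z \<in> D" and near: "\<And>x. x \<in> D \<Longrightarrow> \<psi> x \<le> \<psi> z + \<kappa> * \<kappa>"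
  obtains z' \<theta> where "z' \<in> D" "N (z' - z) \<le> \<kappa>" "\<theta> \<in> real_dual" "\<And>x. x \<in> X \<Longrightarrow> \<bar>\<theta> x - \<psi> x\<bar> \<le> \<kappa> * N x"
    "\<And>x. x \<in> D \<Longrightarrow> \<theta> x \<le> \<theta> z'"
proof -
  obtain z' where z': "z' \<in> D" "\<psi> z + \<kappa> * N (z' - z) \<le> \<psi> z'"
      "\<And>y. y \<in> D \<Longrightarrow> \<psi> y \<le> \<psi> z' + \<kappa> * N (y - z')"
    using ekeland[OF D(1,2) \<psi> near z \<kappa>] by metis
  have "\<kappa> * N (z' - z) \<le> \<kappa> * \<kappa>" using z'(2) near[OF z'(1)] by simp
  then have close: "N (z' - z) \<le> \<kappa>" using \<kappa> by simp
  define Q where "Q = (\<lambda>y. y - z') ` D"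
  have QX: "Q \<subseteq> X" using D(1) z'(1) by (auto simp: Q_def intro!: diff_mem)
  have "convex Q" using convex_translation[OF D(3), of "- z'"] by (simp add: Q_def)
  then have "concave_on Q \<psi>" unfolding concave_on_def convex_on_def
    using QX dual_add[OF \<psi>] dual_scale[OF \<psi>] scale_mem by (auto simp: subset_iff)
  then obtain f where f: "f \<in> real_dual" "\<And>x. x \<in> X \<Longrightarrow> \<bar>f x\<bar> \<le> \<kappa> * N x" "\<And>q. q \<in> Q \<Longrightarrow> \<psi> q \<le> f q"
  proof (rule dominated_functional[rotated 2])
    show "\<psi> q \<le> \<kappa> * N q" if "q \<in> Q" for q
      using that z'(3) dual_diff[OF \<psi>] z'(1) D(1) by (force simp: Q_def)
  qed (use QX z'(1) \<kappa> in \<open>auto simp: Q_def\<close>)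
  have "\<psi> x + (-1) * f x \<le> \<psi> z' + (-1) * f z'" if "x \<in> D" for x
  proof -
    have "\<psi> (x - z') \<le> f (x - z')" using f(3) that by (auto simp: Q_def)
    then show ?thesis using dual_diff[OF \<psi>, of x z'] dual_diff[OF f(1), of x z'] that z'(1) D(1)
      by (simp add: subset_iff)
  qed
  then show ?thesis
    using that[OF z'(1) close dual_combine[OF \<psi> f(1), of "-1"]] f(2) by simp
qed

lemma near_maximum:
  assumes D: "D \<subseteq> X" "D \<noteq> {}" "\<And>x. x \<in> D \<Longrightarrow> N x \<le> M" and \<phi>: "\<phi> \<in> real_dual" and \<delta>: "\<delta> > 0"
  obtains z where "z \<in> D" "\<And>x. x \<in> D \<Longrightarrow> \<phi> x \<le> \<phi> z + \<delta>"
proof -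
  obtain C where C: "C > 0" "\<And>x. x \<in> X \<Longrightarrow> \<bar>\<phi> x\<bar> \<le> C * N x" using dual_bound[OF \<phi>] by metis
  have "\<phi> x \<le> C * M" if "x \<in> D" for x
  proof -
    have "C * N x \<le> C * M" using D(3)[OF that] C(1) by simp
    then show ?thesis using C(2)[of x] that D(1) by (smt (verit) subset_iff)
  qed
  then have ba: "bdd_above (\<phi> ` D)" by (auto intro!: bdd_aboveI)
  have "Sup (\<phi> ` D) - \<delta> < Sup (\<phi> ` D)" using \<delta> by simp
  then obtain z where z: "z \<in> D" "Sup (\<phi> ` D) - \<delta> < \<phi> z"
    using less_cSup_iff[OF _ ba] D(2) by blast
  have "\<phi> x \<le> \<phi> z + \<delta>" if "x \<in> D" for x
    using cSup_upper[OF _ ba, of "\<phi> x"] that z(2) by auto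
  then show ?thesis using that z by blast
qed

text \<open>If \<open>x\<close> maximises \<open>\<psi>\<close> and \<open>z\<close> maximises a functional close to \<open>\<psi> + t y\<close>, then \<open>y z\<close> is
  almost as large as \<open>y x\<close> (monotonicity of the subdifferential). Hence a small slice, cut by \<open>y\<close>,
  of the set of points of \<open>D\<close> supported by functionals near \<open>\<phi>\<close> traps a whole slice of \<open>D\<close>.\<close>

lemma small_slice_dense:
  assumes dent: dentable and D: "D \<subseteq> X" "D \<noteq> {}" "seq_closed D" "convex D" "\<And>x. x \<in> D \<Longrightarrow> N x \<le> M"
    and \<phi>: "\<phi> \<in> real_dual" and \<eta>: "\<eta> > 0" and \<epsilon>: "\<epsilon> > 0"
  obtains \<psi> where "\<psi> \<in> real_dual" "\<And>x. x \<in> X \<Longrightarrow> \<bar>\<psi> x - \<phi> x\<bar> \<le> \<eta> * N x" "small_slice \<epsilon> \<psi> D"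
proof -
  \<comment> \<open>The strict bound \<open>\<eta>' < \<eta>\<close> leaves room to perturb the
    supporting functional of a point of \<open>A\<close> once more without leaving the
    \<open>\<eta>\<close>-ball around \<open>\<phi>\<close>.\<close>
  define A where "A = {x \<in> D. \<exists>\<psi>\<in>real_dual. \<exists>\<eta>'<\<eta>. (\<forall>v\<in>X. \<bar>\<psi> v - \<phi> v\<bar> \<le> \<eta>' * N v) \<and> (\<forall>z\<in>D. \<psi> z \<le> \<psi> x)}"
  have "A \<noteq> {}"
  proof -
    obtain z where z: "z \<in> D" "\<And>x. x \<in> D \<Longrightarrow> \<phi> x \<le> \<phi> z + (\<eta>/2) * (\<eta>/2)"
      using near_maximum[OF D(1,2,5) \<phi>, of "(\<eta>/2) * (\<eta>/2)"] \<eta> by (metis mult_pos_pos half_gt_zero)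
    obtain z' \<theta> where "z' \<in> D" "\<theta> \<in> real_dual" "\<And>x. x \<in> X \<Longrightarrow> \<bar>\<theta> x - \<phi> x\<bar> \<le> (\<eta>/2) * N x"
      "\<And>x. x \<in> D \<Longrightarrow> \<theta> x \<le> \<theta> z'"
      using bishop_phelps_bollobas[OF D(1,3,4) \<phi> _ z(1), of "\<eta>/2"] z(2) \<eta> by (metis half_gt_zero)
    moreover have "\<eta>/2 < \<eta>" using \<eta> by simp
    ultimately have "z' \<in> A" unfolding A_def by blast
    then show ?thesis by blast
  qed
  moreover have AD: "A \<subseteq> D" by (auto simp: A_def)
  ultimately obtain y where y: "y \<in> real_dual" "small_slice (\<epsilon>/3) y A"
    using dent[unfolded dentable_def, rule_format, of A M "\<epsilon>/3"] D(1,5) \<epsilon> by auto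
  then obtain \<tau> x where x: "x \<in> A" "y x > \<tau>"
    and small: "\<And>u v. u \<in> A \<Longrightarrow> v \<in> A \<Longrightarrow> y u > \<tau> \<Longrightarrow> y v > \<tau> \<Longrightarrow> N (u - v) \<le> \<epsilon>/3"
    unfolding small_slice_def by blast
  obtain \<psi> \<eta>' where \<psi>: "\<psi> \<in> real_dual" "\<eta>' < \<eta>" "\<And>v. v \<in> X \<Longrightarrow> \<bar>\<psi> v - \<phi> v\<bar> \<le> \<eta>' * N v"
      "\<And>z. z \<in> D \<Longrightarrow> \<psi> z \<le> \<psi> x"
    using x(1) unfolding A_def by blast
  obtain C where C: "C > 0" "\<And>x. x \<in> X \<Longrightarrow> \<bar>y x\<bar> \<le> C * N x" using dual_bound[OF y(1)] by metis
  \<comment> \<open>A quarter of the remaining room: adding \<open>t * y\<close> costs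
    \<open>g\<close>, the later support functional costs at most another \<open>g\<close>, and the
    total stays strictly below \<open>\<eta>\<close>.\<close>
  define g where "g = (\<eta> - \<eta>') / 4"
  have g: "g > 0" and \<eta>g: "\<eta> = \<eta>' + 4 * g" using \<psi>(2) by (simp_all add: g_def field_simps)
  define t where "t = g / C"
  have t: "t > 0" using g C(1) by (simp add: t_def)
  define \<psi>' where "\<psi>' = (\<lambda>v. \<psi> v + t * y v)"
  have \<psi>'d: "\<psi>' \<in> real_dual" unfolding \<psi>'_def using dual_combine[OF \<psi>(1) y(1)] .
  have \<psi>': "\<bar>\<psi>' v - \<phi> v\<bar> \<le> (\<eta>' + g) * N v" if "v \<in> X" for v
  proof -
    have "\<bar>t * y v\<bar> \<le> t * (C * N v)" using C(2)[OF that] t by (simp add: abs_mult)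
    also have "\<dots> = g * N v" using C(1) by (simp add: t_def)
    finally show ?thesis using \<psi>(3)[OF that] by (simp add: \<psi>'_def distrib_right)
  qed
  define M' where "M' = \<bar>M\<bar> + 1"
  have M': "M' > 0" "\<And>x. x \<in> D \<Longrightarrow> N x \<le> M'" using D(5) by (force simp: M'_def)+
  \<comment> \<open>The bound \<open>g\<close> keeps the support functional admissible for
    \<open>A\<close>. The bound \<open>\<epsilon> / 3\<close> lets the two displacements and the
    small slice of \<open>A\<close> add up to \<open>\<epsilon>\<close>. The last bound makes the
    error \<open>\<kappa> * (2 * M')\<close> smaller than \<open>t * (y x - \<tau>)\<close>.\<close>
  define \<kappa> where "\<kappa> = min (min g (\<epsilon>/3)) (t * (y x - \<tau>) / (3 * M'))"
  have \<kappa>: "\<kappa> > 0" "\<kappa> \<le> g" "\<kappa> \<le> \<epsilon>/3" "\<kappa> \<le> t * (y x - \<tau>) / (3 * M')"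
    using g \<epsilon> t x(2) M'(1) by (auto simp: \<kappa>_def)
  have \<kappa>4: "\<kappa> * (2 * M') < t * (y x - \<tau>)"
  proof -
    have "\<kappa> * (3 * M') \<le> t * (y x - \<tau>)" using \<kappa>(4) M'(1) by (simp add: field_simps)
    moreover have "\<kappa> * M' > 0" using \<kappa>(1) M'(1) by simp
    ultimately show ?thesis by simp
  qed
  have xD: "x \<in> D" using x(1) AD by blast
  have trap: "\<exists>z'\<in>A. y z' > \<tau> \<and> N (z' - z) \<le> \<kappa>"
    if z: "z \<in> D" "\<And>w. w \<in> D \<Longrightarrow> \<psi>' w \<le> \<psi>' z + \<kappa> * \<kappa>" for z
  proof -
    obtain z' \<theta> where z': "z' \<in> D" "N (z' - z) \<le> \<kappa>" "\<theta> \<in> real_dual" "\<And>v. v \<in> X \<Longrightarrow> \<bar>\<theta> v - \<psi>' v\<bar> \<le> \<kappa> * N v"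
      "\<And>w. w \<in> D \<Longrightarrow> \<theta> w \<le> \<theta> z'"
      using bishop_phelps_bollobas[OF D(1,3,4) \<psi>'d \<kappa>(1) z] by metis
    have "\<bar>\<theta> v - \<phi> v\<bar> \<le> (\<eta>' + g + \<kappa>) * N v" if "v \<in> X" for v
      using \<psi>'[OF that] z'(4)[OF that] by (simp add: distrib_right)
    moreover have "\<eta>' + g + \<kappa> < \<eta>" using \<kappa>(2) g \<eta>g by linarith
    ultimately have "z' \<in> A" unfolding A_def using z'(1,3,5) by blast
    moreover have "y z' > \<tau>"
    proof -
      have X: "z' \<in> X" "x \<in> X" using z'(1) xD D(1) by auto
      have "\<bar>\<theta> (x - z') - \<psi>' (x - z')\<bar> \<le> \<kappa> * N (x - z')" using z'(4) X diff_mem by blast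
      also have "\<dots> \<le> \<kappa> * (2 * M')"
        using norm_diff_le[OF X(2,1)] M'(2)[OF xD] M'(2)[OF z'(1)] \<kappa>(1) by (intro mult_left_mono) auto
      also note \<kappa>4
      \<comment> \<open>Maximality of \<open>z'\<close> for \<open>\<theta>\<close> removes the last
        term, and maximality of \<open>x\<close> for \<open>\<psi>\<close> removes the
        \<open>\<psi>\<close> part of the left side. Only the comparison of \<open>y z'\<close> with
        \<open>\<tau>\<close> survives.\<close>
      finally have "\<psi>' (x - z') < t * (y x - \<tau>) + \<theta> (x - z')" by linarith
      moreover have "\<theta> (x - z') \<le> 0" using dual_diff[OF z'(3) X(2,1)] z'(5)[OF xD] by simp
      moreover have "\<psi>' (x - z') = (\<psi> x - \<psi> z') + t * (y x - y z')"
        using dual_diff[OF \<psi>(1) X(2,1)] dual_diff[OF y(1) X(2,1)] by (simp add: \<psi>'_def)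
      moreover have "\<psi> z' \<le> \<psi> x" using \<psi>(4) z'(1) by blast
      ultimately have "t * (y x - y z') < t * (y x - \<tau>)" by linarith
      then show ?thesis using t by simp
    qed
    ultimately show ?thesis using z'(2) by blast
  qed
  \<comment> \<open>Half of the slack is spent on \<open>z0\<close> and half on the depth of the
    slice, so every point of the slice is maximal up to \<open>\<kappa> * \<kappa>\<close> and
    \<open>trap\<close> applies to it.\<close>
  have "\<kappa> * \<kappa> / 2 > 0" using \<kappa>(1) by simp
  then obtain z0 where z0: "z0 \<in> D" "\<And>w. w \<in> D \<Longrightarrow> \<psi>' w \<le> \<psi>' z0 + \<kappa> * \<kappa> / 2"
    using near_maximum[OF D(1,2,5) \<psi>'d] by metis
  have "N (u - v) \<le> \<epsilon>" if uv: "u \<in> D" "v \<in> D" "\<psi>' u > \<psi>' z0 - \<kappa> * \<kappa> / 2" "\<psi>' v > \<psi>' z0 - \<kappa> * \<kappa> / 2" for u v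
  proof -
    obtain u' where u': "u' \<in> A" "y u' > \<tau>" "N (u' - u) \<le> \<kappa>" using trap[OF uv(1)] z0(2) uv(3) by (smt (verit) field_sum_of_halves)
    obtain v' where v': "v' \<in> A" "y v' > \<tau>" "N (v' - v) \<le> \<kappa>" using trap[OF uv(2)] z0(2) uv(4) by (smt (verit) field_sum_of_halves)
    have m: "u \<in> X" "v \<in> X" "u' \<in> X" "v' \<in> X" using uv u' v' AD D(1) by auto
    have "N (u - v) \<le> N (u - u') + N (u' - v') + N (v' - v)"
      using norm_diff_triangle[OF m(1,3,2)] norm_diff_triangle[OF m(3,4,2)] by simp
    then show ?thesis using u'(3) v'(3) small[OF u'(1) v'(1) u'(2) v'(2)] norm_diff_commute[OF m(1,3)] \<kappa>(3) by simp
  qed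
  moreover have "\<exists>u\<in>D. \<psi>' u > \<psi>' z0 - \<kappa> * \<kappa> / 2" using z0(1) \<kappa>(1) by (intro bexI[of _ z0]) auto
  ultimately have "small_slice \<epsilon> \<psi>' D" unfolding small_slice_def by blast
  moreover have "\<bar>\<psi>' v - \<phi> v\<bar> \<le> \<eta> * N v" if "v \<in> X" for v
  proof -
    have "(\<eta>' + g) * N v \<le> \<eta> * N v" using g \<eta>g nonneg[OF that] by (intro mult_right_mono) linarith+
    then show ?thesis using \<psi>'[OF that] by simp
  qed
  ultimately show ?thesis using that \<psi>'d by blast
qed

text \<open>A perturbation of size \<open>c / M'\<close> moves the values on \<open>D\<close> by at
  most \<open>c\<close>. As \<open>\<phi> x\<close> exceeds the old threshold by
  \<open>3 * c\<close>, raising the threshold by \<open>c\<close> keeps \<open>x\<close> in the new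
  slice and the new slice inside the old one.\<close>

lemma small_slice_open:
  assumes D: "D \<subseteq> X" "\<And>x. x \<in> D \<Longrightarrow> N x \<le> M" and small: "small_slice \<epsilon> \<phi> D"
  obtains r where "r > 0" "\<And>\<psi>. (\<And>x. x \<in> X \<Longrightarrow> \<bar>\<psi> x - \<phi> x\<bar> \<le> r * N x) \<Longrightarrow> small_slice \<epsilon> \<psi> D"
proof -
  obtain \<tau> x where x: "x \<in> D" "\<phi> x > \<tau>"
    and sm: "\<And>u v. u \<in> D \<Longrightarrow> v \<in> D \<Longrightarrow> \<phi> u > \<tau> \<Longrightarrow> \<phi> v > \<tau> \<Longrightarrow> N (u - v) \<le> \<epsilon>"
    using small unfolding small_slice_def by blast
  define M' where "M' = \<bar>M\<bar> + 1"
  have M': "M' > 0" "\<And>x. x \<in> D \<Longrightarrow> N x \<le> M'" using D(2) by (force simp: M'_def)+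
  define c where "c = (\<phi> x - \<tau>) / 3"
  have c: "c > 0" "\<phi> x = \<tau> + 3 * c" using x(2) by (simp_all add: c_def field_simps)
  define r where "r = c / M'"
  have r: "r > 0" using c(1) M'(1) by (simp add: r_def)
  have rM: "r * M' = c" using M'(1) by (simp add: r_def)
  have "small_slice \<epsilon> \<psi> D" if \<psi>: "\<And>x. x \<in> X \<Longrightarrow> \<bar>\<psi> x - \<phi> x\<bar> \<le> r * N x" for \<psi>
  proof -
    have close: "\<bar>\<psi> u - \<phi> u\<bar> \<le> c" if "u \<in> D" for u
    proof -
      have "r * N u \<le> r * M'" using M'(2)[OF that] r by simp
      moreover have "\<bar>\<psi> u - \<phi> u\<bar> \<le> r * N u" using \<psi> that D(1) by blast
      ultimately show ?thesis using rM by linarith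
    qed
    have "\<psi> x > \<tau> + c" using close[OF x(1)] c by linarith
    moreover have "N (u - v) \<le> \<epsilon>"
      if "u \<in> D" "v \<in> D" "\<psi> u > \<tau> + c" "\<psi> v > \<tau> + c" for u v
      using close[OF that(1)] close[OF that(2)] that by (intro sm) linarith+
    ultimately show ?thesis unfolding small_slice_def using x(1) by blast
  qed
  then show ?thesis using that r by blast
qed

text \<open>A maximising sequence eventually enters every nonempty slice, so small slices make it
  Cauchy; its limit attains the maximum and lies in all these slices.\<close>

lemma strongly_exposes_of_small_slices:
  assumes D: "D \<subseteq> X" "D \<noteq> {}" "seq_closed D" "\<And>x. x \<in> D \<Longrightarrow> N x \<le> M"
    and \<psi>: "\<psi> \<in> real_dual" and small: "\<And>\<epsilon>. \<epsilon> > 0 \<Longrightarrow> small_slice \<epsilon> \<psi> D"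
  obtains b where "strongly_exposes \<psi> D b" "\<And>x. x \<in> D \<Longrightarrow> \<psi> x \<le> \<psi> b"
proof -
  have "\<exists>z\<in>D. \<forall>x\<in>D. \<psi> x \<le> \<psi> z + inverse (real (Suc n))" for n
    using near_maximum[OF D(1,2,4) \<psi>, of "inverse (real (Suc n))"]
    by (metis inverse_positive_iff_positive of_nat_0_less_iff zero_less_Suc)
  then obtain s where s: "\<And>n. s n \<in> D" "\<And>n x. x \<in> D \<Longrightarrow> \<psi> x \<le> \<psi> (s n) + inverse (real (Suc n))"
    by metis
  have sX: "s n \<in> X" for n using s(1) D(1) by blast
  have slice: "\<exists>M. \<forall>n\<ge>M. \<psi> (s n) > \<tau>" if x: "x \<in> D" "\<psi> x > \<tau>" for x \<tau>
  proof -
    obtain M where M: "inverse (real (Suc M)) < \<psi> x - \<tau>" using reals_Archimedean[of "\<psi> x - \<tau>"] x(2) by auto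
    have "\<psi> (s n) > \<tau>" if "n \<ge> M" for n
    proof -
      have "inverse (real (Suc n)) \<le> inverse (real (Suc M))" using that by (intro le_imp_inverse_le) auto
      then show ?thesis using s(2)[OF \<open>x \<in> D\<close>, of n] M by linarith
    qed
    then show ?thesis by blast
  qed
  have "\<exists>M. \<forall>m\<ge>M. \<forall>n\<ge>M. N (s m - s n) < \<epsilon>" if \<epsilon>: "\<epsilon> > 0" for \<epsilon>
  proof -
    obtain \<tau> x where x: "x \<in> D" "\<psi> x > \<tau>"
      and sm: "\<And>u v. u \<in> D \<Longrightarrow> v \<in> D \<Longrightarrow> \<psi> u > \<tau> \<Longrightarrow> \<psi> v > \<tau> \<Longrightarrow> N (u - v) \<le> \<epsilon> / 2"
      using small[of "\<epsilon>/2"] \<epsilon> unfolding small_slice_def by auto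
    obtain M where M: "\<And>n. n \<ge> M \<Longrightarrow> \<psi> (s n) > \<tau>" using slice[OF x] by blast
    have "N (s m - s n) < \<epsilon>" if "m \<ge> M" "n \<ge> M" for m n
      using sm[OF s(1) s(1) M M, OF that] \<epsilon> by linarith
    then show ?thesis by blast
  qed
  then obtain b where b: "b \<in> X" "(\<lambda>n. N (s n - b)) \<longlonglongrightarrow> 0"
    using complete[of s] sX by blast
  have bD: "b \<in> D" using D(3) s(1) b unfolding seq_closed_def by blast
  have max: "\<psi> x \<le> \<psi> b" if "x \<in> D" for x
  proof -
    have "(\<lambda>n. \<psi> (s n) + inverse (real (Suc n))) \<longlonglongrightarrow> \<psi> b + 0"
      by (intro tendsto_intros dual_tendsto[OF \<psi> sX b] LIMSEQ_inverse_real_of_nat)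
    then show ?thesis using s(2)[OF that] by (intro LIMSEQ_le_const[of _ "\<psi> b"]) auto
  qed
  have "\<exists>\<delta>>0. \<forall>x\<in>D. \<psi> x > \<psi> b - \<delta> \<longrightarrow> N (x - b) < \<rho>" if \<rho>: "\<rho> > 0" for \<rho>
  proof -
    obtain \<tau> x where x: "x \<in> D" "\<psi> x > \<tau>"
      and sm: "\<And>u v. u \<in> D \<Longrightarrow> v \<in> D \<Longrightarrow> \<psi> u > \<tau> \<Longrightarrow> \<psi> v > \<tau> \<Longrightarrow> N (u - v) \<le> \<rho> / 2"
      using small[of "\<rho>/2"] \<rho> unfolding small_slice_def by auto
    have b\<tau>: "\<psi> b > \<tau>" using max[OF x(1)] x(2) by simp
    have "N (u - b) < \<rho>" if "u \<in> D" "\<psi> u > \<psi> b - (\<psi> b - \<tau>)" for u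
      using sm[OF that(1) bD _ b\<tau>] that(2) \<rho> by simp
    then show ?thesis using b\<tau> by (intro exI[of _ "\<psi> b - \<tau>"]) auto
  qed
  then show ?thesis using that max bD \<psi> unfolding strongly_exposes_def by blast
qed

text \<open>The Baire argument in the dual, written out: the functionals with a slice of diameter
  \<open>inverse n\<close> are dense by \<open>small_slice_dense\<close> and stable under small
  perturbation by \<open>small_slice_open\<close>. A limit of nested balls lies in all these
  sets.\<close>

lemma strongly_exposing_dense:
  assumes dent: dentable and D: "D \<subseteq> X" "D \<noteq> {}" "seq_closed D" "convex D" "\<And>x. x \<in> D \<Longrightarrow> N x \<le> M"
    and \<phi>: "\<phi> \<in> real_dual" and \<eta>: "\<eta> > 0"
  obtains \<psi> b where "\<And>x. x \<in> X \<Longrightarrow> \<bar>\<psi> x - \<phi> x\<bar> \<le> \<eta> * N x" "strongly_exposes \<psi> D b" "\<And>x. x \<in> D \<Longrightarrow> \<psi> x \<le> \<psi> b"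
proof -
  \<comment> \<open>A state is a ball in the dual, given by centre and radius, all of whose members
    have a slice of diameter \<open>inverse n\<close>. Stage 0 is the prescribed ball and carries no
    slice condition.\<close>
  define P where "P n z \<longleftrightarrow> fst z \<in> real_dual \<and> (snd z :: real) > 0 \<and> (n = 0 \<longrightarrow> z = (\<phi>, \<eta>)) \<and>
      (n > 0 \<longrightarrow> (\<forall>\<psi>. (\<forall>x\<in>X. \<bar>\<psi> x - fst z x\<bar> \<le> snd z * N x) \<longrightarrow> small_slice (inverse (real n)) \<psi> D))"
    for n and z :: "('a \<Rightarrow> real) \<times> real"
  define Q where "Q z w \<longleftrightarrow> snd w \<le> snd z / 2 \<and> (\<forall>x\<in>X. \<bar>fst w x - fst z x\<bar> \<le> snd z / 2 * N x)"
    for z w :: "('a \<Rightarrow> real) \<times> real"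
  have step: "\<exists>w. P (Suc n) w \<and> Q z w" if z: "P n z" for n z
  proof -
    have "fst z \<in> real_dual" "snd z / 2 > 0" "inverse (real (Suc n)) > 0" using z by (auto simp: P_def)
    then obtain \<psi> where \<psi>: "\<psi> \<in> real_dual" "\<And>x. x \<in> X \<Longrightarrow> \<bar>\<psi> x - fst z x\<bar> \<le> snd z / 2 * N x"
        "small_slice (inverse (real (Suc n))) \<psi> D"
      using small_slice_dense[OF dent D] by metis
    obtain r where r: "r > 0" "\<And>\<theta>. (\<And>x. x \<in> X \<Longrightarrow> \<bar>\<theta> x - \<psi> x\<bar> \<le> r * N x) \<Longrightarrow> small_slice (inverse (real (Suc n))) \<theta> D"
      using small_slice_open[OF D(1,5) \<psi>(3)] by metis
    define r' where "r' = min r (snd z / 2)"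
    have "small_slice (inverse (real (Suc n))) \<theta> D" if \<theta>: "\<forall>x\<in>X. \<bar>\<theta> x - \<psi> x\<bar> \<le> r' * N x" for \<theta>
    proof (rule r(2))
      fix x assume x: "x \<in> X"
      have "r' * N x \<le> r * N x" using nonneg[OF x] by (intro mult_right_mono) (auto simp: r'_def)
      then show "\<bar>\<theta> x - \<psi> x\<bar> \<le> r * N x" using \<theta> x by force
    qed
    moreover have "r' > 0" "r' \<le> snd z / 2" using r(1) \<open>snd z / 2 > 0\<close> by (auto simp: r'_def)
    ultimately have "P (Suc n) (\<psi>, r') \<and> Q z (\<psi>, r')" using \<psi> by (auto simp: P_def Q_def)
    then show ?thesis by blast
  qed
  have "\<exists>f. \<forall>n. P n (f n) \<and> Q (f n) (f (Suc n))"
    using \<phi> \<eta> step by (intro dependent_nat_choice) (auto simp: P_def)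
  then obtain f where f: "\<And>n. P n (f n)" "\<And>n. Q (f n) (f (Suc n))" by blast
  define F r where "F n = fst (f n)" and "r n = snd (f n)" for n
  have r0: "r n > 0" for n using f(1)[of n] by (simp add: P_def r_def)
  have r_step: "r (Suc n) \<le> r n / 2" for n using f(2)[of n] by (simp add: Q_def r_def)
  \<comment> \<open>Since the radii at least halve, \<open>r n / 2\<close> is at most
    \<open>r n - r (Suc n)\<close>, and in this form the steps telescope.\<close>
  have F_step: "\<bar>F (Suc n) x - F n x\<bar> \<le> (r n - r (Suc n)) * N x" if x: "x \<in> X" for n x
  proof -
    have "\<bar>F (Suc n) x - F n x\<bar> \<le> r n / 2 * N x" using f(2)[of n] x by (simp add: Q_def F_def r_def)
    also have "\<dots> \<le> (r n - r (Suc n)) * N x" using r_step[of n] nonneg[OF x] by (intro mult_right_mono) auto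
    finally show ?thesis .
  qed
  have F_tail: "\<bar>F m x - F n x\<bar> \<le> r n * N x" if x: "x \<in> X" and "n \<le> m" for m n x
  proof -
    have "\<bar>F m x - F n x\<bar> \<le> (r n - r m) * N x"
      using that(2)
    proof (induction m rule: dec_induct)
      case base
      show ?case by simp
    next
      case (step m)
      then show ?case using F_step[OF x, of m] by (simp add: left_diff_distrib)
    qed
    moreover have "0 \<le> r m * N x" using r0[of m] nonneg[OF x] by simp
    ultimately show ?thesis by (simp add: left_diff_distrib)
  qed
  have r_le: "r n \<le> \<eta> * (1/2) ^ n" for n
  proof (induction n)
    case 0
    then show ?case using f(1)[of 0] by (simp add: P_def r_def)
  next
    case (Suc n)
    then show ?case using r_step[of n] by simp
  qed
  have "(\<lambda>n. \<eta> * (1/2) ^ n) \<longlonglongrightarrow> \<eta> * 0" by (intro tendsto_intros LIMSEQ_power_zero) auto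
  then have r_lim: "r \<longlonglongrightarrow> 0"
    using r_le r0 by (intro tendsto_sandwich[of "\<lambda>_. 0" r]) (auto intro: always_eventually less_imp_le)
  have "convergent (\<lambda>n. F n x)" if x: "x \<in> X" for x
  proof -
    have "Cauchy (\<lambda>n. F n x)"
    proof (rule CauchyI')
      fix e :: real assume e: "e > 0"
      have "(\<lambda>n. r n * N x) \<longlonglongrightarrow> 0" using tendsto_mult_left_zero[OF r_lim] .
      then obtain M where M: "\<And>n. n \<ge> M \<Longrightarrow> \<bar>r n * N x\<bar> < e"
        using LIMSEQ_D[of "\<lambda>n. r n * N x" 0 e] e by auto
      show "\<exists>M. \<forall>m\<ge>M. \<forall>n>m. dist (F m x) (F n x) < e"
      proof (intro exI[of _ M] allI impI)
        fix m n assume mn: "m \<ge> M" "n > m"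
        show "dist (F m x) (F n x) < e" using F_tail[OF x, of m n] M[of m] mn by (simp add: dist_real_def)
      qed
    qed
    then show ?thesis by (simp add: Cauchy_convergent_iff)
  qed
  then obtain \<psi> where \<psi>: "\<And>x. x \<in> X \<Longrightarrow> (\<lambda>n. F n x) \<longlonglongrightarrow> \<psi> x"
    unfolding convergent_def by metis
  have \<psi>F: "\<bar>\<psi> x - F n x\<bar> \<le> r n * N x" if x: "x \<in> X" for n x
  proof -
    have "(\<lambda>m. \<bar>F m x - F n x\<bar>) \<longlonglongrightarrow> \<bar>\<psi> x - F n x\<bar>" by (intro tendsto_intros \<psi> x)
    then show ?thesis using F_tail[OF x] by (intro LIMSEQ_le_const2) auto
  qed
  have F_dual: "F n \<in> real_dual" for n using f(1)[of n] by (simp add: P_def F_def)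
  have \<psi>\<phi>: "\<bar>\<psi> x - \<phi> x\<bar> \<le> \<eta> * N x" if "x \<in> X" for x
    using \<psi>F[OF that, of 0] f(1)[of 0] by (simp add: P_def F_def r_def)
  have \<psi>d: "\<psi> \<in> real_dual"
  proof -
    have "\<psi> (x + y) = \<psi> x + \<psi> y" if x: "x \<in> X" and y: "y \<in> X" for x y
    proof -
      have "(\<lambda>n. F n (x + y)) \<longlonglongrightarrow> \<psi> x + \<psi> y"
        using tendsto_add[OF \<psi>[OF x] \<psi>[OF y]] dual_add[OF F_dual x y] by simp
      then show ?thesis using \<psi>[OF add_mem[OF x y]] LIMSEQ_unique by blast
    qed
    moreover have "\<psi> (c *\<^sub>R x) = c * \<psi> x" if x: "x \<in> X" for c x
    proof -
      have "(\<lambda>n. F n (c *\<^sub>R x)) \<longlonglongrightarrow> c * \<psi> x"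
        using tendsto_mult_left[OF \<psi>[OF x], of c] dual_scale[OF F_dual x] by simp
      then show ?thesis using \<psi>[OF scale_mem[OF x]] LIMSEQ_unique by blast
    qed
    moreover obtain C where C: "\<And>x. x \<in> X \<Longrightarrow> \<bar>\<phi> x\<bar> \<le> C * N x" using dual_bound[OF \<phi>] by metis
    have "\<bar>\<psi> x\<bar> \<le> (C + \<eta>) * N x" if "x \<in> X" for x
      using \<psi>\<phi>[OF that] C[OF that] by (simp add: distrib_right)
    ultimately show ?thesis unfolding real_dual_def linear_functional_on_def by blast
  qed
  have "small_slice \<epsilon> \<psi> D" if \<epsilon>: "\<epsilon> > 0" for \<epsilon>
  proof -
    obtain n where n: "inverse (real (Suc n)) < \<epsilon>" using reals_Archimedean[OF \<epsilon>] by blast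
    have "small_slice (inverse (real (Suc n))) \<psi> D"
      using f(1)[of "Suc n"] \<psi>F[of _ "Suc n"] by (simp add: P_def F_def r_def)
    then show ?thesis using n unfolding small_slice_def by (meson less_imp_le order.trans)
  qed
  then obtain b where "strongly_exposes \<psi> D b" "\<And>x. x \<in> D \<Longrightarrow> \<psi> x \<le> \<psi> b"
    using strongly_exposes_of_small_slices[OF D(1,2,3,5) \<psi>d] by metis
  then show ?thesis using that \<psi>\<phi> by blast
qed

text \<open>A point of \<open>B\<close> outside \<open>T\<close> is separated from \<open>T\<close>
  with a gap \<open>d\<close>. A strongly exposing functional close to the separating one attains
  its maximum over \<open>B\<close> at a point of \<open>T\<close>, which the gap forbids.\<close>

lemma subset_if_dentable:
  assumes dent: dentable and B: "B \<subseteq> X" "seq_closed B" "convex B" "\<And>x. x \<in> B \<Longrightarrow> N x \<le> M"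
    and T: "T \<subseteq> X" "seq_closed T" "convex T" and exp: "\<And>\<phi> b. strongly_exposes \<phi> B b \<Longrightarrow> b \<in> T"
  shows "B \<subseteq> T"
proof
  fix b assume b: "b \<in> B"
  show "b \<in> T"
  proof (rule ccontr)
    assume nT: "b \<notin> T"
    have bX: "b \<in> X" using b B(1) by blast
    have Bne: "B \<noteq> {}" using b by blast
    \<comment> \<open>Separation requires \<open>T\<close> to be nonempty; any strongly exposed
      point of \<open>B\<close> provides an element, and one is found near the zero
      functional.\<close>
    have zero: "(\<lambda>_. 0) \<in> real_dual"
      by (auto simp: real_dual_def linear_functional_on_def intro: exI[of _ 0])
    obtain \<psi> c where "strongly_exposes \<psi> B c"
      using strongly_exposing_dense[OF dent B(1) Bne B(2,3,4) zero, of 1] by (metis zero_less_one)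
    then have "T \<noteq> {}" using exp by blast
    then obtain \<phi> d where \<phi>: "\<phi> \<in> real_dual" "d > 0" "\<And>y. y \<in> T \<Longrightarrow> \<phi> y \<le> \<phi> b - d"
      using separation[OF T(1) _ T(3,2) bX nT] by metis
    define M' where "M' = \<bar>M\<bar> + 1"
    have M': "M' > 0" "\<And>x. x \<in> B \<Longrightarrow> N x \<le> M'" using B(4) by (force simp: M'_def)+
    \<comment> \<open>On \<open>B\<close> the perturbation changes values by at most
      \<open>d / 3\<close>; this is spent once at \<open>b\<close> and once at \<open>b'\<close>,
      and a third of the gap remains.\<close>
    define \<eta> where "\<eta> = d / (3 * M')"
    have \<eta>: "\<eta> > 0" "\<eta> * M' = d / 3" using M'(1) \<phi>(2) by (simp_all add: \<eta>_def)
    obtain \<psi> b' where \<psi>: "\<And>x. x \<in> X \<Longrightarrow> \<bar>\<psi> x - \<phi> x\<bar> \<le> \<eta> * N x" "strongly_exposes \<psi> B b'"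
        "\<And>x. x \<in> B \<Longrightarrow> \<psi> x \<le> \<psi> b'"
      using strongly_exposing_dense[OF dent B(1) Bne B(2,3,4) \<phi>(1) \<eta>(1)] by metis
    have b': "b' \<in> B" "b' \<in> T" using \<psi>(2) exp by (auto simp: strongly_exposes_def)
    have close: "\<bar>\<psi> x - \<phi> x\<bar> \<le> d / 3" if "x \<in> B" for x
    proof -
      have "\<eta> * N x \<le> \<eta> * M'" using M'(2)[OF that] \<eta>(1) by simp
      then show ?thesis using \<psi>(1)[of x] that B(1) \<eta>(2) by force
    qed
    show False
      using close[OF b] close[OF b'(1)] \<psi>(3)[OF b] \<phi>(3)[OF b'(2)] \<phi>(2) by linarith
  qed
qed

text \<open>A point with a larger value would lie in every slice around \<open>e\<close>, hence at
  distance 0 from it.\<close>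

lemma strongly_exposes_maximum:
  assumes D: "D \<subseteq> X" and e: "strongly_exposes \<phi> D e" and x: "x \<in> D"
  shows "\<phi> x \<le> \<phi> e"
proof (rule ccontr)
  assume gt: "\<not> \<phi> x \<le> \<phi> e"
  have m: "x \<in> X" "e \<in> X" using D x e by (auto simp: strongly_exposes_def)
  have "N (x - e) < \<rho>" if "\<rho> > 0" for \<rho>
    using e that x gt unfolding strongly_exposes_def by (smt (verit))
  then have "N (x - e) = 0" using nonneg[OF diff_mem[OF m]] by (metis less_irrefl linorder_not_le order.antisym)
  then have "x = e" using definite[OF diff_mem[OF m]] by simp
  then show False using gt by simp
qed

end

section \<open>Transfer of dentability along a semi-embedding\<close>

text \<open>In the separable case \<open>fragmented\<close> holds for a countable cover by small norm balls.\<close>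

locale semi_embedding = X: banach_subspace X NX + Y: banach_subspace Y NY
  for X :: "'v::real_vector set" and NX :: "'v \<Rightarrow> real" and Y :: "'v set" and NY :: "'v \<Rightarrow> real" +
  assumes subset: "X \<subseteq> Y"
    and bounded_inclusion: "\<exists>K. \<forall>x\<in>X. NY x \<le> K * NX x"
    and ball_closed: "(\<And>n::nat. s n \<in> X) \<Longrightarrow> (\<And>n. NX (s n) \<le> c) \<Longrightarrow> l \<in> Y \<Longrightarrow>
      (\<lambda>n. NY (s n - l)) \<longlonglongrightarrow> 0 \<Longrightarrow> l \<in> X \<and> NX l \<le> c"
    and fragmented: "\<epsilon> > 0 \<Longrightarrow> \<exists>(F :: nat \<Rightarrow> 'v set) \<rho>. \<rho> > 0 \<and> X \<subseteq> (\<Union>n. F n) \<and>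
      (\<forall>n. \<forall>x\<in>F n \<inter> X. \<forall>y\<in>F n \<inter> X. NY (x - y) < \<rho> \<longrightarrow> NX (x - y) < \<epsilon>) \<and>
      (\<forall>n c s l. (\<forall>k::nat. s k \<in> F n \<inter> X \<and> NX (s k) \<le> c) \<longrightarrow> l \<in> X \<longrightarrow>
        (\<lambda>k. NY (s k - l)) \<longlonglongrightarrow> 0 \<longrightarrow> l \<in> F n)"
    and target_RNP: "B \<subseteq> Y \<Longrightarrow> Y.seq_closed B \<Longrightarrow> convex B \<Longrightarrow> (\<And>x. x \<in> B \<Longrightarrow> NY x \<le> M) \<Longrightarrow>
      T \<subseteq> Y \<Longrightarrow> Y.seq_closed T \<Longrightarrow> convex T \<Longrightarrow> (\<And>\<phi> b. Y.strongly_exposes \<phi> B b \<Longrightarrow> b \<in> T) \<Longrightarrow> B \<subseteq> T"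
begin

text \<open>Closedness of balls is applied to tails of the translated sequence, with radius slightly
  above the limit of the bounds. The bounds vary with \<open>n\<close> because in the set
  \<open>T\<close> of \<open>source_dentable\<close> they involve the values of a
  functional.\<close>

lemma norm_diff_lower_semicontinuous:
  assumes s: "\<And>n. s n \<in> X" and l: "l \<in> Y" "(\<lambda>n. NY (s n - l)) \<longlonglongrightarrow> 0" and e: "e \<in> X"
    and le: "\<And>n. NX (s n - e) \<le> u n" and u: "u \<longlonglongrightarrow> q"
  shows "l \<in> X" "NX (l - e) \<le> q"
proof -
  have bound: "l \<in> X \<and> NX (l - e) \<le> q + \<kappa>" if "\<kappa> > 0" for \<kappa>
  proof -
    have "eventually (\<lambda>n. u n < q + \<kappa>) sequentially" using u that by (intro order_tendstoD) auto
    then obtain n0 where n0: "\<And>n. n \<ge> n0 \<Longrightarrow> u n < q + \<kappa>" by (auto simp: eventually_sequentially)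
    define s' where "s' n = s (n + n0) - e" for n
    have "(\<lambda>n. NY (s (n + n0) - l)) \<longlonglongrightarrow> 0" using LIMSEQ_ignore_initial_segment[OF l(2)] .
    then have "(\<lambda>n. NY (s' n - (l - e))) \<longlonglongrightarrow> 0" by (simp add: s'_def)
    moreover have "NX (s' n) \<le> q + \<kappa>" for n
      using le[of "n + n0"] n0[of "n + n0"] by (simp add: s'_def)
    moreover have "s' n \<in> X" for n using s e X.diff_mem by (simp add: s'_def)
    moreover have "l - e \<in> Y" using l(1) e subset Y.diff_mem by blast
    ultimately have "l - e \<in> X" "NX (l - e) \<le> q + \<kappa>" using ball_closed[of s' "q + \<kappa>" "l - e"] by blast+
    then show ?thesis using X.add_mem[OF _ e, of "l - e"] by simp
  qed
  show "l \<in> X" using bound[of 1] by simp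
  show "NX (l - e) \<le> q" by (rule field_le_epsilon) (rule conjunct2[OF bound])
qed

text \<open>This is why a slice cut by a functional on \<open>Y\<close> counts for dentability of
  \<open>X\<close>.\<close>

lemma dual_subset: "Y.real_dual \<subseteq> X.real_dual"
proof
  fix \<phi> assume \<phi>: "\<phi> \<in> Y.real_dual"
  obtain C where C: "C > 0" "\<And>x. x \<in> Y \<Longrightarrow> \<bar>\<phi> x\<bar> \<le> C * NY x" using Y.dual_bound[OF \<phi>] by metis
  obtain K where K: "\<And>x. x \<in> X \<Longrightarrow> NY x \<le> K * NX x" using bounded_inclusion by blast
  have "\<bar>\<phi> x\<bar> \<le> (C * K) * NX x" if "x \<in> X" for x
  proof -
    have "C * NY x \<le> C * (K * NX x)" using K[OF that] C(1) by simp
    then show ?thesis using C(2)[of x] that subset by (simp add: subset_iff mult.assoc)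
  qed
  moreover have "linear_functional_on X \<phi>"
    using \<phi> subset unfolding Y.real_dual_def linear_functional_on_def by blast
  ultimately show "\<phi> \<in> X.real_dual" unfolding X.real_dual_def by blast
qed

text \<open>A Baire category argument, run on the closure of \<open>E\<close> in \<open>Y\<close>.\<close>

lemma locally_small:
  assumes C: "C \<subseteq> X" "Y.seq_closed C" "\<And>x. x \<in> C \<Longrightarrow> NX x \<le> M" and E: "E \<subseteq> C" "E \<noteq> {}" and \<epsilon>: "\<epsilon> > 0"
  obtains e \<rho> where "e \<in> E" "\<rho> > 0" "\<And>x. x \<in> E \<Longrightarrow> NY (x - e) < \<rho> \<Longrightarrow> NX (x - e) < \<epsilon>"
proof -
  obtain F :: "nat \<Rightarrow> 'v set" and \<rho>0 where \<rho>0: "\<rho>0 > 0" and cover: "X \<subseteq> (\<Union>n. F n)"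
    and smallF: "\<And>n x y. x \<in> F n \<inter> X \<Longrightarrow> y \<in> F n \<inter> X \<Longrightarrow> NY (x - y) < \<rho>0 \<Longrightarrow> NX (x - y) < \<epsilon>"
    and closedF: "\<And>n c s l. (\<And>k::nat. s k \<in> F n \<inter> X \<and> NX (s k) \<le> c) \<Longrightarrow> l \<in> X \<Longrightarrow>
        (\<lambda>k. NY (s k - l)) \<longlonglongrightarrow> 0 \<Longrightarrow> l \<in> F n"
    using fragmented[OF \<epsilon>] by metis
  have CY: "C \<subseteq> Y" using C subset by blast
  have "\<exists>n. \<exists>e\<in>E. \<exists>\<rho>>0. \<forall>x\<in>E. NY (x - e) < \<rho> \<longrightarrow> x \<in> F n"
  proof (rule ccontr)
    assume "\<not> ?thesis"
    then have escape: "\<exists>x\<in>E. NY (x - e) < \<rho> \<and> x \<notin> F n" if "e \<in> E" "\<rho> > 0" for n e \<rho> using that by blast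
    \<comment> \<open>Within the bounded set \<open>C\<close>, each piece of the cover is closed for
      \<open>NY\<close>, so a point of \<open>C\<close> outside it has a whole ball outside
      it.\<close>
    have isolate: "\<exists>\<rho>>0. \<forall>y\<in>C. NY (y - x) \<le> \<rho> \<longrightarrow> y \<notin> F n" if x: "x \<in> C" "x \<notin> F n" for x n
    proof (rule ccontr)
      assume "\<not> ?thesis"
      then have "\<exists>y\<in>C. NY (y - x) \<le> inverse (real (Suc k)) \<and> y \<in> F n" for k
        by (metis inverse_positive_iff_positive of_nat_0_less_iff zero_less_Suc)
      then obtain s where s: "\<And>k. s k \<in> C" "\<And>k. NY (s k - x) \<le> inverse (real (Suc k))" "\<And>k. s k \<in> F n" by metis
      have sY: "s k \<in> Y" "x \<in> Y" for k using s(1) x(1) CY by auto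
      have "(\<lambda>k. NY (s k - x)) \<longlonglongrightarrow> 0"
        using s(2) Y.nonneg[OF Y.diff_mem[OF sY]]
        by (intro Lim_null_comparison[OF _ LIMSEQ_inverse_real_of_nat]) auto
      then have "x \<in> F n" using closedF[of s n M x] s(1,3) C x(1) by blast
      then show False using x(2) by blast
    qed
    define P where "P z \<longleftrightarrow> fst z \<in> E \<and> (snd z :: real) > 0" for z :: "'v \<times> real"
    \<comment> \<open>The new closed ball lies in the old one, as its centre moves by less than half
      the old radius and its own radius is at most the other half; within \<open>C\<close> it misses
      \<open>F n\<close>.\<close>
    define Q where "Q n z w \<longleftrightarrow> snd w \<le> snd z / 2 \<and> NY (fst w - fst z) < snd z / 2 \<and>
        (\<forall>y\<in>C. NY (y - fst w) \<le> snd w \<longrightarrow> y \<notin> F n)" for n and z w :: "'v \<times> real"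
    have step: "\<exists>w. P w \<and> Q n z w" if z: "P z" for n z
    proof -
      have "fst z \<in> E" "snd z / 2 > 0" using z by (auto simp: P_def)
      then obtain x where x: "x \<in> E" "NY (x - fst z) < snd z / 2" "x \<notin> F n" using escape by blast
      obtain \<rho> where \<rho>: "\<rho> > 0" "\<And>y. y \<in> C \<Longrightarrow> NY (y - x) \<le> \<rho> \<Longrightarrow> y \<notin> F n"
        using isolate[of x n] x(1,3) E(1) by blast
      have "P (x, min \<rho> (snd z / 2)) \<and> Q n z (x, min \<rho> (snd z / 2))"
        using x \<rho> \<open>snd z / 2 > 0\<close> by (auto simp: P_def Q_def)
      then show ?thesis by blast
    qed
    obtain e0 where "e0 \<in> E" using E(2) by blast
    then have "\<exists>z. P z" by (intro exI[of _ "(e0, 1)"]) (simp add: P_def)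
    then have "\<exists>f. \<forall>n. P (f n) \<and> Q n (f n) (f (Suc n))" using step by (intro dependent_nat_choice) auto
    then obtain f where f: "\<And>n. P (f n)" "\<And>n. Q n (f n) (f (Suc n))" by blast
    define x r where "x n = fst (f n)" and "r n = snd (f n)" for n
    have xE: "x n \<in> E" and r0: "r n > 0" for n using f(1)[of n] by (auto simp: P_def x_def r_def)
    have xC: "x n \<in> C" and xY: "x n \<in> Y" for n using xE E(1) CY by auto
    have r_step: "r (Suc n) \<le> r n / 2" and x_step: "NY (x (Suc n) - x n) < r n / 2"
      and avoid: "\<And>y. y \<in> C \<Longrightarrow> NY (y - x (Suc n)) \<le> r (Suc n) \<Longrightarrow> y \<notin> F n" for n
      using f(2)[of n] by (auto simp: Q_def x_def r_def)
    have tail: "NY (x m - x n) \<le> r n" if "n \<le> m" for m n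
    proof -
      have "NY (x m - x n) \<le> r n - r m"
        using that
      proof (induction m rule: dec_induct)
        case base
        show ?case by (simp add: Y.norm_zero_eq)
      next
        case (step m)
        then show ?case using Y.norm_diff_triangle[OF xY[of "Suc m"] xY[of m] xY[of n]] x_step[of m] r_step[of m] by linarith
      qed
      then show ?thesis using r0[of m] by linarith
    qed
    have r_le: "r n \<le> r 0 * (1/2) ^ n" for n
    proof (induction n)
      case (Suc n)
      then show ?case using r_step[of n] by simp
    qed simp
    have "(\<lambda>n. r 0 * (1/2) ^ n) \<longlonglongrightarrow> r 0 * 0" by (intro tendsto_intros LIMSEQ_power_zero) auto
    then have r_lim: "r \<longlonglongrightarrow> 0"
      using r_le r0 by (intro tendsto_sandwich[of "\<lambda>_. 0" r]) (auto intro: always_eventually less_imp_le)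
    have "\<exists>M. \<forall>m\<ge>M. \<forall>n\<ge>M. NY (x m - x n) < \<epsilon>" if \<epsilon>: "\<epsilon> > 0" for \<epsilon>
    proof -
      obtain M where M: "r M < \<epsilon>"
        using order_tendstoD(2)[OF r_lim \<epsilon>] by (auto simp: eventually_sequentially)
      have r_mono: "r n \<le> r M" if "M \<le> n" for n
        using that
      proof (induction n rule: dec_induct)
        case (step n)
        then show ?case using r_step[of n] r0[of n] by linarith
      qed simp
      have "NY (x m - x n) < \<epsilon>" if "M \<le> m" "M \<le> n" for m n
      proof (cases "n \<le> m")
        case True
        then show ?thesis using tail[of n m] r_mono[OF that(2)] M by linarith
      next
        case False
        then show ?thesis using tail[of m n] r_mono[OF that(1)] M Y.norm_diff_commute[OF xY xY, of m n] by linarith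
      qed
      then show ?thesis by blast
    qed
    then obtain l where l: "l \<in> Y" "(\<lambda>n. NY (x n - l)) \<longlonglongrightarrow> 0" using Y.complete[of x] xY by blast
    have lC: "l \<in> C" using C(2) xC l unfolding Y.seq_closed_def by blast
    \<comment> \<open>The limit need not belong to \<open>E\<close>, only to \<open>C\<close>. It
      lies in every ball, hence in no \<open>F n\<close>, although these sets cover
      \<open>X\<close>.\<close>
    have "NY (l - x n) \<le> r n" for n
      using Y.norm_tendsto[OF xY l(1) xY l(2)] tail by (intro LIMSEQ_le_const2[of "\<lambda>m. NY (x m - x n)"]) auto
    then have "l \<notin> F n" for n using avoid lC by blast
    then show False using cover lC C(1) by blast
  qed
  then obtain n e \<rho> where e: "e \<in> E" "\<rho> > 0" "\<And>x. x \<in> E \<Longrightarrow> NY (x - e) < \<rho> \<Longrightarrow> x \<in> F n" by blast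
  have "e \<in> F n" using e by (auto simp: Y.norm_zero_eq)
  \<comment> \<open>Being in \<open>F n\<close> together with \<open>e\<close> is not enough; two
    points of a piece are close for \<open>NX\<close> only when their \<open>NY\<close> distance is
    below \<open>\<rho>0\<close>.\<close>
  then have "NX (x - e) < \<epsilon>" if "x \<in> E" "NY (x - e) < min \<rho> \<rho>0" for x
    using smallF[of x n e] e that E(1) C(1) by auto
  then show ?thesis using that[of e "min \<rho> \<rho>0"] e \<rho>0 by simp
qed

text \<open>The set \<open>A\<close> is replaced by its closed convex hull \<open>C\<close> in
  \<open>Y\<close>. As balls of \<open>X\<close> are closed in \<open>Y\<close>, the hull stays in
  the same ball of \<open>X\<close>, so both norms are available on it.\<close>

theorem source_dentable: "X.dentable"
  unfolding X.dentable_def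
proof (intro allI impI)
  fix A \<epsilon> M assume A: "A \<subseteq> X" "A \<noteq> {}" "\<forall>x\<in>A. NX x \<le> M" and \<epsilon>: "(0::real) < \<epsilon>"
  define M' where "M' = \<bar>M\<bar> + 1"
  have M': "M' > 0" "\<And>x. x \<in> A \<Longrightarrow> NX x \<le> M'" using A(3) by (force simp: M'_def)+
  define \<C> where "\<C> = {T. T \<subseteq> Y \<and> Y.seq_closed T \<and> convex T \<and> A \<subseteq> T}"
  define C where "C = \<Inter>\<C>"
  define Ball where "Ball = {x \<in> X. NX x \<le> M'}"
  have "Y.seq_closed Ball"
    unfolding Y.seq_closed_def Ball_def using ball_closed by blast
  moreover have "convex Ball"
  proof (rule convexI)
    fix x y u v assume xy: "x \<in> Ball" "y \<in> Ball" and uv: "(0::real) \<le> u" "0 \<le> v" "u + v = 1"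
    have "NX (u *\<^sub>R x + v *\<^sub>R y) \<le> u * NX x + v * NX y"
      using X.triangle[of "u *\<^sub>R x" "v *\<^sub>R y"] xy uv by (auto simp: Ball_def X.scale_mem X.scale)
    also have "\<dots> \<le> u * M' + v * M'" using xy uv by (intro add_mono mult_left_mono) (auto simp: Ball_def)
    also have "\<dots> = M'" using uv(3) by (metis distrib_right mult_1)
    finally show "u *\<^sub>R x + v *\<^sub>R y \<in> Ball" using xy by (auto simp: Ball_def X.add_mem X.scale_mem)
  qed
  ultimately have Ball: "Ball \<in> \<C>" using A(1) M'(2) subset by (auto simp: \<C>_def Ball_def)
  then have CX: "C \<subseteq> X" and CM: "\<And>x. x \<in> C \<Longrightarrow> NX x \<le> M'" by (auto simp: C_def Ball_def)
  then have CY: "C \<subseteq> Y" using subset by blast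
  have AC: "A \<subseteq> C" by (auto simp: C_def \<C>_def)
  have C_least: "C \<subseteq> T" if "T \<subseteq> Y" "Y.seq_closed T" "convex T" "A \<subseteq> T" for T
    using that by (auto simp: C_def \<C>_def)
  have C_closed: "Y.seq_closed C" unfolding C_def Y.seq_closed_def
  proof (intro allI impI InterI)
    fix s l T assume h: "\<forall>n. s n \<in> \<Inter>\<C>" "l \<in> Y" "(\<lambda>n. NY (s n - l)) \<longlonglongrightarrow> 0" "T \<in> \<C>"
    then have "Y.seq_closed T" "\<forall>n. s n \<in> T" by (auto simp: \<C>_def)
    then show "l \<in> T" using h(2,3) unfolding Y.seq_closed_def by blast
  qed
  have C_convex: "convex C" unfolding C_def by (rule convex_Inter) (auto simp: \<C>_def)
  obtain K where K: "\<And>x. x \<in> X \<Longrightarrow> NY x \<le> K * NX x" using bounded_inclusion by blast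
  have CYM: "NY x \<le> \<bar>K\<bar> * M'" if "x \<in> C" for x
  proof -
    have xX: "x \<in> X" using that CX by blast
    have "NY x \<le> K * NX x" by (rule K[OF xX])
    also have "\<dots> \<le> \<bar>K\<bar> * M'" using X.nonneg[OF xX] CM[OF that] by (intro mult_mono) auto
    finally show ?thesis .
  qed
  \<comment> \<open>The RNP of \<open>Y\<close> now reads as a test: a \<open>Y\<close>-closed
    convex set containing all strongly exposed points of \<open>C\<close> contains \<open>C\<close>.
    It is used twice, with the empty set and with \<open>T\<close>.\<close>
  note C_in = target_RNP[OF CY C_closed C_convex CYM]
  define E where "E = {b. \<exists>\<phi>. Y.strongly_exposes \<phi> C b}"
  have EC: "E \<subseteq> C" by (auto simp: E_def Y.strongly_exposes_def)
  have "E \<noteq> {}"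
  proof
    assume "E = {}"
    then have "C \<subseteq> {}" by (intro C_in) (auto simp: E_def Y.seq_closed_def)
    then show False using AC A(2) by blast
  qed
  have \<epsilon>4: "\<epsilon> / 4 > 0" using \<epsilon> by simp
  obtain e \<rho> where e: "e \<in> E" "\<rho> > 0" "\<And>x. x \<in> E \<Longrightarrow> NY (x - e) < \<rho> \<Longrightarrow> NX (x - e) < \<epsilon> / 4"
    using locally_small[OF CX C_closed CM EC \<open>E \<noteq> {}\<close> \<epsilon>4] by metis
  obtain \<phi> where exposes: "Y.strongly_exposes \<phi> C e" using e(1) by (auto simp: E_def)
  then have \<phi>: "\<phi> \<in> Y.real_dual" by (simp add: Y.strongly_exposes_def)
  obtain \<delta> where \<delta>: "\<delta> > 0" "\<And>x. x \<in> C \<Longrightarrow> \<phi> x > \<phi> e - \<delta> \<Longrightarrow> NY (x - e) < \<rho>"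
    using exposes e(2) unfolding Y.strongly_exposes_def by blast
  have eC: "e \<in> C" and eX: "e \<in> X" using e(1) EC CX by auto
  have max: "\<phi> x \<le> \<phi> e" if "x \<in> C" for x using Y.strongly_exposes_maximum[OF CY exposes that] .
  \<comment> \<open>The weight is such that a drop of \<open>\<delta>\<close> in
    \<open>\<phi>\<close> pays for the \<open>NX\<close> diameter of \<open>C\<close>, which is at
    most \<open>2 * M'\<close>.\<close>
  define L where "L = 2 * M' / \<delta>"
  have L: "L > 0" "L * \<delta> = 2 * M'" using M'(1) \<delta>(1) by (simp_all add: L_def)
  \<comment> \<open>The exposed points away from \<open>e\<close> lie in \<open>T\<close> because \<open>\<phi>\<close> is small there, those near \<open>e\<close> by
    the choice of \<open>\<rho>\<close>; so \<open>C \<subseteq> T\<close>, and a slice of \<open>T\<close> at \<open>e\<close> is small.\<close>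
  define T where "T = {x \<in> C. NX (x - e) + L * \<phi> x \<le> \<epsilon> / 4 + L * \<phi> e}"
  have "C \<subseteq> T"
  proof (rule C_in)
    show "T \<subseteq> Y" using CY by (auto simp: T_def)
    show "Y.seq_closed T" unfolding Y.seq_closed_def
    proof (intro allI impI)
      fix s l assume s: "\<forall>n. s n \<in> T" and l: "l \<in> Y" "(\<lambda>n. NY (s n - l)) \<longlonglongrightarrow> 0"
      have sC: "s n \<in> C" "s n \<in> X" "s n \<in> Y" for n using s CX CY by (auto simp: T_def)
      have lC: "l \<in> C" using C_closed sC(1) l unfolding Y.seq_closed_def by blast
      have "NX (s n - e) \<le> \<epsilon> / 4 + L * \<phi> e - L * \<phi> (s n)" for n using s by (simp add: T_def algebra_simps)
      moreover have "(\<lambda>n. \<epsilon> / 4 + L * \<phi> e - L * \<phi> (s n)) \<longlonglongrightarrow> \<epsilon> / 4 + L * \<phi> e - L * \<phi> l"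
        by (intro tendsto_intros Y.dual_tendsto[OF \<phi> sC(3) l])
      ultimately have "NX (l - e) \<le> \<epsilon> / 4 + L * \<phi> e - L * \<phi> l"
        by (rule norm_diff_lower_semicontinuous(2)[OF sC(2) l eX])
      then show "l \<in> T" using lC by (simp add: T_def)
    qed
    show "convex T"
    proof (rule convexI)
      fix x y u v assume xy: "x \<in> T" "y \<in> T" and uv: "(0::real) \<le> u" "0 \<le> v" "u + v = 1"
      have m: "x \<in> C" "y \<in> C" using xy by (auto simp: T_def)
      then have mX: "x \<in> X" "y \<in> X" "x \<in> Y" "y \<in> Y" using CX CY by auto
      have "u *\<^sub>R x + v *\<^sub>R y - e = u *\<^sub>R x + v *\<^sub>R y - (u + v) *\<^sub>R e" using uv(3) by simp
      also have "\<dots> = u *\<^sub>R (x - e) + v *\<^sub>R (y - e)" by (simp add: algebra_simps)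
      finally have "NX (u *\<^sub>R x + v *\<^sub>R y - e) \<le> u * NX (x - e) + v * NX (y - e)"
        using X.triangle[of "u *\<^sub>R (x - e)" "v *\<^sub>R (y - e)"] mX uv eX by (simp add: X.scale_mem X.diff_mem X.scale)
      moreover have "\<phi> (u *\<^sub>R x + v *\<^sub>R y) = u * \<phi> x + v * \<phi> y"
        using Y.dual_add[OF \<phi>] Y.dual_scale[OF \<phi>] mX Y.scale_mem by simp
      ultimately have "NX (u *\<^sub>R x + v *\<^sub>R y - e) + L * \<phi> (u *\<^sub>R x + v *\<^sub>R y) \<le>
          u * (NX (x - e) + L * \<phi> x) + v * (NX (y - e) + L * \<phi> y)" by (simp add: algebra_simps)
      also have "\<dots> \<le> u * (\<epsilon> / 4 + L * \<phi> e) + v * (\<epsilon> / 4 + L * \<phi> e)"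
        using xy uv by (intro add_mono[OF mult_left_mono mult_left_mono]) (auto simp: T_def)
      also have "\<dots> = \<epsilon> / 4 + L * \<phi> e" using uv(3) by (metis distrib_right mult_1)
      finally show "u *\<^sub>R x + v *\<^sub>R y \<in> T" using convexD[OF C_convex m uv] by (simp add: T_def)
    qed
    show "b \<in> T" if "Y.strongly_exposes \<theta> C b" for \<theta> b
    proof -
      have bE: "b \<in> E" using that by (auto simp: E_def)
      then have bC: "b \<in> C" "b \<in> X" using EC CX by auto
      show ?thesis
      proof (cases "\<phi> b > \<phi> e - \<delta>")
        case True
        then have "NX (b - e) < \<epsilon> / 4" using e(3)[OF bE] \<delta>(2)[OF bC(1)] by blast
        moreover have "L * \<phi> b \<le> L * \<phi> e" using max[OF bC(1)] L(1) by simp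
        ultimately show ?thesis using bC by (simp add: T_def)
      next
        case False
        then have "L * \<phi> b \<le> L * (\<phi> e - \<delta>)" using L(1) by simp
        then have "L * \<phi> b \<le> L * \<phi> e - 2 * M'" using L(2) by (simp add: right_diff_distrib)
        moreover have "NX (b - e) \<le> 2 * M'"
          using X.norm_diff_le[OF bC(2) eX] CM[OF bC(1)] CM[OF eC] by simp
        ultimately show ?thesis using bC \<epsilon> by (simp add: T_def)
      qed
    qed
  qed
  \<comment> \<open>At this depth the weighted drop \<open>L * (\<phi> e - \<phi> x)\<close> is
    below \<open>\<epsilon> / 4\<close>; with the \<open>\<epsilon> / 4\<close> from
    \<open>T\<close> this gives distance at most \<open>\<epsilon> / 2\<close> from
    \<open>e\<close>.\<close>
  define \<tau> where "\<tau> = \<phi> e - \<epsilon> / (4 * L)"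
  have near: "NX (x - e) \<le> \<epsilon> / 2" if "x \<in> C" "\<phi> x > \<tau>" for x
  proof -
    have "L * \<tau> \<le> L * \<phi> x" using that(2) L(1) by simp
    moreover have "L * \<tau> = L * \<phi> e - \<epsilon> / 4" using L(1) by (simp add: \<tau>_def right_diff_distrib)
    moreover have "NX (x - e) + L * \<phi> x \<le> \<epsilon> / 4 + L * \<phi> e" using that(1) \<open>C \<subseteq> T\<close> by (auto simp: T_def)
    ultimately show ?thesis by linarith
  qed
  \<comment> \<open>The point \<open>e\<close> belongs to the hull, possibly not to
    \<open>A\<close>. If \<open>A\<close> missed the slice, the closed half-space
    \<open>\<phi> \<le> \<tau>\<close> would contain the hull and hence \<open>e\<close>.\<close>
  have "\<exists>x\<in>A. \<phi> x > \<tau>"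
  proof (rule ccontr)
    assume none: "\<not> ?thesis"
    have "C \<subseteq> {y \<in> Y. \<phi> y \<le> \<tau>}"
    proof (rule C_least)
      show "A \<subseteq> {y \<in> Y. \<phi> y \<le> \<tau>}" using none AC CY by auto
      show "convex {y \<in> Y. \<phi> y \<le> \<tau>}"
      proof (rule convexI)
        fix x y u v assume xy: "x \<in> {y \<in> Y. \<phi> y \<le> \<tau>}" "y \<in> {y \<in> Y. \<phi> y \<le> \<tau>}"
          and uv: "(0::real) \<le> u" "0 \<le> v" "u + v = 1"
        have "\<phi> (u *\<^sub>R x + v *\<^sub>R y) = u * \<phi> x + v * \<phi> y"
          using Y.dual_add[OF \<phi>] Y.dual_scale[OF \<phi>] xy Y.scale_mem by simp
        also have "\<dots> \<le> u * \<tau> + v * \<tau>" using xy uv by (intro add_mono mult_left_mono) auto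
        also have "\<dots> = \<tau>" using uv(3) by (metis distrib_right mult_1)
        finally show "u *\<^sub>R x + v *\<^sub>R y \<in> {y \<in> Y. \<phi> y \<le> \<tau>}" using xy by (simp add: Y.add_mem Y.scale_mem)
      qed
      show "Y.seq_closed {y \<in> Y. \<phi> y \<le> \<tau>}" unfolding Y.seq_closed_def
      proof (intro allI impI)
        fix s l assume s: "\<forall>n. s n \<in> {y \<in> Y. \<phi> y \<le> \<tau>}" and l: "l \<in> Y" "(\<lambda>n. NY (s n - l)) \<longlonglongrightarrow> 0"
        have "(\<lambda>n. \<phi> (s n)) \<longlonglongrightarrow> \<phi> l" using s by (intro Y.dual_tendsto[OF \<phi> _ l]) auto
        then have "\<phi> l \<le> \<tau>" using s by (intro LIMSEQ_le_const2) auto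
        then show "l \<in> {y \<in> Y. \<phi> y \<le> \<tau>}" using l(1) by simp
      qed
    qed auto
    then have "\<phi> e \<le> \<tau>" using eC by blast
    then show False using \<epsilon> L(1) by (simp add: \<tau>_def field_simps)
  qed
  moreover have "NX (x - y) \<le> \<epsilon>" if "x \<in> A" "y \<in> A" "\<phi> x > \<tau>" "\<phi> y > \<tau>" for x y
  proof -
    have m: "x \<in> C" "y \<in> C" "x \<in> X" "y \<in> X" using that AC A(1) by auto
    show ?thesis
      using X.norm_diff_triangle[OF m(3) eX m(4)] near[OF m(1) that(3)] near[OF m(2) that(4)]
        X.norm_diff_commute[OF m(4) eX] by simp
  qed
  ultimately have "X.small_slice \<epsilon> \<phi> A" unfolding X.small_slice_def by blast
  then show "\<exists>\<phi>\<in>X.real_dual. X.small_slice \<epsilon> \<phi> A" using \<phi> dual_subset by blast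
qed

end

section \<open>Complex function spaces\<close>

text \<open>Pointwise real scaling makes \<open>subspace\<close> and \<open>convex\<close>
  meaningful for sets of complex functions.\<close>

instantiation "fun" :: (type, real_vector) real_vector
begin

definition scaleR_fun :: "real \<Rightarrow> ('a \<Rightarrow> 'b) \<Rightarrow> 'a \<Rightarrow> 'b" where
  "scaleR_fun r f = (\<lambda>x. r *\<^sub>R f x)"

instance
  by standard (auto simp: scaleR_fun_def fun_eq_iff scaleR_add_left scaleR_add_right)

end

text \<open>Elements are honest functions, not classes modulo null sets. That a vanishing norm
  forces the zero function is supplied in the application by the A_p part of the norm, which
  dominates the supremum.\<close>

locale complex_function_space =
  fixes X :: "('a \<Rightarrow> complex) set" and N :: "('a \<Rightarrow> complex) \<Rightarrow> real"
  assumes zero_fun_mem: "(\<lambda>_. 0) \<in> X"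
    and sum_mem: "f \<in> X \<Longrightarrow> g \<in> X \<Longrightarrow> (\<lambda>x. f x + g x) \<in> X"
    and norm_sum: "f \<in> X \<Longrightarrow> g \<in> X \<Longrightarrow> N (\<lambda>x. f x + g x) \<le> N f + N g"
    and multiple_mem: "f \<in> X \<Longrightarrow> (\<lambda>x. c * f x) \<in> X"
    and norm_multiple: "f \<in> X \<Longrightarrow> N (\<lambda>x. c * f x) = cmod c * N f"
    and norm_nonneg: "f \<in> X \<Longrightarrow> 0 \<le> N f"
    and norm_definite: "f \<in> X \<Longrightarrow> N f = 0 \<Longrightarrow> f = (\<lambda>_. 0)"
    and norm_complete: "(\<And>n::nat. s n \<in> X) \<Longrightarrow>
      (\<And>\<epsilon>. \<epsilon> > 0 \<Longrightarrow> \<exists>M. \<forall>m\<ge>M. \<forall>n\<ge>M. N (\<lambda>x. s m x - s n x) < \<epsilon>) \<Longrightarrow>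
      \<exists>l\<in>X. (\<lambda>n. N (\<lambda>x. s n x - l x)) \<longlonglongrightarrow> 0"
begin

lemma scaleR_complex_fun: "r *\<^sub>R f = (\<lambda>x. complex_of_real r * f x)" for f :: "'a \<Rightarrow> complex"
  by (simp add: scaleR_fun_def scaleR_conv_of_real)

sublocale banach_subspace X N
proof
  show "subspace X"
    using zero_fun_mem sum_mem multiple_mem
    by (auto simp: subspace_def scaleR_complex_fun zero_fun_def plus_fun_def)
  show "0 \<le> N x" if "x \<in> X" for x using norm_nonneg that .
  show "N (x + y) \<le> N x + N y" if "x \<in> X" "y \<in> X" for x y
    using norm_sum that by (simp add: plus_fun_def)
  show "N (c *\<^sub>R x) = \<bar>c\<bar> * N x" if "x \<in> X" for c x
    using norm_multiple[OF that] by (simp add: scaleR_complex_fun)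
  show "x = 0" if "x \<in> X" "N x = 0" for x
    using norm_definite that by (simp add: zero_fun_def)
  show "\<exists>l\<in>X. (\<lambda>n. N (s n - l)) \<longlonglongrightarrow> 0"
    if "\<And>n::nat. s n \<in> X" "\<And>\<epsilon>. \<epsilon> > 0 \<Longrightarrow> \<exists>M. \<forall>m\<ge>M. \<forall>n\<ge>M. N (s m - s n) < \<epsilon>" for s
    using norm_complete[OF that(1)] that(2) by (simp add: fun_diff_def)
qed

section \<open>Comparison of the complex notions with the real ones\<close>

lemma closed_convex_in_iff: "closed_convex_in X N B \<longleftrightarrow> B \<subseteq> X \<and> seq_closed B \<and> convex B"
proof -
  have "(\<forall>s l. (\<forall>n. s n \<in> B) \<and> l \<in> X \<and> (\<lambda>n::nat. N (\<lambda>x. s n x - l x)) \<longlonglongrightarrow> 0 \<longrightarrow> l \<in> B) \<longleftrightarrow> seq_closed B"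
    unfolding seq_closed_def fun_diff_def by (simp only: imp_conjL)
  moreover have "(\<forall>f\<in>B. \<forall>g\<in>B. \<forall>\<tau>\<in>{0..1::real}.
      (\<lambda>x. complex_of_real (1 - \<tau>) * f x + complex_of_real \<tau> * g x) \<in> B) \<longleftrightarrow> convex B"
    unfolding convex_alt scaleR_complex_fun plus_fun_def by (simp add: Ball_def)
  ultimately show ?thesis unfolding closed_convex_in_def by simp
qed

lemma Re_dual:
  assumes "\<phi> \<in> dual_space X N"
  shows "(\<lambda>f. Re (\<phi> f)) \<in> real_dual"
proof -
  have \<phi>: "\<And>f g. f \<in> X \<Longrightarrow> g \<in> X \<Longrightarrow> \<phi> (\<lambda>x. f x + g x) = \<phi> f + \<phi> g"
    "\<And>c f. f \<in> X \<Longrightarrow> \<phi> (\<lambda>x. c * f x) = c * \<phi> f"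
    using assms by (auto simp: dual_space_def)
  obtain C where C: "\<And>f. f \<in> X \<Longrightarrow> cmod (\<phi> f) \<le> C * N f" using assms unfolding dual_space_def by blast
  have "\<bar>Re (\<phi> f)\<bar> \<le> C * N f" if "f \<in> X" for f
    using C[OF that] abs_Re_le_cmod[of "\<phi> f"] by linarith
  moreover have "linear_functional_on X (\<lambda>f. Re (\<phi> f))"
    using \<phi> by (auto simp: linear_functional_on_def plus_fun_def scaleR_complex_fun)
  ultimately show ?thesis by (auto simp: real_dual_def)
qed

text \<open>The usual complexification \<open>\<phi> f - \<i> * \<phi> (\<i> f)\<close>, with real
  part \<open>\<phi>\<close>. Bounding its modulus by the sum of both parts costs the factor
  2.\<close>

lemma complexify_dual:
  assumes \<phi>: "\<phi> \<in> real_dual"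
  shows "(\<lambda>f. Complex (\<phi> f) (- \<phi> (\<lambda>x. \<i> * f x))) \<in> dual_space X N"
proof -
  obtain C where C: "C > 0" "\<And>f. f \<in> X \<Longrightarrow> \<bar>\<phi> f\<bar> \<le> C * N f" using dual_bound[OF \<phi>] by metis
  have add: "\<phi> (\<lambda>x. f x + g x) = \<phi> f + \<phi> g" if "f \<in> X" "g \<in> X" for f g
    using dual_add[OF \<phi> that] by (simp add: plus_fun_def)
  have scale: "\<phi> (\<lambda>x. complex_of_real r * f x) = r * \<phi> f" if "f \<in> X" for f r
    using dual_scale[OF \<phi> that] by (simp add: scaleR_complex_fun)
  have split: "\<phi> (\<lambda>x. c * f x) = Re c * \<phi> f + Im c * \<phi> (\<lambda>x. \<i> * f x)" if f: "f \<in> X" for c f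
  proof -
    have "(\<lambda>x. c * f x) = (\<lambda>x. complex_of_real (Re c) * f x + complex_of_real (Im c) * (\<i> * f x))"
      by (rule ext, subst complex_eq[of c]) (simp add: algebra_simps)
    then show ?thesis
      using add[OF multiple_mem[OF f] multiple_mem[OF multiple_mem[OF f]]] scale[OF f] scale[OF multiple_mem[OF f]] by simp
  qed
  have "\<phi> (\<lambda>x. \<i> * (f x + g x)) = \<phi> (\<lambda>x. \<i> * f x) + \<phi> (\<lambda>x. \<i> * g x)" if "f \<in> X" "g \<in> X" for f g
    using add[OF multiple_mem multiple_mem, OF that] by (simp add: distrib_left)
  then have 1: "Complex (\<phi> (\<lambda>x. f x + g x)) (- \<phi> (\<lambda>x. \<i> * (f x + g x))) =
      Complex (\<phi> f) (- \<phi> (\<lambda>x. \<i> * f x)) + Complex (\<phi> g) (- \<phi> (\<lambda>x. \<i> * g x))" if "f \<in> X" "g \<in> X" for f g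
    using add that by (simp add: complex_eq_iff)
  have 2: "Complex (\<phi> (\<lambda>x. c * f x)) (- \<phi> (\<lambda>x. \<i> * (c * f x))) = c * Complex (\<phi> f) (- \<phi> (\<lambda>x. \<i> * f x))"
    if f: "f \<in> X" for c f
    using split[OF f, of c] split[OF f, of "\<i> * c"] by (simp add: complex_eq_iff mult.assoc)
  have 3: "cmod (Complex (\<phi> f) (- \<phi> (\<lambda>x. \<i> * f x))) \<le> (2 * C) * N f" if f: "f \<in> X" for f
    using cmod_le[of "Complex (\<phi> f) (- \<phi> (\<lambda>x. \<i> * f x))"] C(2)[OF f] C(2)[OF multiple_mem[OF f, of \<i>]]
      norm_multiple[OF f, of \<i>] by simp
  show ?thesis unfolding dual_space_def using 1 2 3 by (intro CollectI conjI) blast+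
qed

text \<open>Two translations at once: complex functionals against their real parts, and sequences
  against thresholds. Strictness of the maximum is recovered because a competitor of
  \<open>b\<close> would lie in every slice and so at distance 0.\<close>

lemma strongly_exposed_points_eq:
  assumes B: "B \<subseteq> X"
  shows "strongly_exposed_points X N B = {b. \<exists>\<phi>. strongly_exposes \<phi> B b}"
proof (intro set_eqI iffI)
  fix b assume "b \<in> strongly_exposed_points X N B"
  then obtain \<phi> where b: "b \<in> B" and \<phi>: "\<phi> \<in> dual_space X N" "\<And>f. f \<in> B \<Longrightarrow> f \<noteq> b \<Longrightarrow> Re (\<phi> f) < Re (\<phi> b)"
    "\<And>s. (\<And>n. s n \<in> B) \<Longrightarrow> (\<lambda>n::nat. Re (\<phi> (s n))) \<longlonglongrightarrow> Re (\<phi> b) \<Longrightarrow> (\<lambda>n. N (\<lambda>x. s n x - b x)) \<longlonglongrightarrow> 0"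
    unfolding strongly_exposed_points_def by blast
  have "\<exists>\<delta>>0. \<forall>x\<in>B. Re (\<phi> x) > Re (\<phi> b) - \<delta> \<longrightarrow> N (x - b) < \<rho>" if \<rho>: "\<rho> > 0" for \<rho>
  proof (rule ccontr)
    assume neg: "\<not> ?thesis"
    have "\<exists>x\<in>B. Re (\<phi> x) > Re (\<phi> b) - inverse (real (Suc n)) \<and> N (x - b) \<ge> \<rho>" for n
      using neg by (metis inverse_positive_iff_positive of_nat_0_less_iff zero_less_Suc not_le)
    then obtain s where s: "\<And>n. s n \<in> B" "\<And>n. Re (\<phi> (s n)) > Re (\<phi> b) - inverse (real (Suc n))"
      "\<And>n. N (s n - b) \<ge> \<rho>" by metis
    have "Re (\<phi> (s n)) \<le> Re (\<phi> b)" for n using \<phi>(2)[OF s(1), of n] by (cases "s n = b") auto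
    then have "\<bar>Re (\<phi> (s n)) - Re (\<phi> b)\<bar> \<le> inverse (real (Suc n))" for n
      using s(2)[of n] by (simp add: abs_le_iff less_imp_le algebra_simps)
    then have "(\<lambda>n. Re (\<phi> (s n)) - Re (\<phi> b)) \<longlonglongrightarrow> 0"
      by (intro Lim_null_comparison[OF _ LIMSEQ_inverse_real_of_nat]) auto
    then have "(\<lambda>n. N (s n - b)) \<longlonglongrightarrow> 0"
      using \<phi>(3)[OF s(1)] by (simp add: LIM_zero_iff fun_diff_def)
    then have "\<rho> \<le> 0" using s(3) by (intro LIMSEQ_le_const) auto
    then show False using \<rho> by simp
  qed
  then have "strongly_exposes (\<lambda>f. Re (\<phi> f)) B b"
    using b Re_dual[OF \<phi>(1)] unfolding strongly_exposes_def by blast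
  then show "b \<in> {b. \<exists>\<phi>. strongly_exposes \<phi> B b}" by blast
next
  fix b assume "b \<in> {b. \<exists>\<phi>. strongly_exposes \<phi> B b}"
  then obtain \<phi> where e: "strongly_exposes \<phi> B b" by blast
  then have \<phi>: "\<phi> \<in> real_dual" and b: "b \<in> B" "b \<in> X"
    and exp: "\<And>\<rho>. \<rho> > 0 \<Longrightarrow> \<exists>\<delta>>0. \<forall>x\<in>B. \<phi> x > \<phi> b - \<delta> \<longrightarrow> N (x - b) < \<rho>"
    using B by (auto simp: strongly_exposes_def)
  have "\<phi> f < \<phi> b" if f: "f \<in> B" "f \<noteq> b" for f
  proof (rule ccontr)
    assume ge: "\<not> \<phi> f < \<phi> b"
    have fX: "f - b \<in> X" using f(1) b B diff_mem by blast
    have "N (f - b) < \<rho>" if "\<rho> > 0" for \<rho> using exp[OF that] f(1) ge by force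
    then have "N (f - b) = 0" using norm_nonneg[OF fX] by (metis less_irrefl linorder_not_le order.antisym)
    then show False using definite[OF fX] f(2) by simp
  qed
  moreover have "(\<lambda>n. N (\<lambda>x. s n x - b x)) \<longlonglongrightarrow> 0"
    if s: "\<And>n. s n \<in> B" and lim: "(\<lambda>n::nat. \<phi> (s n)) \<longlonglongrightarrow> \<phi> b" for s
  proof (rule LIMSEQ_I)
    fix \<rho> :: real assume "\<rho> > 0"
    from exp[OF this] obtain \<delta> where \<delta>: "\<delta> > 0" "\<And>x. x \<in> B \<Longrightarrow> \<phi> x > \<phi> b - \<delta> \<Longrightarrow> N (x - b) < \<rho>" by blast
    have "eventually (\<lambda>n. \<phi> (s n) > \<phi> b - \<delta>) sequentially" using lim \<delta>(1) by (intro order_tendstoD) auto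
    then obtain n0 where n0: "\<And>n. n \<ge> n0 \<Longrightarrow> \<phi> (s n) > \<phi> b - \<delta>" by (auto simp: eventually_sequentially)
    have "norm (N (\<lambda>x. s n x - b x) - 0) < \<rho>" if "n \<ge> n0" for n
    proof -
      have "s n - b \<in> X" using s b B diff_mem by blast
      then show ?thesis using \<delta>(2)[OF s n0[OF that]] norm_nonneg by (simp add: fun_diff_def)
    qed
    then show "\<exists>no. \<forall>n\<ge>no. norm (N (\<lambda>x. s n x - b x) - 0) < \<rho>" by blast
  qed
  ultimately show "b \<in> strongly_exposed_points X N B"
    unfolding strongly_exposed_points_def using b(1) complexify_dual[OF \<phi>] by (auto intro!: bexI)
qed

text \<open>The hull is an intersection, so \<open>B\<close> lies in it exactly when
  \<open>B\<close> lies in every closed convex set containing the exposed points. The opposite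
  inclusion holds as \<open>B\<close> is itself such a set.\<close>

lemma RNP_iff:
  "RNP X N \<longleftrightarrow> (\<forall>B T M. B \<subseteq> X \<longrightarrow> seq_closed B \<longrightarrow> convex B \<longrightarrow> (\<forall>x\<in>B. N x \<le> M) \<longrightarrow>
     T \<subseteq> X \<longrightarrow> seq_closed T \<longrightarrow> convex T \<longrightarrow> (\<forall>\<phi> b. strongly_exposes \<phi> B b \<longrightarrow> b \<in> T) \<longrightarrow> B \<subseteq> T)"
  (is "_ \<longleftrightarrow> ?R")
proof
  assume rnp: "RNP X N"
  show ?R
  proof (intro allI impI)
    fix B T M assume B: "B \<subseteq> X" "seq_closed B" "convex B" "\<forall>x\<in>B. N x \<le> M"
      and T: "T \<subseteq> X" "seq_closed T" "convex T" and exp: "\<forall>\<phi> b. strongly_exposes \<phi> B b \<longrightarrow> b \<in> T"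
    have "B = closed_convex_in X N hull strongly_exposed_points X N B"
      using rnp B unfolding RNP_def closed_convex_in_iff norm_bounded_def by blast
    also have "\<dots> \<subseteq> T"
      using T exp unfolding strongly_exposed_points_eq[OF B(1)]
      by (intro hull_minimal) (auto simp: closed_convex_in_iff)
    finally show "B \<subseteq> T" .
  qed
next
  assume R: ?R
  show "RNP X N" unfolding RNP_def
  proof (intro allI impI)
    fix B assume "closed_convex_in X N B \<and> norm_bounded N B"
    then obtain M where B: "B \<subseteq> X" "seq_closed B" "convex B" "\<forall>x\<in>B. N x \<le> M" and cB: "closed_convex_in X N B"
      unfolding norm_bounded_def closed_convex_in_iff by blast
    show "B = closed_convex_in X N hull strongly_exposed_points X N B"
    proof (rule antisym)
      show "B \<subseteq> closed_convex_in X N hull strongly_exposed_points X N B"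
        unfolding hull_def
      proof (rule Inter_greatest)
        fix T assume "T \<in> {T. closed_convex_in X N T \<and> strongly_exposed_points X N B \<subseteq> T}"
        then have "T \<subseteq> X" "seq_closed T" "convex T" "\<forall>\<phi> b. strongly_exposes \<phi> B b \<longrightarrow> b \<in> T"
          by (auto simp: closed_convex_in_iff strongly_exposed_points_eq[OF B(1)])
        then show "B \<subseteq> T" using R B by blast
      qed
      show "closed_convex_in X N hull strongly_exposed_points X N B \<subseteq> B"
        using cB by (intro hull_minimal) (auto simp: strongly_exposed_points_def)
    qed
  qed
qed

end

theorem RNP_semi_embedding:
  assumes "complex_function_space X NX" "complex_function_space Y NY"
    and rnp: "RNP Y NY"
    and subset: "X \<subseteq> Y"
    and bounded_inclusion: "\<And>f. f \<in> X \<Longrightarrow> NY f \<le> K * NX f"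
    and ball_closed: "\<And>s c l. (\<And>n::nat. s n \<in> X) \<Longrightarrow> (\<And>n. NX (s n) \<le> c) \<Longrightarrow> l \<in> Y \<Longrightarrow>
      (\<lambda>n. NY (\<lambda>x. s n x - l x)) \<longlonglongrightarrow> 0 \<Longrightarrow> l \<in> X \<and> NX l \<le> c"
    and fragmented: "\<And>\<epsilon>. \<epsilon> > 0 \<Longrightarrow> \<exists>(F :: nat \<Rightarrow> _ set) \<rho>. \<rho> > 0 \<and> X \<subseteq> (\<Union>n. F n) \<and>
      (\<forall>n. \<forall>f\<in>F n \<inter> X. \<forall>g\<in>F n \<inter> X. NY (\<lambda>x. f x - g x) < \<rho> \<longrightarrow> NX (\<lambda>x. f x - g x) < \<epsilon>) \<and>
      (\<forall>n c s l. (\<forall>k::nat. s k \<in> F n \<inter> X \<and> NX (s k) \<le> c) \<longrightarrow> l \<in> X \<longrightarrow>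
        (\<lambda>k. NY (\<lambda>x. s k x - l x)) \<longlonglongrightarrow> 0 \<longrightarrow> l \<in> F n)"
  shows "RNP X NX"
proof -
  interpret X: complex_function_space X NX by fact
  interpret Y: complex_function_space Y NY by fact
  interpret semi_embedding X NX Y NY
  proof
    show "X \<subseteq> Y" by fact
    show "\<exists>K. \<forall>x\<in>X. NY x \<le> K * NX x" using bounded_inclusion by blast
    show "l \<in> X \<and> NX l \<le> c"
      if "\<And>n::nat. s n \<in> X" "\<And>n. NX (s n) \<le> c" "l \<in> Y" "(\<lambda>n. NY (s n - l)) \<longlonglongrightarrow> 0" for s c l
      using ball_closed[OF that(1-3)] that(4) by (simp add: fun_diff_def)
    show "\<exists>(F :: nat \<Rightarrow> _ set) \<rho>. \<rho> > 0 \<and> X \<subseteq> (\<Union>n. F n) \<and>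
      (\<forall>n. \<forall>x\<in>F n \<inter> X. \<forall>y\<in>F n \<inter> X. NY (x - y) < \<rho> \<longrightarrow> NX (x - y) < \<epsilon>) \<and>
      (\<forall>n c s l. (\<forall>k::nat. s k \<in> F n \<inter> X \<and> NX (s k) \<le> c) \<longrightarrow> l \<in> X \<longrightarrow>
        (\<lambda>k. NY (s k - l)) \<longlonglongrightarrow> 0 \<longrightarrow> l \<in> F n)" if "\<epsilon> > 0" for \<epsilon>
      using fragmented[OF that] unfolding fun_diff_def .
    show "B \<subseteq> T" if "B \<subseteq> Y" "Y.seq_closed B" "convex B" "\<And>x. x \<in> B \<Longrightarrow> NY x \<le> M"
      "T \<subseteq> Y" "Y.seq_closed T" "convex T" "\<And>\<phi> b. Y.strongly_exposes \<phi> B b \<Longrightarrow> b \<in> T" for B T M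
      using rnp that unfolding Y.RNP_iff by blast
  qed
  show ?thesis
    unfolding X.RNP_iff using X.subset_if_dentable[OF source_dentable] by blast
qed

section \<open>Lebesgue spaces\<close>

text \<open>Positive arguments are covered by convexity of the power function. When one of them is
  0, \<open>w powr q \<le> w\<close> for a weight \<open>w\<close> in the unit interval
  suffices.\<close>

lemma powr_convex_combination:
  fixes a b u v q :: real
  assumes q: "1 \<le> q" and nonneg: "0 \<le> a" "0 \<le> b" "0 \<le> u" "0 \<le> v" and one: "u + v = 1"
  shows "(u * a + v * b) powr q \<le> u * a powr q + v * b powr q"
proof -
  have aux: "(w * c) powr q \<le> w * c powr q" if "0 \<le> w" "w \<le> 1" "0 \<le> c" for w c :: real
  proof -
    have "w powr q \<le> w powr 1" using that q by (intro powr_mono') auto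
    then have "w powr q * c powr q \<le> w * c powr q" using that by (intro mult_right_mono) auto
    then show ?thesis using that by (simp add: powr_mult)
  qed
  show ?thesis
  proof (cases "a = 0 \<or> b = 0")
    case True
    then show ?thesis using aux[of u a] aux[of v b] nonneg one by auto
  next
    case False
    then show ?thesis
      using powr_convex[OF q] nonneg one unfolding convex_on_def by simp
  qed
qed

lemma Lspace_measurable: "f \<in> Lspace M q \<Longrightarrow> f \<in> borel_measurable M"
  and Lspace_integrable: "f \<in> Lspace M q \<Longrightarrow> integrable M (\<lambda>x. cmod (f x) powr q)"
  by (auto simp: Lspace_def)

lemma Lnorm_nonneg: "0 \<le> Lnorm M q f"
  by (simp add: Lnorm_def)

lemma Lnorm_powr:
  assumes "0 < q" shows "Lnorm M q f powr q = (LINT x|M. cmod (f x) powr q)"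
  using assms by (simp add: Lnorm_def powr_powr integral_nonneg_AE)

lemma Lnorm_le_iff:
  assumes "0 < q" "0 \<le> c"
  shows "Lnorm M q f \<le> c \<longleftrightarrow> (LINT x|M. cmod (f x) powr q) \<le> c powr q"
  using assms Lnorm_nonneg[of M q f] Lnorm_powr[OF assms(1), of M f]
  by (metis powr_mono2 powr_less_mono2 less_imp_le not_less)

lemma Lspace_dominated:
  assumes q: "0 < q" and f: "f \<in> borel_measurable M" and h: "integrable M h"
    and le: "\<And>x. cmod (f x) powr q \<le> h x" and c: "0 \<le> c" "integral\<^sup>L M h \<le> c powr q"
  shows "f \<in> Lspace M q" "Lnorm M q f \<le> c"
proof -
  have i: "integrable M (\<lambda>x. cmod (f x) powr q)"
    using f le by (intro Bochner_Integration.integrable_bound[OF h]) (auto intro: order.trans[OF le abs_ge_self])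
  then show "f \<in> Lspace M q" using f by (simp add: Lspace_def)
  have "(LINT x|M. cmod (f x) powr q) \<le> integral\<^sup>L M h" using i h le by (intro integral_mono) auto
  then show "Lnorm M q f \<le> c" using c q by (simp add: Lnorm_le_iff)
qed

lemma Lspace_zero: "(\<lambda>_. 0) \<in> Lspace M q"
  and Lnorm_zero: "Lnorm M q (\<lambda>_. 0) = 0"
  by (simp_all add: Lspace_def Lnorm_def)

lemma Lspace_multiple:
  assumes "f \<in> Lspace M q"
  shows "(\<lambda>x. c * f x) \<in> Lspace M q"
  using assms by (auto simp: Lspace_def norm_mult powr_mult)

lemma Lnorm_multiple:
  assumes "0 < q"
  shows "Lnorm M q (\<lambda>x. c * f x) = cmod c * Lnorm M q f"
  using assms by (simp add: Lnorm_def norm_mult powr_mult powr_powr integral_nonneg_AE)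

lemma Lnorm_minus: "Lnorm M q (\<lambda>x. - f x) = Lnorm M q f"
  by (simp add: Lnorm_def)

text \<open>Normalise by numbers \<open>a\<close> and \<open>b\<close> strictly above the two norms,
  which avoids a separate case of norm 0. The sum is then \<open>a + b\<close> times a convex
  combination, to which convexity of the power applies.\<close>

lemma minkowski:
  assumes q: "1 \<le> q" and f: "f \<in> Lspace M q" and g: "g \<in> Lspace M q"
  shows "(\<lambda>x. f x + g x) \<in> Lspace M q" "Lnorm M q (\<lambda>x. f x + g x) \<le> Lnorm M q f + Lnorm M q g"
proof -
  have q0: "0 < q" using q by simp
  have main: "(\<lambda>x. f x + g x) \<in> Lspace M q \<and> Lnorm M q (\<lambda>x. f x + g x) \<le> a + b"
    if a: "Lnorm M q f < a" and b: "Lnorm M q g < b" for a b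
  proof -
    have ab: "a > 0" "b > 0" using a b Lnorm_nonneg[of M q f] Lnorm_nonneg[of M q g] by auto
    define s where "s = a + b"
    have s: "s > 0" using ab by (simp add: s_def)
    define h where "h x = s powr q * (a / s * (cmod (f x) powr q / a powr q) + b / s * (cmod (g x) powr q / b powr q))" for x
    have h: "integrable M h" unfolding h_def
      using Lspace_integrable[OF f] Lspace_integrable[OF g] by (intro integrable_mult_right Bochner_Integration.integrable_add integrable_divide) auto
    have le: "cmod (f x + g x) powr q \<le> h x" for x
    proof -
      have "cmod (f x + g x) \<le> s * (a / s * (cmod (f x) / a) + b / s * (cmod (g x) / b))"
        using ab s norm_triangle_ineq[of "f x" "g x"] by (simp add: distrib_left)
      then have "cmod (f x + g x) powr q \<le> (s * (a / s * (cmod (f x) / a) + b / s * (cmod (g x) / b))) powr q"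
        using q0 by (intro powr_mono2) auto
      also have "\<dots> = s powr q * (a / s * (cmod (f x) / a) + b / s * (cmod (g x) / b)) powr q"
        by (rule powr_mult)
      also have "\<dots> \<le> s powr q * (a / s * (cmod (f x) / a) powr q + b / s * (cmod (g x) / b) powr q)"
        using ab s by (intro mult_left_mono powr_convex_combination q) (auto simp: s_def add_divide_distrib[symmetric])
      also have "\<dots> = h x" using ab by (simp add: h_def powr_divide)
      finally show ?thesis .
    qed
    have int: "integral\<^sup>L M h = s powr q * (a / s * ((LINT x|M. cmod (f x) powr q) / a powr q) + b / s * ((LINT x|M. cmod (g x) powr q) / b powr q))"
      unfolding h_def using Lspace_integrable[OF f] Lspace_integrable[OF g] by simp
    have "(LINT x|M. cmod (f x) powr q) / a powr q \<le> 1" "(LINT x|M. cmod (g x) powr q) / b powr q \<le> 1"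
      using a b ab q0 Lnorm_le_iff[OF q0, of a M f] Lnorm_le_iff[OF q0, of b M g] by auto
    then have "a / s * ((LINT x|M. cmod (f x) powr q) / a powr q) + b / s * ((LINT x|M. cmod (g x) powr q) / b powr q)
        \<le> a / s * 1 + b / s * 1" using ab s by (intro add_mono mult_left_mono) auto
    also have "\<dots> = 1" using s by (simp add: s_def add_divide_distrib[symmetric])
    finally have "integral\<^sup>L M h \<le> s powr q * 1" unfolding int by (intro mult_left_mono) auto
    then show ?thesis
      using Lspace_dominated[OF q0 _ h le, of s] s Lspace_measurable[OF f] Lspace_measurable[OF g] by (simp add: s_def)
  qed
  show "(\<lambda>x. f x + g x) \<in> Lspace M q" using main[of "Lnorm M q f + 1" "Lnorm M q g + 1"] by simp
  show "Lnorm M q (\<lambda>x. f x + g x) \<le> Lnorm M q f + Lnorm M q g"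
  proof (rule field_le_epsilon)
    fix e :: real assume "e > 0"
    then show "Lnorm M q (\<lambda>x. f x + g x) \<le> Lnorm M q f + Lnorm M q g + e"
      using main[of "Lnorm M q f + e / 2" "Lnorm M q g + e / 2"] by simp
  qed
qed

lemma Lspace_diff:
  assumes q: "1 \<le> q" and f: "f \<in> Lspace M q" and g: "g \<in> Lspace M q"
  shows "(\<lambda>x. f x - g x) \<in> Lspace M q" "Lnorm M q (\<lambda>x. f x - g x) \<le> Lnorm M q f + Lnorm M q g"
  using minkowski[OF q f Lspace_multiple[OF g, of "-1"]] by (simp_all add: Lnorm_minus)

lemma Lnorm_diff_commute: "Lnorm M q (\<lambda>x. f x - g x) = Lnorm M q (\<lambda>x. g x - f x)"
  by (simp add: Lnorm_def norm_minus_commute)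

lemma Lnorm_diff_triangle:
  assumes q: "1 \<le> q" and "f \<in> Lspace M q" "g \<in> Lspace M q" "h \<in> Lspace M q"
  shows "Lnorm M q (\<lambda>x. f x - h x) \<le> Lnorm M q (\<lambda>x. f x - g x) + Lnorm M q (\<lambda>x. g x - h x)"
  using minkowski(2)[OF q Lspace_diff(1)[OF q assms(2,3)] Lspace_diff(1)[OF q assms(3,4)]] by simp

text \<open>Young's inequality after dividing by numbers strictly above the norms; these then
  decrease to the norms.\<close>

lemma holder:
  assumes p: "1 < p" and f: "f \<in> Lspace M (conjugate_exponent p)" and g: "g \<in> Lspace M p"
  shows "cmod (LINT x|M. f x * g x) \<le> Lnorm M (conjugate_exponent p) f * Lnorm M p g"
proof -
  define p' where "p' = conjugate_exponent p"
  have p': "p' > 1" "1 / p' + 1 / p = 1" using p by (auto simp: p'_def conjugate_exponent_def field_simps)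
  have f: "f \<in> Lspace M p'" using f by (simp add: p'_def)
  have main: "cmod (LINT x|M. f x * g x) \<le> a * b" if a: "Lnorm M p' f < a" and b: "Lnorm M p g < b" for a b
  proof -
    have ab: "a > 0" "b > 0" using a b Lnorm_nonneg[of M p' f] Lnorm_nonneg[of M p g] by auto
    define h where "h x = a * b * ((cmod (f x) powr p' / a powr p') / p' + (cmod (g x) powr p / b powr p) / p)" for x
    have h: "integrable M h" unfolding h_def
      using Lspace_integrable[OF f] Lspace_integrable[OF g] by (intro integrable_mult_right Bochner_Integration.integrable_add integrable_divide) auto
    have le: "norm (f x * g x) \<le> h x" for x
    proof -
      have "cmod (f x) / a * (cmod (g x) / b) \<le> (cmod (f x) / a) powr p' / p' + (cmod (g x) / b) powr p / p"
        using p' p ab by (intro Youngs_inequality) auto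
      then have "a * b * (cmod (f x) / a * (cmod (g x) / b)) \<le> a * b * ((cmod (f x) / a) powr p' / p' + (cmod (g x) / b) powr p / p)"
        using ab by (intro mult_left_mono) auto
      then show ?thesis using ab by (simp add: h_def powr_divide norm_mult)
    qed
    have int: "integral\<^sup>L M h = a * b * (((LINT x|M. cmod (f x) powr p') / a powr p') / p' + ((LINT x|M. cmod (g x) powr p) / b powr p) / p)"
      unfolding h_def using Lspace_integrable[OF f] Lspace_integrable[OF g] by simp
    have "(LINT x|M. cmod (f x) powr p') / a powr p' \<le> 1" "(LINT x|M. cmod (g x) powr p) / b powr p \<le> 1"
      using a b ab p p' Lnorm_le_iff[of p' a M f] Lnorm_le_iff[of p b M g] by auto
    then have "((LINT x|M. cmod (f x) powr p') / a powr p') / p' + ((LINT x|M. cmod (g x) powr p) / b powr p) / p \<le> 1 / p' + 1 / p"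
      using p p' by (intro add_mono divide_right_mono) auto
    then have "integral\<^sup>L M h \<le> a * b * 1" unfolding int using ab p' by (intro mult_left_mono) auto
    moreover have "integrable M (\<lambda>x. f x * g x)"
      using le Lspace_measurable[OF f] Lspace_measurable[OF g]
      by (intro Bochner_Integration.integrable_bound[OF h]) (auto intro: order.trans[OF le abs_ge_self])
    then have "cmod (LINT x|M. f x * g x) \<le> integral\<^sup>L M h"
      using le h by (intro order.trans[OF integral_norm_bound integral_mono]) auto
    ultimately show ?thesis by simp
  qed
  have "((\<lambda>e. (Lnorm M p' f + e) * (Lnorm M p g + e)) \<longlongrightarrow> (Lnorm M p' f + 0) * (Lnorm M p g + 0)) (at_right 0)"
    by (intro tendsto_intros)
  moreover have "eventually (\<lambda>e. cmod (LINT x|M. f x * g x) \<le> (Lnorm M p' f + e) * (Lnorm M p g + e)) (at_right (0::real))"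
    using eventually_at_right_less[of "0::real"] by eventually_elim (rule main, auto)
  ultimately have "cmod (LINT x|M. f x * g x) \<le> (Lnorm M p' f + 0) * (Lnorm M p g + 0)"
    by (rule tendsto_lowerbound) simp
  then show ?thesis by (simp add: p'_def)
qed

text \<open>Pointwise limits stay in a norm ball, including membership in the space. This gives
  completeness, closedness of balls and closedness of the covering pieces.\<close>

lemma Lspace_fatou:
  assumes q: "0 < q" and v: "\<And>n. v n \<in> Lspace M q" "\<And>n. Lnorm M q (v n) \<le> c"
    and lim: "\<And>x. (\<lambda>n. v n x) \<longlonglongrightarrow> w x"
  shows "w \<in> Lspace M q" "Lnorm M q w \<le> c"
proof -
  have c: "0 \<le> c" using v(2)[of 0] Lnorm_nonneg[of M q "v 0"] by simp
  note [measurable] = Lspace_measurable[OF v(1)]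
  have w [measurable]: "w \<in> borel_measurable M" using lim by (intro borel_measurable_LIMSEQ_metric[of v M w]) auto
  have "(\<integral>\<^sup>+x. ennreal (cmod (w x) powr q) \<partial>M) = (\<integral>\<^sup>+x. liminf (\<lambda>n. ennreal (cmod (v n x) powr q)) \<partial>M)"
  proof (rule nn_integral_cong)
    fix x
    have "(\<lambda>n. ennreal (cmod (v n x) powr q)) \<longlonglongrightarrow> ennreal (cmod (w x) powr q)"
      using q by (intro tendsto_ennrealI tendsto_powr' tendsto_intros lim) auto
    then show "ennreal (cmod (w x) powr q) = liminf (\<lambda>n. ennreal (cmod (v n x) powr q))"
      by (rule lim_imp_Liminf[OF trivial_limit_sequentially, symmetric])
  qed
  also have "\<dots> \<le> liminf (\<lambda>n. \<integral>\<^sup>+x. ennreal (cmod (v n x) powr q) \<partial>M)"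
    by (intro nn_integral_liminf) auto
  also have "\<dots> \<le> liminf (\<lambda>n::nat. ennreal (c powr q))"
  proof (intro Liminf_mono always_eventually allI)
    fix n
    have "(\<integral>\<^sup>+x. ennreal (cmod (v n x) powr q) \<partial>M) = ennreal (LINT x|M. cmod (v n x) powr q)"
      using Lspace_integrable[OF v(1)] by (intro nn_integral_eq_integral) auto
    also have "\<dots> \<le> ennreal (c powr q)" using v(2)[of n] q c by (intro ennreal_leI) (simp add: Lnorm_le_iff)
    finally show "(\<integral>\<^sup>+x. ennreal (cmod (v n x) powr q) \<partial>M) \<le> ennreal (c powr q)" .
  qed
  also have "\<dots> = ennreal (c powr q)" by (simp add: Liminf_const)
  finally have le: "(\<integral>\<^sup>+x. ennreal (cmod (w x) powr q) \<partial>M) \<le> ennreal (c powr q)" .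
  then have int: "integrable M (\<lambda>x. cmod (w x) powr q)"
    by (intro integrableI_nonneg) (auto simp: top.extremum_strict intro: le_less_trans)
  then show "w \<in> Lspace M q" by (simp add: Lspace_def)
  have "ennreal (LINT x|M. cmod (w x) powr q) \<le> ennreal (c powr q)"
    using le int by (subst (asm) nn_integral_eq_integral) auto
  then show "Lnorm M q w \<le> c" using q c by (simp add: Lnorm_le_iff)
qed

text \<open>The surplus power \<open>t - r\<close> of the modulus is bounded by
  \<open>a powr (t - r)\<close>. One constant bounds both the norm and the supremum, so the powers
  of \<open>a\<close> recombine to \<open>a powr t\<close>.\<close>

lemma Lspace_bounded_interpolation:
  assumes r: "0 < r" "r \<le> t" and f: "f \<in> Lspace M r" and a: "Lnorm M r f \<le> a" "\<And>x. cmod (f x) \<le> a"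
  shows "f \<in> Lspace M t" "Lnorm M t f \<le> a"
proof -
  have a0: "0 \<le> a" using a(1) Lnorm_nonneg[of M r f] by simp
  have t: "0 < t" using r by simp
  define h where "h x = a powr (t - r) * cmod (f x) powr r" for x
  have h: "integrable M h" unfolding h_def using Lspace_integrable[OF f] by simp
  have le: "cmod (f x) powr t \<le> h x" for x
  proof (cases "f x = 0")
    case False
    have "cmod (f x) powr t = cmod (f x) powr (t - r) * cmod (f x) powr r" by (simp add: powr_add[symmetric])
    also have "\<dots> \<le> h x" unfolding h_def using a(2)[of x] r by (intro mult_right_mono powr_mono2) auto
    finally show ?thesis .
  qed (simp add: h_def)
  have "integral\<^sup>L M h = a powr (t - r) * (LINT x|M. cmod (f x) powr r)" unfolding h_def by simp
  also have "\<dots> \<le> a powr (t - r) * a powr r" using a(1) r a0 by (intro mult_left_mono) (auto simp: Lnorm_le_iff)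
  also have "\<dots> = a powr t" by (simp add: powr_add[symmetric])
  finally have "integral\<^sup>L M h \<le> a powr t" .
  then show "f \<in> Lspace M t" "Lnorm M t f \<le> a"
    using Lspace_dominated[OF t Lspace_measurable[OF f] h le a0] by auto
qed

section \<open>Separability of Lebesgue spaces over a second countable space\<close>

lemma sum_fun_closed:
  fixes f :: "'i \<Rightarrow> 'a \<Rightarrow> complex"
  assumes "finite A" "\<And>i. i \<in> A \<Longrightarrow> f i \<in> S"
    and "(\<lambda>_. 0) \<in> S" "\<And>g h. g \<in> S \<Longrightarrow> h \<in> S \<Longrightarrow> (\<lambda>x. g x + h x) \<in> S"
  shows "(\<lambda>x. \<Sum>i\<in>A. f i x) \<in> S"
  using assms(1,2) by (induction A rule: finite_induct) (simp_all add: assms(3,4))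

text \<open>Outer regularity gives an open \<open>U\<close> of slightly larger measure. It is a
  countable union of basic sets, and by continuity from below finitely many of them exhaust it up to
  \<open>\<eta>\<close>.\<close>

lemma emeasure_approximation:
  fixes M :: "'a::second_countable_topology measure"
  assumes sets: "sets M = sets borel"
    and outer: "\<And>A. A \<in> sets borel \<Longrightarrow> emeasure M A = (INF U\<in>{U. open U \<and> A \<subseteq> U}. emeasure M U)"
    and B: "countable \<B>" "\<And>C. C \<in> \<B> \<Longrightarrow> open C" "\<And>S. open S \<Longrightarrow> \<exists>U. U \<subseteq> \<B> \<and> S = \<Union>U"
    and A: "A \<in> sets borel" "emeasure M A < \<infinity>" and \<eta>: "\<eta> > 0"
  obtains F where "finite F" "F \<subseteq> \<B>" "emeasure M (\<Union>F) < \<infinity>" "measure M (A - \<Union>F) < \<eta>" "measure M (\<Union>F - A) < \<eta>"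
proof -
  have "emeasure M A < emeasure M A + ennreal \<eta>" using A(2) \<eta> by (simp add: ennreal_add_left_cancel_less[of _ 0, simplified] less_top)
  then obtain U where U: "open U" "A \<subseteq> U" "emeasure M U < emeasure M A + ennreal \<eta>"
    unfolding outer[OF A(1)] INF_less_iff by blast
  have Ufin: "emeasure M U < \<infinity>" using U(3) A(2) by (metis ennreal_add_less_top ennreal_less_top infinity_ennreal_def less_trans)
  have meas: "A \<in> sets M" "U \<in> sets M" using A U(1) sets by auto
  have fm: "A \<in> fmeasurable M" "U \<in> fmeasurable M" using meas A(2) Ufin by (auto intro: fmeasurableI)
  have "measure M U < measure M A + \<eta>"
    using U(3) \<eta> fm by (simp add: emeasure_eq_measure2 ennreal_plus[symmetric] ennreal_less_iff del: ennreal_plus)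
  then have UA: "measure M (U - A) < \<eta>" using measure_Diff[of M U A] Ufin meas U(2) by simp
  obtain V where V: "V \<subseteq> \<B>" "U = \<Union>V" using B(3)[OF U(1)] by blast
  have cV: "countable V" using V(1) B(1) countable_subset by blast
  \<comment> \<open>The sets of \<open>V\<close> are enumerated by \<open>to_nat_on V\<close>;
    \<open>W n\<close> unites the finitely many of index below \<open>n\<close>.\<close>
  define W where "W n = \<Union>{v \<in> V. to_nat_on V v < n}" for n
  have fin: "finite {v \<in> V. to_nat_on V v < n}" for n
    by (rule finite_imageD[of "to_nat_on V"])
      (auto intro: finite_subset[of _ "{..<n}"] inj_on_subset[OF inj_on_to_nat_on[OF cV]])
  have Wm: "W n \<in> sets M" for n
    unfolding W_def using fin V(1) B(2) sets by (intro sets.finite_Union) auto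
  have "incseq W" unfolding W_def by (intro monoI) force
  moreover have "(\<Union>n. W n) = U" using V(2) by (auto simp: W_def)
  ultimately have "(\<lambda>n. measure M (W n)) \<longlonglongrightarrow> measure M U"
    using Lim_measure_incseq[of W M] Wm Ufin by (auto simp: less_top)
  then have "eventually (\<lambda>n. measure M (W n) > measure M U - \<eta>) sequentially"
    using \<eta> by (intro order_tendstoD) auto
  then obtain n where n: "measure M (W n) > measure M U - \<eta>" by (auto simp: eventually_sequentially)
  have WU: "W n \<subseteq> U" using V(2) by (auto simp: W_def)
  have Wfm: "W n \<in> fmeasurable M" using fmeasurableI2[OF fm(2) WU Wm] .
  have UW: "measure M (U - W n) < \<eta>" using measure_Diff[of M U "W n"] Ufin meas Wm WU n by simp
  have "measure M (A - W n) \<le> measure M (U - W n)"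
    using U(2) meas Wm fm Wfm by (intro measure_mono_fmeasurable) (auto intro: fmeasurable.Diff)
  moreover have "measure M (W n - A) \<le> measure M (U - A)"
    using WU meas Wm fm Wfm by (intro measure_mono_fmeasurable) (auto intro: fmeasurable.Diff)
  ultimately show ?thesis
    using that[of "{v \<in> V. to_nat_on V v < n}"] fin V(1) UW UA Wfm unfolding W_def fmeasurable_def by auto
qed

lemma Lspace_indicator:
  assumes q: "0 < q" and A: "A \<in> fmeasurable M"
  shows "(\<lambda>x. c * indicator A x) \<in> Lspace M q" "Lnorm M q (indicator A) = measure M A powr (1 / q)"
proof -
  have eq: "cmod (indicator A x) powr q = indicat_real A x" for x using q by (simp add: indicator_def)
  have Am: "A \<in> sets M" "emeasure M A < \<infinity>" using A by (auto simp: fmeasurable_def)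
  have "indicator A \<in> Lspace M q"
    using Am by (auto simp: Lspace_def eq intro!: integrable_real_indicator)
  then show "(\<lambda>x. c * indicator A x) \<in> Lspace M q" by (rule Lspace_multiple)
  show "Lnorm M q (indicator A) = measure M A powr (1 / q)"
    unfolding Lnorm_def eq using Am sets.sets_into_space by (simp add: Int_absorb2)
qed

lemma Lnorm_indicator_diff:
  assumes q: "0 < q" and A: "A \<in> fmeasurable M" "B \<in> fmeasurable M"
    and small: "measure M (A - B) < \<eta>" "measure M (B - A) < \<eta>"
  shows "Lnorm M q (\<lambda>x. indicator A x - indicator B x) \<le> (2 * \<eta>) powr (1 / q)"
proof -
  define E where "E = (A - B) \<union> (B - A)"
  have E: "E \<in> fmeasurable M" unfolding E_def using A by (intro fmeasurable.Un fmeasurable.Diff)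
  have eq: "Lnorm M q (\<lambda>x. indicator A x - indicator B x) = Lnorm M q (indicator E)"
    unfolding Lnorm_def by (intro arg_cong2[of _ _ _ _ "(powr)"] Bochner_Integration.integral_cong refl)
      (auto simp: indicator_def E_def)
  have "measure M E \<le> measure M (A - B) + measure M (B - A)"
    unfolding E_def using A by (intro measure_Un_le) (auto simp: fmeasurable_def)
  then have "measure M E \<le> 2 * \<eta>" using small by simp
  then show ?thesis unfolding eq Lspace_indicator(2)[OF q E] using q by (intro powr_mono2) auto
qed

lemma Lspace_separable:
  fixes M :: "'a::second_countable_topology measure"
  assumes sets: "sets M = sets borel"
    and outer: "\<And>A. A \<in> sets borel \<Longrightarrow> emeasure M A = (INF U\<in>{U. open U \<and> A \<subseteq> U}. emeasure M U)"
    and q: "1 \<le> q"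
  shows "\<exists>b :: nat \<Rightarrow> 'a \<Rightarrow> complex. (\<forall>m. b m \<in> Lspace M q) \<and>
    (\<forall>f\<in>Lspace M q. \<forall>\<epsilon>>0. \<exists>m. Lnorm M q (\<lambda>x. f x - b m x) < \<epsilon>)"
proof -
  have q0: "0 < q" using q by simp
  obtain \<B> :: "'a set set" where B: "countable \<B>" "\<And>C. C \<in> \<B> \<Longrightarrow> open C" "\<And>S. open S \<Longrightarrow> \<exists>U. U \<subseteq> \<B> \<and> S = \<Union>U"
    using univ_second_countable by metis
  obtain R :: "complex set" where R: "countable R" "\<And>X. open X \<Longrightarrow> X \<noteq> {} \<Longrightarrow> \<exists>d\<in>R. d \<in> X"
    using countable_dense_setE by metis
  define \<U> where "\<U> = Union ` {F. finite F \<and> F \<subseteq> \<B>}"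
  \<comment> \<open>Lists of coefficients and sets, because the sum of two such functions is then
    given by appending the lists.\<close>
  define G where "G l = (\<lambda>x. \<Sum>z\<leftarrow>l. fst z * indicator (snd z) x)" for l :: "(complex \<times> 'a set) list"
  \<comment> \<open>Basic open sets may have infinite measure, hence the intersection with
    \<open>Lspace M q\<close>.\<close>
  define D where "D = G ` lists (R \<times> \<U>) \<inter> Lspace M q"
  have "countable \<U>" unfolding \<U>_def using countable_Collect_finite_subset[OF B(1)] by (intro countable_image)
  then have cD: "countable D" unfolding D_def using R(1)
    by (intro countable_Int1 countable_image countable_lists countable_SIGMA)
  have G_app: "G (l @ l') x = G l x + G l' x" for l l' x by (simp add: G_def)
  have D_sum: "(\<lambda>x. f x + g x) \<in> D" if "f \<in> D" "g \<in> D" for f g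
  proof -
    obtain l l' where l: "l \<in> lists (R \<times> \<U>)" "l' \<in> lists (R \<times> \<U>)" "f = G l" "g = G l'"
      using \<open>f \<in> D\<close> \<open>g \<in> D\<close> unfolding D_def by blast
    then have "(\<lambda>x. f x + g x) = G (l @ l')" by (auto simp: G_app)
    moreover have "l @ l' \<in> lists (R \<times> \<U>)" using l(1,2) by simp
    ultimately show ?thesis using that minkowski(1)[OF q] unfolding D_def by blast
  qed
  have D0: "(\<lambda>_. 0) \<in> D"
  proof -
    have "(\<lambda>_. 0) = G []" by (simp add: G_def)
    then show ?thesis unfolding D_def using Lspace_zero[of M q] by blast
  qed
  \<comment> \<open>The closure of \<open>D\<close>. It is shown to contain multiples of indicators,
    then simple functions, and these are dense by dominated convergence.\<close>
  define S where "S = {f \<in> Lspace M q. \<forall>\<epsilon>>0. \<exists>d\<in>D. Lnorm M q (\<lambda>x. f x - d x) < \<epsilon>}"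
  have S0: "(\<lambda>_. 0) \<in> S" unfolding S_def
    using D0 Lspace_zero[of M q] by (auto intro!: bexI[of _ "\<lambda>_. 0"] simp: Lnorm_zero)
  have S_sum: "(\<lambda>x. f x + g x) \<in> S" if fg: "f \<in> S" "g \<in> S" for f g
    unfolding S_def
  proof (intro CollectI conjI allI impI)
    have m: "f \<in> Lspace M q" "g \<in> Lspace M q" using fg by (auto simp: S_def)
    then show "(\<lambda>x. f x + g x) \<in> Lspace M q" by (rule minkowski(1)[OF q])
    fix \<epsilon> :: real assume "\<epsilon> > 0"
    then have e2: "\<epsilon> / 2 > 0" by simp
    obtain d where d: "d \<in> D" "Lnorm M q (\<lambda>x. f x - d x) < \<epsilon> / 2" using fg(1) e2 unfolding S_def by blast
    obtain d' where d': "d' \<in> D" "Lnorm M q (\<lambda>x. g x - d' x) < \<epsilon> / 2" using fg(2) e2 unfolding S_def by blast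
    have "Lnorm M q (\<lambda>x. (f x - d x) + (g x - d' x)) \<le> Lnorm M q (\<lambda>x. f x - d x) + Lnorm M q (\<lambda>x. g x - d' x)"
      using m d(1) d'(1) by (intro minkowski(2) q Lspace_diff(1)) (auto simp: D_def)
    moreover have "(\<lambda>x. (f x - d x) + (g x - d' x)) = (\<lambda>x. f x + g x - (d x + d' x))" by auto
    ultimately have "Lnorm M q (\<lambda>x. f x + g x - (d x + d' x)) < \<epsilon>" using d(2) d'(2) by simp
    then show "\<exists>d\<in>D. Lnorm M q (\<lambda>x. f x + g x - d x) < \<epsilon>" using D_sum[OF d(1) d'(1)] by (intro bexI[of _ "\<lambda>x. d x + d' x"]) auto
  qed
  have S_ind: "(\<lambda>x. c * indicator A x) \<in> S" if A: "A \<in> fmeasurable M" for c A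
    unfolding S_def
  proof (intro CollectI conjI allI impI)
    show "(\<lambda>x. c * indicator A x) \<in> Lspace M q" using Lspace_indicator(1)[OF q0 A] .
    fix \<epsilon> :: real assume \<epsilon>: "\<epsilon> > 0"
    \<comment> \<open>Adding 1 here and in \<open>w\<close> avoids division by 0. The number
      \<open>\<eta>\<close> solves \<open>(2 * \<eta>) powr (1 / q) = \<epsilon> / (3 * c1)\<close>,
      so replacing the set and replacing the coefficient cost at most \<open>\<epsilon> / 3\<close>
      each.\<close>
    define c1 where "c1 = cmod c + 1"
    have c1: "c1 > 0" "cmod c \<le> c1" using norm_ge_zero[of c] by (simp_all add: c1_def del: norm_ge_zero)
    define \<eta> where "\<eta> = (\<epsilon> / (3 * c1)) powr q / 2"
    have pos: "\<epsilon> / (3 * c1) > 0" using \<epsilon> c1 by simp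
    then have \<eta>: "\<eta> > 0" unfolding \<eta>_def using powr_gt_zero[of "\<epsilon> / (3 * c1)" q] by linarith
    have \<eta>q: "(2 * \<eta>) powr (1 / q) = \<epsilon> / (3 * c1)" using c1 \<epsilon> q0 by (simp add: \<eta>_def powr_powr)
    have Ab: "A \<in> sets borel" "emeasure M A < \<infinity>" using A sets by (auto simp: fmeasurable_def)
    obtain F where F: "finite F" "F \<subseteq> \<B>" "emeasure M (\<Union>F) < \<infinity>" "measure M (A - \<Union>F) < \<eta>" "measure M (\<Union>F - A) < \<eta>"
      using emeasure_approximation[OF sets outer B Ab \<eta>] by metis
    define W where "W = \<Union>F"
    have "open W" unfolding W_def using F(2) B(2) by blast
    then have W: "W \<in> fmeasurable M" using F(3) sets by (auto simp: W_def fmeasurable_def)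
    have WU: "W \<in> \<U>" using F by (auto simp: W_def \<U>_def)
    define w where "w = Lnorm M q (indicator W) + 1"
    have w: "w > 0" using Lnorm_nonneg[of M q "indicator W"] by (simp add: w_def)
    have "\<epsilon> / (3 * w) > 0" using \<epsilon> w by simp
    then have "\<exists>d\<in>R. d \<in> ball c (\<epsilon> / (3 * w))" by (intro R(2)) auto
    then obtain c' where c': "c' \<in> R" "cmod (c - c') < \<epsilon> / (3 * w)" by (auto simp: dist_norm)
    define d where "d = (\<lambda>x. c' * indicator W x :: complex)"
    have dl: "d \<in> Lspace M q" unfolding d_def by (rule Lspace_indicator(1)[OF q0 W])
    have "d = G [(c', W)]" by (simp add: d_def G_def)
    moreover have "[(c', W)] \<in> lists (R \<times> \<U>)" using c'(1) WU by simp
    ultimately have dD: "d \<in> D" unfolding D_def using dl by blast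
    have IA: "indicator A \<in> Lspace M q" "indicator W \<in> Lspace M q"
      using Lspace_indicator(1)[OF q0 A, of 1] Lspace_indicator(1)[OF q0 W, of 1] by simp_all
    have "Lnorm M q (\<lambda>x. c * (indicator A x - indicator W x) + (c - c') * indicator W x)
        \<le> Lnorm M q (\<lambda>x. c * (indicator A x - indicator W x)) + Lnorm M q (\<lambda>x. (c - c') * indicator W x)"
      using IA by (intro minkowski(2) q Lspace_multiple Lspace_diff(1))
    also have "\<dots> = cmod c * Lnorm M q (\<lambda>x. indicator A x - indicator W x) + cmod (c - c') * Lnorm M q (indicator W)"
      by (simp add: Lnorm_multiple[OF q0])
    also have "\<dots> \<le> c1 * (\<epsilon> / (3 * c1)) + \<epsilon> / (3 * w) * w"
    proof (intro add_mono mult_mono)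
      show "Lnorm M q (\<lambda>x. indicator A x - indicator W x) \<le> \<epsilon> / (3 * c1)"
        using Lnorm_indicator_diff[OF q0 A W, of \<eta>] F(4,5) \<eta>q by (simp add: W_def)
      show "Lnorm M q (indicator W) \<le> w" by (simp add: w_def)
    qed (use c1 c'(2) \<open>\<epsilon> / (3 * w) > 0\<close> Lnorm_nonneg in \<open>auto simp: less_imp_le\<close>)
    also have "\<dots> < \<epsilon>"
    proof -
      have "c1 * (\<epsilon> / (3 * c1)) = \<epsilon> / 3" using c1 by simp
      moreover have "\<epsilon> / (3 * w) * w = \<epsilon> / 3" using w by simp
      ultimately show ?thesis using \<epsilon> by simp
    qed
    also have "(\<lambda>x. c * (indicator A x - indicator W x) + (c - c') * indicator W x) = (\<lambda>x. c * indicator A x - d x)"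
      by (auto simp: d_def algebra_simps)
    finally show "\<exists>d\<in>D. Lnorm M q (\<lambda>x. c * indicator A x - d x) < \<epsilon>" using dD by blast
  qed
  have S_simple: "f \<in> S" if f: "simple_function M f" "f \<in> Lspace M q" for f
  proof -
    have sp: "space M = UNIV" using sets_eq_imp_space_eq[OF sets] by simp
    have "(\<lambda>x. c * indicator (f -` {c}) x) \<in> S" for c
    proof (cases "c = 0")
      case False
      have m: "f -` {c} \<in> sets M" using simple_functionD(2)[OF f(1), of "{c}"] sp by simp
      \<comment> \<open>On the fibre over \<open>c\<close> the function has modulus
        \<open>cmod c > 0\<close>, so integrability of its power forces the fibre to have finite
        measure.\<close>
      have "integrable M (indicat_real (f -` {c}))"
      proof (rule Bochner_Integration.integrable_bound[of M "\<lambda>x. inverse (cmod c powr q) * cmod (f x) powr q"])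
        show "integrable M (\<lambda>x. inverse (cmod c powr q) * cmod (f x) powr q)"
          using Lspace_integrable[OF f(2)] by simp
      qed (use m False in \<open>auto simp: indicator_def\<close>)
      then have "emeasure M (f -` {c}) < \<infinity>" by (simp add: integrable_indicator_iff sp)
      then show ?thesis using m by (intro S_ind) (simp add: fmeasurable_def)
    qed (use S0 in simp)
    then have "(\<lambda>x. \<Sum>c\<in>range f. c * indicator (f -` {c}) x) \<in> S"
      using simple_functionD(1)[OF f(1)] sp S0 S_sum by (intro sum_fun_closed) auto
    also have "(\<lambda>x. \<Sum>c\<in>range f. c * indicator (f -` {c}) x) = f"
    proof
      fix x
      have "(\<Sum>c\<in>range f. c * indicator (f -` {c}) x) = (\<Sum>c\<in>{f x}. c * indicator (f -` {c}) x)"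
        using simple_functionD(1)[OF f(1)] sp by (intro sum.mono_neutral_right) (auto simp: indicator_def)
      then show "(\<Sum>c\<in>range f. c * indicator (f -` {c}) x) = f x" by simp
    qed
    finally show ?thesis .
  qed
  have dense: "\<exists>d\<in>D. Lnorm M q (\<lambda>x. f x - d x) < \<epsilon>" if f: "f \<in> Lspace M q" and \<epsilon>: "\<epsilon> > 0" for f \<epsilon>
  proof -
    note [measurable] = Lspace_measurable[OF f]
    obtain F where F: "\<And>i. simple_function M (F i)" "\<And>x. x \<in> space M \<Longrightarrow> (\<lambda>i. F i x) \<longlonglongrightarrow> f x"
      "\<And>i x. x \<in> space M \<Longrightarrow> dist (F i x) 0 \<le> 2 * dist (f x) 0"
      using borel_measurable_implies_sequence_metric[OF Lspace_measurable[OF f], of 0] by blast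
    have F: "\<And>i. simple_function M (F i)" "\<And>x. (\<lambda>i. F i x) \<longlonglongrightarrow> f x" "\<And>i x. cmod (F i x) \<le> 2 * cmod (f x)"
      using F sets_eq_imp_space_eq[OF sets] by auto
    have [measurable]: "F i \<in> borel_measurable M" for i using borel_measurable_simple_function[OF F(1)] .
    \<comment> \<open>The approximants have modulus at most twice that of \<open>f\<close>, so the
      factor 3 majorises both them and the differences.\<close>
    have dom: "integrable M (\<lambda>x. 3 powr q * cmod (f x) powr q)" using Lspace_integrable[OF f] by simp
    have le: "cmod (F i x) powr q \<le> 3 powr q * cmod (f x) powr q" "cmod (f x - F i x) powr q \<le> 3 powr q * cmod (f x) powr q" for i x
    proof -
      have "cmod (F i x) \<le> 3 * cmod (f x)" "cmod (f x - F i x) \<le> 3 * cmod (f x)"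
        using F(3)[of i x] norm_ge_zero[of "f x"] norm_triangle_ineq4[of "f x" "F i x"] by linarith+
      then have "cmod (F i x) powr q \<le> (3 * cmod (f x)) powr q" "cmod (f x - F i x) powr q \<le> (3 * cmod (f x)) powr q"
        using q0 by (auto intro!: powr_mono2)
      then show "cmod (F i x) powr q \<le> 3 powr q * cmod (f x) powr q" "cmod (f x - F i x) powr q \<le> 3 powr q * cmod (f x) powr q"
        by (simp_all add: powr_mult)
    qed
    have Fl: "F i \<in> Lspace M q" for i unfolding Lspace_def
      using le(1) by (auto intro!: Bochner_Integration.integrable_bound[OF dom])
    have "(\<lambda>i. LINT x|M. cmod (f x - F i x) powr q) \<longlonglongrightarrow> (LINT x|M. 0)"
    proof (rule integral_dominated_convergence[OF _ _ dom])
      have "(\<lambda>i. cmod (f x - F i x) powr q) \<longlonglongrightarrow> cmod (f x - f x) powr q" for x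
        using q0 by (intro tendsto_powr' tendsto_intros F(2)) auto
      then show "AE x in M. (\<lambda>i. cmod (f x - F i x) powr q) \<longlonglongrightarrow> 0" using q0 by simp
    qed (use le(2) in auto)
    then have "eventually (\<lambda>i. (LINT x|M. cmod (f x - F i x) powr q) < (\<epsilon> / 2) powr q) sequentially"
      using \<epsilon> by (intro order_tendstoD) auto
    then obtain i where i: "(LINT x|M. cmod (f x - F i x) powr q) < (\<epsilon> / 2) powr q" by (auto simp: eventually_sequentially)
    then have a: "Lnorm M q (\<lambda>x. f x - F i x) \<le> \<epsilon> / 2" using \<epsilon> by (intro iffD2[OF Lnorm_le_iff[OF q0]]) auto
    have "F i \<in> S" using S_simple[OF F(1) Fl] .
    then obtain d where d: "d \<in> D" "Lnorm M q (\<lambda>x. F i x - d x) < \<epsilon> / 2" using half_gt_zero[OF \<epsilon>] unfolding S_def by blast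
    have "d \<in> Lspace M q" using d(1) by (simp add: D_def)
    then have "Lnorm M q (\<lambda>x. f x - d x) < \<epsilon>" using Lnorm_diff_triangle[OF q f Fl, of d i] a d(2) by simp
    then show ?thesis using d(1) by blast
  qed
  have ne: "D \<noteq> {}" using D0 by blast
  have "from_nat_into D m \<in> Lspace M q" for m using from_nat_into[OF ne] by (auto simp: D_def)
  moreover have "\<exists>m. Lnorm M q (\<lambda>x. f x - from_nat_into D m x) < \<epsilon>" if "f \<in> Lspace M q" "\<epsilon> > 0" for f \<epsilon>
    using dense[OF that] from_nat_into_surj[OF cD] by metis
  ultimately show ?thesis by (intro exI[of _ "from_nat_into D"]) blast
qed

section \<open>The Figa-Talamanca--Herz algebra\<close>

text \<open>Tonelli for series. A representation is indexed by a single natural number, so countably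
  many of them are merged along \<open>prod_decode\<close>.\<close>

lemma sums_prod_decode_nonneg:
  fixes a :: "nat \<times> nat \<Rightarrow> real"
  assumes nonneg: "\<And>z. 0 \<le> a z" and rows: "\<And>k. (\<lambda>n. a (k, n)) sums A k" and A: "summable A"
  shows "a summable_on UNIV" "(\<lambda>m. a (prod_decode m)) sums (\<Sum>k. A k)"
proof -
  have A0: "0 \<le> A k" for k using sums_le[OF _ sums_zero rows[of k]] nonneg by simp
  have r: "((\<lambda>n. a (k, n)) has_sum A k) UNIV" for k
    using rows[of k] nonneg by (intro norm_summable_imp_has_sum) (auto simp: sums_iff)
  have s: "(A has_sum (\<Sum>k. A k)) UNIV"
    using A A0 by (intro norm_summable_imp_has_sum) (auto simp: summable_sums)
  have "a summable_on (SIGMA k:UNIV. UNIV)"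
    using r s nonneg by (intro summable_on_SigmaI[where f = a and g = A]) (auto simp: summable_on_def)
  then show sm: "a summable_on UNIV" by simp
  have "(a has_sum (\<Sum>k. A k)) (SIGMA k:UNIV. UNIV)"
    using r s sm by (intro has_sum_SigmaI[where f = a and g = A]) auto
  then have "((\<lambda>m. a (prod_decode m)) has_sum (\<Sum>k. A k)) UNIV"
    by (subst has_sum_reindex_bij_betw[OF bij_prod_decode]) simp
  then show "(\<lambda>m. a (prod_decode m)) sums (\<Sum>k. A k)" by (rule has_sum_imp_sums)
qed

text \<open>Fubini for series: the nonnegative majorant makes the double series absolutely summable,
  so the order of summation is irrelevant.\<close>

lemma sums_prod_decode_dominated:
  fixes a :: "nat \<times> nat \<Rightarrow> real" and c :: "nat \<times> nat \<Rightarrow> complex"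
  assumes le: "\<And>z. norm (c z) \<le> a z" and rows: "\<And>k. (\<lambda>n. a (k, n)) sums A k" and A: "summable A"
    and C: "\<And>k. (\<lambda>n. c (k, n)) sums C k" and L: "C sums L"
  shows "(\<lambda>m. c (prod_decode m)) sums L"
proof -
  have nonneg: "0 \<le> a z" for z using le[of z] norm_ge_zero order.trans by blast
  have row_norm: "summable (\<lambda>n. norm (c (k, n)))" for k
    by (rule summable_comparison_test'[OF sums_summable[OF rows[of k]], where N = 0]) (simp add: le)
  then have r: "((\<lambda>n. c (k, n)) has_sum C k) UNIV" for k
    using C by (intro norm_summable_imp_has_sum)
  have "norm (C k) \<le> A k" for k
  proof -
    have "norm (C k) \<le> (\<Sum>n. norm (c (k, n)))"
      using summable_norm[OF row_norm[of k]] sums_unique[OF C[of k]] by simp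
    also have "\<dots> \<le> (\<Sum>n. a (k, n))"
      by (intro suminf_le le row_norm sums_summable[OF rows])
    also have "\<dots> = A k" using sums_unique[OF rows[of k]] by simp
    finally show ?thesis .
  qed
  then have "summable (\<lambda>k. norm (C k))" by (intro summable_comparison_test'[OF A, where N = 0]) simp
  then have s: "(C has_sum L) UNIV" using L by (intro norm_summable_imp_has_sum)
  have "(\<lambda>z. norm (c z)) summable_on UNIV"
    using Infinite_Sum.abs_summable_on_comparison_test'[OF sums_prod_decode_nonneg(1)[OF nonneg rows A]] le by blast
  then have "c summable_on UNIV" by (rule Infinite_Sum.abs_summable_summable)
  then have "(c has_sum L) (SIGMA k:UNIV. UNIV)"
    using r s by (intro has_sum_SigmaI[where f = c and g = C]) auto
  then have "((\<lambda>m. c (prod_decode m)) has_sum L) UNIV"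
    by (subst has_sum_reindex_bij_betw[OF bij_prod_decode]) simp
  then show ?thesis by (rule has_sum_imp_sums)
qed

section \<open>Left translations and the A_p norm\<close>

context
  fixes \<mu> :: "'g::{topological_group_add, t2_space} measure"
  assumes haar: "left_haar_measure \<mu>"
begin

lemma haar_sets: "sets \<mu> = sets borel"
  using haar by (simp add: left_haar_measure_def)

text \<open>Invariance is stated for images of sets, while \<open>distr\<close> uses preimages; the
  preimage under translation by \<open>a\<close> is the image under translation by
  \<open>- a\<close>.\<close>

lemma distr_translation: "distr \<mu> \<mu> (\<lambda>y. a + y) = \<mu>"
proof (rule measure_eqI)
  have cont: "(\<lambda>y. a + y) \<in> borel_measurable borel"
    by (intro borel_measurable_continuous_onI continuous_intros)
  have m: "(\<lambda>y. a + y) \<in> measurable \<mu> \<mu>"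
    using cont measurable_cong_sets[OF haar_sets haar_sets] by simp
  fix A assume "A \<in> sets (distr \<mu> \<mu> (\<lambda>y. a + y))"
  then have A: "A \<in> sets \<mu>" by simp
  have "(\<lambda>y. a + y) -` A \<inter> space \<mu> = (\<lambda>x. - a + x) ` A"
    using sets_eq_imp_space_eq[OF haar_sets] by (auto simp: image_iff add.assoc[symmetric] intro!: bexI[of _ "a + _"])
  then have "emeasure (distr \<mu> \<mu> (\<lambda>y. a + y)) A = emeasure \<mu> ((\<lambda>x. - a + x) ` A)"
    using m A by (simp add: emeasure_distr)
  also have "\<dots> = emeasure \<mu> A" using haar A haar_sets by (simp add: left_haar_measure_def)
  finally show "emeasure (distr \<mu> \<mu> (\<lambda>y. a + y)) A = emeasure \<mu> A" .
qed simp

lemma Lspace_translation: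
  assumes g: "g \<in> Lspace \<mu> q"
  shows "(\<lambda>y. g (a + y)) \<in> Lspace \<mu> q" "Lnorm \<mu> q (\<lambda>y. g (a + y)) = Lnorm \<mu> q g"
proof -
  have "(\<lambda>y. a + y) \<in> borel_measurable borel"
    by (intro borel_measurable_continuous_onI continuous_intros)
  then have m: "(\<lambda>y. a + y) \<in> measurable \<mu> \<mu>"
    using measurable_cong_sets[OF haar_sets haar_sets] by simp
  have gm: "g \<in> borel_measurable \<mu>" using Lspace_measurable[OF g] .
  then have pm: "(\<lambda>x. cmod (g x) powr q) \<in> borel_measurable \<mu>" by simp
  have "integrable (distr \<mu> \<mu> (\<lambda>y. a + y)) (\<lambda>x. cmod (g x) powr q)"
    unfolding distr_translation by (rule Lspace_integrable[OF g])
  then have "integrable \<mu> (\<lambda>y. cmod (g (a + y)) powr q)" by (rule integrable_distr[OF m])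
  then show "(\<lambda>y. g (a + y)) \<in> Lspace \<mu> q" unfolding Lspace_def using measurable_compose[OF m gm] by simp
  have "(LINT y|\<mu>. cmod (g (a + y)) powr q) = (LINT x|distr \<mu> \<mu> (\<lambda>y. a + y). cmod (g x) powr q)"
    using integral_distr[OF m pm] by simp
  then show "Lnorm \<mu> q (\<lambda>y. g (a + y)) = Lnorm \<mu> q g" by (simp add: Lnorm_def distr_translation)
qed

context
  fixes p :: real
  assumes p: "1 < p"
begin

text \<open>Hoelder's inequality for \<open>f\<close> and the left translate of \<open>g\<close> by
  \<open>- x\<close>, whose norm is that of \<open>g\<close>.\<close>

lemma check_convolution_bound:
  assumes "f \<in> Lspace \<mu> (conjugate_exponent p)" "g \<in> Lspace \<mu> p"
  shows "cmod (check_convolution \<mu> f g x) \<le> Lnorm \<mu> (conjugate_exponent p) f * Lnorm \<mu> p g"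
  using holder[OF p assms(1) Lspace_translation(1)[OF assms(2), of "- x"]] Lspace_translation(2)[OF assms(2), of "- x"]
  by (simp add: check_convolution_def)

lemma conjugate_exponent_pos: "0 < conjugate_exponent p"
  using p by (simp add: conjugate_exponent_def)

lemma Ap_representationsD:
  assumes "(f, g) \<in> Ap_representations \<mu> p u"
  shows "f n \<in> Lspace \<mu> (conjugate_exponent p)" "g n \<in> Lspace \<mu> p"
    "summable (\<lambda>n. Lnorm \<mu> (conjugate_exponent p) (f n) * Lnorm \<mu> p (g n))"
    "(\<lambda>n. check_convolution \<mu> (f n) (g n) x) sums u x"
  using assms by (auto simp: Ap_representations_def)

lemma cost_nonneg: "0 \<le> Lnorm \<mu> (conjugate_exponent p) f * Lnorm \<mu> p g"
  by (simp add: Lnorm_nonneg)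

lemma Ap_norm_le:
  assumes "(f, g) \<in> Ap_representations \<mu> p u"
  shows "Ap_norm \<mu> p u \<le> (\<Sum>n. Lnorm \<mu> (conjugate_exponent p) (f n) * Lnorm \<mu> p (g n))"
proof -
  have "bdd_below ((\<lambda>(f, g). \<Sum>n. Lnorm \<mu> (conjugate_exponent p) (f n) * Lnorm \<mu> p (g n)) ` Ap_representations \<mu> p u)"
    by (rule bdd_belowI2[of _ 0]) (auto intro!: suminf_nonneg cost_nonneg dest: Ap_representationsD(3))
  from cINF_lower[OF this assms] show ?thesis by (simp add: Ap_norm_def)
qed

lemma Ap_norm_ge:
  assumes "u \<in> Ap \<mu> p"
    and "\<And>f g. (f, g) \<in> Ap_representations \<mu> p u \<Longrightarrow>
      a \<le> (\<Sum>n. Lnorm \<mu> (conjugate_exponent p) (f n) * Lnorm \<mu> p (g n))"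
  shows "a \<le> Ap_norm \<mu> p u"
  using assms unfolding Ap_norm_def Ap_def by (intro cINF_greatest) auto

lemma Ap_norm_approx:
  assumes "u \<in> Ap \<mu> p" "Ap_norm \<mu> p u < a"
  obtains f g where "(f, g) \<in> Ap_representations \<mu> p u"
    "(\<Sum>n. Lnorm \<mu> (conjugate_exponent p) (f n) * Lnorm \<mu> p (g n)) < a"
  using Ap_norm_ge[OF assms(1), of a] assms(2) by (meson not_le)

lemma Ap_norm_nonneg: "u \<in> Ap \<mu> p \<Longrightarrow> 0 \<le> Ap_norm \<mu> p u"
  by (intro Ap_norm_ge suminf_nonneg cost_nonneg) (auto dest: Ap_representationsD(3))

text \<open>Every representation bounds the supremum of \<open>u\<close> by its cost. Hence
  convergence in A_p is pointwise, and a vanishing norm forces the function to vanish.\<close>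

lemma Ap_norm_bound:
  assumes u: "u \<in> Ap \<mu> p"
  shows "cmod (u x) \<le> Ap_norm \<mu> p u"
proof (rule Ap_norm_ge[OF u])
  fix f g assume fg: "(f, g) \<in> Ap_representations \<mu> p u"
  note r = Ap_representationsD[OF fg]
  have sn: "summable (\<lambda>n. cmod (check_convolution \<mu> (f n) (g n) x))"
    using check_convolution_bound[OF r(1,2)] r(3) by (intro summable_comparison_test'[OF r(3), of 0]) auto
  have "cmod (u x) \<le> (\<Sum>n. cmod (check_convolution \<mu> (f n) (g n) x))"
    using summable_norm[OF sn] sums_unique[OF r(4)[of x]] by simp
  also have "\<dots> \<le> (\<Sum>n. Lnorm \<mu> (conjugate_exponent p) (f n) * Lnorm \<mu> p (g n))"
    using check_convolution_bound[OF r(1,2)] by (intro suminf_le sn r(3)) auto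
  finally show "cmod (u x) \<le> (\<Sum>n. Lnorm \<mu> (conjugate_exponent p) (f n) * Lnorm \<mu> p (g n))" .
qed

lemma Ap_zero: "(\<lambda>_. 0) \<in> Ap \<mu> p" and Ap_norm_zero: "Ap_norm \<mu> p (\<lambda>_. 0) = 0"
proof -
  have z: "(\<lambda>_ _. 0, \<lambda>_ _. 0) \<in> Ap_representations \<mu> p (\<lambda>_. 0)"
    by (simp add: Ap_representations_def Lspace_zero Lnorm_zero check_convolution_def)
  then show "(\<lambda>_. 0) \<in> Ap \<mu> p" by (auto simp: Ap_def)
  then show "Ap_norm \<mu> p (\<lambda>_. 0) = 0"
    using Ap_norm_le[OF z] Ap_norm_nonneg by (force simp: Lnorm_zero)
qed

text \<open>Only the first factors of a representation are scaled. Equality of the norms then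
  follows by scaling back with \<open>inverse c\<close>.\<close>

lemma Ap_multiple_le:
  assumes u: "u \<in> Ap \<mu> p"
  shows "(\<lambda>x. c * u x) \<in> Ap \<mu> p" "Ap_norm \<mu> p (\<lambda>x. c * u x) \<le> cmod c * Ap_norm \<mu> p u"
proof -
  have rep: "(\<lambda>n x. c * f n x, g) \<in> Ap_representations \<mu> p (\<lambda>x. c * u x)"
    if fg: "(f, g) \<in> Ap_representations \<mu> p u" for f g
  proof -
    note r = Ap_representationsD[OF fg]
    have conv: "check_convolution \<mu> (\<lambda>x. c * f n x) (g n) x = c * check_convolution \<mu> (f n) (g n) x" for n x
      by (simp add: check_convolution_def mult.assoc)
    have "summable (\<lambda>n. cmod c * (Lnorm \<mu> (conjugate_exponent p) (f n) * Lnorm \<mu> p (g n)))"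
      using r(3) by (rule summable_mult)
    then show ?thesis
      using r sums_mult[OF r(4), of c]
      by (auto intro: Lspace_multiple simp: Ap_representations_def conv Lnorm_multiple[OF conjugate_exponent_pos] mult.assoc)
  qed
  then show "(\<lambda>x. c * u x) \<in> Ap \<mu> p" using u by (fastforce simp: Ap_def)
  have le: "Ap_norm \<mu> p (\<lambda>x. c * u x) \<le> cmod c * a" if a: "Ap_norm \<mu> p u < a" for a
  proof -
    obtain f g where fg: "(f, g) \<in> Ap_representations \<mu> p u"
      "(\<Sum>n. Lnorm \<mu> (conjugate_exponent p) (f n) * Lnorm \<mu> p (g n)) < a" using Ap_norm_approx[OF u a] .
    have "Ap_norm \<mu> p (\<lambda>x. c * u x) \<le> (\<Sum>n. cmod c * (Lnorm \<mu> (conjugate_exponent p) (f n) * Lnorm \<mu> p (g n)))"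
      using Ap_norm_le[OF rep[OF fg(1)]] by (simp add: Lnorm_multiple[OF conjugate_exponent_pos] mult.assoc)
    also have "\<dots> = cmod c * (\<Sum>n. Lnorm \<mu> (conjugate_exponent p) (f n) * Lnorm \<mu> p (g n))"
      using Ap_representationsD(3)[OF fg(1)] by (rule suminf_mult)
    also have "\<dots> \<le> cmod c * a" using fg(2) by (intro mult_left_mono) auto
    finally show ?thesis .
  qed
  show "Ap_norm \<mu> p (\<lambda>x. c * u x) \<le> cmod c * Ap_norm \<mu> p u"
  proof (rule tendsto_lowerbound)
    show "((\<lambda>a. cmod c * a) \<longlongrightarrow> cmod c * Ap_norm \<mu> p u) (at_right (Ap_norm \<mu> p u))" by (intro tendsto_intros)
    show "eventually (\<lambda>a. Ap_norm \<mu> p (\<lambda>x. c * u x) \<le> cmod c * a) (at_right (Ap_norm \<mu> p u))"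
      using eventually_at_right_less by eventually_elim (rule le)
  qed simp
qed

lemma Ap_norm_multiple:
  assumes u: "u \<in> Ap \<mu> p"
  shows "Ap_norm \<mu> p (\<lambda>x. c * u x) = cmod c * Ap_norm \<mu> p u"
proof (cases "c = 0")
  case True
  then show ?thesis by (simp add: Ap_norm_zero)
next
  case False
  have "Ap_norm \<mu> p (\<lambda>x. inverse c * (c * u x)) \<le> cmod (inverse c) * Ap_norm \<mu> p (\<lambda>x. c * u x)"
    using Ap_multiple_le[OF u] by (intro Ap_multiple_le(2))
  then have "cmod c * Ap_norm \<mu> p u \<le> Ap_norm \<mu> p (\<lambda>x. c * u x)"
    using False by (simp add: mult.assoc[symmetric] norm_divide field_simps)
  then show ?thesis using Ap_multiple_le(2)[OF u, of c] by simp
qed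

text \<open>Nearly optimal representations of the summands are merged into one. This single fact
  yields the triangle inequality and completeness.\<close>

lemma Ap_countable_sum:
  assumes u: "\<And>k. u k \<in> Ap \<mu> p" and sm: "summable (\<lambda>k. Ap_norm \<mu> p (u k))"
    and U: "\<And>x. (\<lambda>k. u k x) sums U x"
  shows "U \<in> Ap \<mu> p" "Ap_norm \<mu> p U \<le> (\<Sum>k. Ap_norm \<mu> p (u k))"
proof -
  have main: "U \<in> Ap \<mu> p \<and> Ap_norm \<mu> p U \<le> (\<Sum>k. Ap_norm \<mu> p (u k)) + \<epsilon>" if \<epsilon>: "\<epsilon> > 0" for \<epsilon>
  proof -
    \<comment> \<open>The excess allowed to the \<open>k\<close>-th representation; these excesses
      add up to \<open>\<epsilon>\<close>.\<close>
    define \<delta> where "\<delta> k = \<epsilon> * (1/2) ^ Suc k" for k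
    have \<delta>0: "\<delta> k > 0" for k using \<epsilon> by (simp add: \<delta>_def)
    have \<delta>: "\<delta> sums \<epsilon>" unfolding \<delta>_def using sums_mult[OF power_half_series, of \<epsilon>] by simp
    have "\<exists>f g. (f, g) \<in> Ap_representations \<mu> p (u k) \<and>
        (\<Sum>n. Lnorm \<mu> (conjugate_exponent p) (f n) * Lnorm \<mu> p (g n)) < Ap_norm \<mu> p (u k) + \<delta> k" for k
      using Ap_norm_approx[OF u, of k "Ap_norm \<mu> p (u k) + \<delta> k"] \<delta>0[of k] by (metis less_add_same_cancel1)
    then obtain f g where fg: "\<And>k. (f k, g k) \<in> Ap_representations \<mu> p (u k)"
      and cost: "\<And>k. (\<Sum>n. Lnorm \<mu> (conjugate_exponent p) (f k n) * Lnorm \<mu> p (g k n)) < Ap_norm \<mu> p (u k) + \<delta> k"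
      by metis
    define a where "a z = Lnorm \<mu> (conjugate_exponent p) (f (fst z) (snd z)) * Lnorm \<mu> p (g (fst z) (snd z))" for z
    define A where "A k = (\<Sum>n. a (k, n))" for k
    have a0: "0 \<le> a z" for z by (simp add: a_def Lnorm_nonneg)
    have rows: "(\<lambda>n. a (k, n)) sums A k" for k
      unfolding A_def a_def using Ap_representationsD(3)[OF fg[of k]] by (simp add: summable_sums)
    have A_le: "A k \<le> Ap_norm \<mu> p (u k) + \<delta> k" for k using cost[of k] by (simp add: A_def a_def)
    have A0: "0 \<le> A k" for k using sums_le[OF _ sums_zero rows[of k]] a0 by simp
    have sm\<delta>: "summable (\<lambda>k. Ap_norm \<mu> p (u k) + \<delta> k)" using sm \<delta> by (intro summable_add) (auto simp: sums_iff)
    have Asm: "summable A" using A_le A0 by (intro summable_comparison_test'[OF sm\<delta>, of 0]) auto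
    have "(\<Sum>k. A k) \<le> (\<Sum>k. Ap_norm \<mu> p (u k) + \<delta> k)" using A_le Asm sm\<delta> by (intro suminf_le) auto
    also have "\<dots> = (\<Sum>k. Ap_norm \<mu> p (u k)) + \<epsilon>" using suminf_add[OF sm, of \<delta>] \<delta> by (simp add: sums_iff)
    finally have total: "(\<Sum>k. A k) \<le> (\<Sum>k. Ap_norm \<mu> p (u k)) + \<epsilon>" .
    define F where "F m = (case prod_decode m of (k, n) \<Rightarrow> f k n)" for m
    define H where "H m = (case prod_decode m of (k, n) \<Rightarrow> g k n)" for m
    have prod_sums: "(\<lambda>m. Lnorm \<mu> (conjugate_exponent p) (F m) * Lnorm \<mu> p (H m)) sums (\<Sum>k. A k)"
      using sums_prod_decode_nonneg(2)[OF a0 rows Asm] by (simp add: F_def H_def a_def case_prod_unfold)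
    have "(\<lambda>m. check_convolution \<mu> (F m) (H m) x) sums U x" for x
    proof -
      define c where "c z = check_convolution \<mu> (f (fst z) (snd z)) (g (fst z) (snd z)) x" for z
      have "norm (c z) \<le> a z" for z
        unfolding c_def a_def using Ap_representationsD(1,2)[OF fg] by (intro check_convolution_bound)
      moreover have "(\<lambda>n. c (k, n)) sums u k x" for k
        unfolding c_def using Ap_representationsD(4)[OF fg[of k], of x] by simp
      ultimately have "(\<lambda>m. c (prod_decode m)) sums U x"
        using sums_prod_decode_dominated[OF _ rows Asm _ U[of x], of c] by blast
      then show ?thesis by (simp add: c_def F_def H_def case_prod_unfold)
    qed
    then have rep: "(F, H) \<in> Ap_representations \<mu> p U"
      using Ap_representationsD(1,2)[OF fg] prod_sums
      by (auto simp: Ap_representations_def F_def H_def case_prod_unfold sums_iff)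
    then have "U \<in> Ap \<mu> p" by (auto simp: Ap_def)
    moreover have "Ap_norm \<mu> p U \<le> (\<Sum>k. Ap_norm \<mu> p (u k)) + \<epsilon>"
      using Ap_norm_le[OF rep] sums_unique[OF prod_sums] total by simp
    ultimately show ?thesis by blast
  qed
  show "U \<in> Ap \<mu> p" using main[of 1] by simp
  show "Ap_norm \<mu> p U \<le> (\<Sum>k. Ap_norm \<mu> p (u k))"
    by (rule field_le_epsilon) (rule conjunct2[OF main])
qed

text \<open>The sequence \<open>u\<close>, \<open>v\<close> padded with zero functions, which have
  norm 0.\<close>

lemma Ap_sum:
  assumes u: "u \<in> Ap \<mu> p" and v: "v \<in> Ap \<mu> p"
  shows "(\<lambda>x. u x + v x) \<in> Ap \<mu> p" "Ap_norm \<mu> p (\<lambda>x. u x + v x) \<le> Ap_norm \<mu> p u + Ap_norm \<mu> p v"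
proof -
  define w where "w k = (if k = 0 then u else if k = 1 then v else (\<lambda>_. 0))" for k :: nat
  have w: "w k \<in> Ap \<mu> p" for k using u v Ap_zero by (simp add: w_def)
  have n: "(\<lambda>k. Ap_norm \<mu> p (w k)) sums (Ap_norm \<mu> p u + Ap_norm \<mu> p v)"
    using sums_finite[of "{0,1}" "\<lambda>k. Ap_norm \<mu> p (w k)"] Ap_norm_zero by (simp add: w_def)
  have "(\<lambda>k. w k x) sums (u x + v x)" for x
    using sums_finite[of "{0,1}" "\<lambda>k. w k x"] by (simp add: w_def)
  from Ap_countable_sum[OF w sums_summable[OF n] this] sums_unique[OF n]
  show "(\<lambda>x. u x + v x) \<in> Ap \<mu> p" "Ap_norm \<mu> p (\<lambda>x. u x + v x) \<le> Ap_norm \<mu> p u + Ap_norm \<mu> p v" by simp_all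
qed

lemma Ap_diff: "u \<in> Ap \<mu> p \<Longrightarrow> v \<in> Ap \<mu> p \<Longrightarrow> (\<lambda>x. u x - v x) \<in> Ap \<mu> p"
  using Ap_sum(1)[OF _ Ap_multiple_le(1), of u v "-1"] by simp

lemma Ap_norm_diff_le:
  assumes u: "u \<in> Ap \<mu> p" and v: "v \<in> Ap \<mu> p"
  shows "Ap_norm \<mu> p (\<lambda>x. u x - v x) \<le> Ap_norm \<mu> p u + Ap_norm \<mu> p v"
  using Ap_sum(2)[OF u Ap_multiple_le(1)[OF v, of "-1"]] Ap_norm_multiple[OF v, of "-1"] by simp

text \<open>Along a fast subsequence the increments have summable norms, so the pointwise limit
  minus a term is a countable sum of elements of A_p.\<close>

lemma Ap_complete:
  fixes s :: "nat \<Rightarrow> 'g \<Rightarrow> complex"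
  assumes s: "\<And>n. s n \<in> Ap \<mu> p"
    and cauchy: "\<And>\<epsilon>. \<epsilon> > 0 \<Longrightarrow> \<exists>M. \<forall>m\<ge>M. \<forall>n\<ge>M. Ap_norm \<mu> p (\<lambda>x. s m x - s n x) < \<epsilon>"
  shows "\<exists>l\<in>Ap \<mu> p. (\<lambda>n. Ap_norm \<mu> p (\<lambda>x. s n x - l x)) \<longlonglongrightarrow> 0"
proof -
  have "\<forall>j. \<exists>M. \<forall>m\<ge>M. \<forall>n\<ge>M. Ap_norm \<mu> p (\<lambda>x. s m x - s n x) < (1/2) ^ j"
    using cauchy by simp
  then obtain M where M: "\<And>j m n. m \<ge> M j \<Longrightarrow> n \<ge> M j \<Longrightarrow> Ap_norm \<mu> p (\<lambda>x. s m x - s n x) < (1/2) ^ j" by metis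
  \<comment> \<open>Partial sums of \<open>M\<close> make the indices monotone while keeping
    \<open>K j\<close> at least \<open>M j\<close>.\<close>
  define K where "K j = (\<Sum>i\<le>j. M i)" for j
  have KM: "M j \<le> K j" for j unfolding K_def by (intro member_le_sum) auto
  have K_Suc: "K j \<le> K (Suc j)" for j by (simp add: K_def)
  define d where "d j = (\<lambda>x. s (K (Suc j)) x - s (K j) x)" for j
  have d: "d j \<in> Ap \<mu> p" for j unfolding d_def by (intro Ap_diff s)
  have d_norm: "Ap_norm \<mu> p (d j) \<le> (1/2) ^ j" for j
    unfolding d_def using M[of j "K (Suc j)" "K j"] KM[of j] K_Suc[of j] by simp
  have geo: "(\<lambda>j. (1/2) ^ (j + i) :: real) sums (2 * (1/2) ^ i)" for i
    using sums_mult2[OF geometric_sums[of "1/2::real"], of "(1/2) ^ i"] by (simp add: power_add)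
  have sm: "summable (\<lambda>j. Ap_norm \<mu> p (d (j + i)))" for i
    using d_norm Ap_norm_nonneg[OF d] by (intro summable_comparison_test'[OF sums_summable[OF geo[of i]], of 0]) auto
  have "summable (\<lambda>j. d j x)" for x
    using Ap_norm_bound[OF d] by (intro summable_comparison_test'[OF sm[of 0], of 0]) auto
  then have "convergent (\<lambda>n. \<Sum>j<n. d j x)" for x by (simp add: summable_iff_convergent)
  moreover have "(\<Sum>j<n. d j x) = s (K n) x - s (K 0) x" for n x
    unfolding d_def by (rule sum_lessThan_telescope)
  ultimately have "convergent (\<lambda>n. s (K n) x)" for x
    using convergent_add_const_right_iff[of "\<lambda>n. s (K n) x" "- s (K 0) x"] by simp
  then obtain l where l: "\<And>x. (\<lambda>n. s (K n) x) \<longlonglongrightarrow> l x" unfolding convergent_def by metis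
  have tail: "(\<lambda>x. l x - s (K i) x) \<in> Ap \<mu> p \<and> Ap_norm \<mu> p (\<lambda>x. l x - s (K i) x) \<le> 2 * (1/2) ^ i" for i
  proof -
    have "(\<lambda>j. d (j + i) x) sums (l x - s (K i) x)" for x
      using telescope_sums[OF LIMSEQ_ignore_initial_segment[OF l[of x], of i]] by (simp add: d_def)
    from Ap_countable_sum[OF d sm this]
    have "(\<lambda>x. l x - s (K i) x) \<in> Ap \<mu> p"
      "Ap_norm \<mu> p (\<lambda>x. l x - s (K i) x) \<le> (\<Sum>j. Ap_norm \<mu> p (d (j + i)))" by simp_all
    moreover have "(\<Sum>j. Ap_norm \<mu> p (d (j + i))) \<le> (\<Sum>j. (1/2) ^ (j + i))"
      using d_norm by (intro suminf_le sm sums_summable[OF geo[of i]]) auto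
    ultimately show ?thesis using sums_unique[OF geo[of i]] by simp
  qed
  have lA: "l \<in> Ap \<mu> p" using Ap_sum(1)[OF conjunct1[OF tail[of 0]] s[of "K 0"]] by simp
  have "(\<lambda>n. Ap_norm \<mu> p (\<lambda>x. s n x - l x)) \<longlonglongrightarrow> 0"
  proof (rule LIMSEQ_I)
    fix \<epsilon> :: real assume \<epsilon>: "\<epsilon> > 0"
    \<comment> \<open>One power of 1/2 bounds the distance to \<open>s (K i)\<close> and two more
      bound the tail, hence the third.\<close>
    obtain i where i: "(1/2::real) ^ i < \<epsilon> / 3" using real_arch_pow_inv[of "\<epsilon> / 3" "1/2"] \<epsilon> by auto
    have "norm (Ap_norm \<mu> p (\<lambda>x. s n x - l x) - 0) < \<epsilon>" if n: "n \<ge> K i" for n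
    proof -
      have "Ap_norm \<mu> p (\<lambda>x. (s n x - s (K i) x) + (-1) * (l x - s (K i) x))
          \<le> Ap_norm \<mu> p (\<lambda>x. s n x - s (K i) x) + Ap_norm \<mu> p (\<lambda>x. (-1) * (l x - s (K i) x))"
        by (intro Ap_sum(2) Ap_diff Ap_multiple_le(1) s lA)
      also have "Ap_norm \<mu> p (\<lambda>x. (-1) * (l x - s (K i) x)) = Ap_norm \<mu> p (\<lambda>x. l x - s (K i) x)"
        using tail[of i] by (subst Ap_norm_multiple) auto
      also have "(\<lambda>x. (s n x - s (K i) x) + (-1) * (l x - s (K i) x)) = (\<lambda>x. s n x - l x)" by auto
      finally have "Ap_norm \<mu> p (\<lambda>x. s n x - l x) < \<epsilon>"
        using M[of i n "K i"] KM[of i] n tail[of i] i by simp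
      then show ?thesis using Ap_norm_nonneg[OF Ap_diff[OF s lA], of n] by simp
    qed
    then show "\<exists>no. \<forall>n\<ge>no. norm (Ap_norm \<mu> p (\<lambda>x. s n x - l x) - 0) < \<epsilon>" by blast
  qed
  then show ?thesis using lA by blast
qed

lemma Ap_norm_definite:
  assumes "u \<in> Ap \<mu> p" "Ap_norm \<mu> p u = 0"
  shows "u = (\<lambda>_. 0)"
  using Ap_norm_bound[OF assms(1)] assms(2) by (auto simp: fun_eq_iff)

lemma Ap_function_space: "complex_function_space (Ap \<mu> p) (Ap_norm \<mu> p)"
proof
  fix s :: "nat \<Rightarrow> 'g \<Rightarrow> complex"
  assume "\<And>n. s n \<in> Ap \<mu> p" "\<And>\<epsilon>. 0 < \<epsilon> \<Longrightarrow> \<exists>M. \<forall>m\<ge>M. \<forall>n\<ge>M. Ap_norm \<mu> p (\<lambda>x. s m x - s n x) < \<epsilon>"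
  then show "\<exists>l\<in>Ap \<mu> p. (\<lambda>n. Ap_norm \<mu> p (\<lambda>x. s n x - l x)) \<longlonglongrightarrow> 0" by (rule Ap_complete)
qed (use Ap_zero Ap_sum Ap_multiple_le(1) Ap_norm_multiple Ap_norm_nonneg Ap_norm_definite in \<open>auto\<close>)

lemma Ap_tendsto_pointwise:
  assumes s: "\<And>n. s n \<in> Ap \<mu> p" and l: "l \<in> Ap \<mu> p" and lim: "(\<lambda>n. Ap_norm \<mu> p (\<lambda>x. s n x - l x)) \<longlonglongrightarrow> 0"
  shows "(\<lambda>n. s n x) \<longlonglongrightarrow> l x"
proof -
  have "(\<lambda>n. s n x - l x) \<longlonglongrightarrow> 0"
    using Ap_norm_bound[OF Ap_diff[OF s l]] by (intro Lim_null_comparison[OF _ lim]) (auto intro!: always_eventually)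
  then show ?thesis by (simp add: LIM_zero_iff)
qed

text \<open>The limit is produced by the A_p norm, which fixes it pointwise; Fatou's lemma then
  shows that the same function is the limit for the other norm.\<close>

lemma Ap_Lspace_function_space:
  assumes r: "1 \<le> r"
  shows "complex_function_space (Ap \<mu> p \<inter> Lspace \<mu> r) (\<lambda>u. Ap_norm \<mu> p u + Lnorm \<mu> r u)"
proof
  have r0: "0 < r" using r by simp
  show "(\<lambda>_. 0) \<in> Ap \<mu> p \<inter> Lspace \<mu> r" using Ap_zero Lspace_zero by blast
  fix f g assume f: "f \<in> Ap \<mu> p \<inter> Lspace \<mu> r"
  show "(\<lambda>x. c * f x) \<in> Ap \<mu> p \<inter> Lspace \<mu> r" for c using f Ap_multiple_le(1) Lspace_multiple by blast
  show "Ap_norm \<mu> p (\<lambda>x. c * f x) + Lnorm \<mu> r (\<lambda>x. c * f x) = cmod c * (Ap_norm \<mu> p f + Lnorm \<mu> r f)" for c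
    using f by (simp add: Ap_norm_multiple Lnorm_multiple[OF r0] distrib_left)
  show "0 \<le> Ap_norm \<mu> p f + Lnorm \<mu> r f" using f Ap_norm_nonneg Lnorm_nonneg[of \<mu> r f] by auto
  show "f = (\<lambda>_. 0)" if "Ap_norm \<mu> p f + Lnorm \<mu> r f = 0"
    using f that Ap_norm_nonneg[of f] Lnorm_nonneg[of \<mu> r f] by (intro Ap_norm_definite) auto
  assume g: "g \<in> Ap \<mu> p \<inter> Lspace \<mu> r"
  show "(\<lambda>x. f x + g x) \<in> Ap \<mu> p \<inter> Lspace \<mu> r" using f g Ap_sum(1) minkowski(1)[OF r] by blast
  show "Ap_norm \<mu> p (\<lambda>x. f x + g x) + Lnorm \<mu> r (\<lambda>x. f x + g x) \<le> Ap_norm \<mu> p f + Lnorm \<mu> r f + (Ap_norm \<mu> p g + Lnorm \<mu> r g)"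
    using f g Ap_sum(2)[of f g] minkowski(2)[OF r, of f \<mu> g] by auto
next
  fix s :: "nat \<Rightarrow> 'g \<Rightarrow> complex"
  assume s: "\<And>n. s n \<in> Ap \<mu> p \<inter> Lspace \<mu> r"
    and cauchy: "\<And>\<epsilon>. 0 < \<epsilon> \<Longrightarrow> \<exists>M. \<forall>m\<ge>M. \<forall>n\<ge>M. Ap_norm \<mu> p (\<lambda>x. s m x - s n x) + Lnorm \<mu> r (\<lambda>x. s m x - s n x) < \<epsilon>"
  have sA: "s n \<in> Ap \<mu> p" and sL: "s n \<in> Lspace \<mu> r" for n using s by auto
  have cauchy_Ap: "\<exists>M. \<forall>m\<ge>M. \<forall>n\<ge>M. Ap_norm \<mu> p (\<lambda>x. s m x - s n x) < \<epsilon>" if "\<epsilon> > 0" for \<epsilon>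
    using cauchy[OF that] Lnorm_nonneg by (smt (verit))
  then obtain l where l: "l \<in> Ap \<mu> p" "(\<lambda>n. Ap_norm \<mu> p (\<lambda>x. s n x - l x)) \<longlonglongrightarrow> 0"
    using Ap_complete[OF sA cauchy_Ap] by blast
  note pw = Ap_tendsto_pointwise[OF sA l]
  \<comment> \<open>For fixed \<open>n\<close> the differences \<open>s n - s (m + M)\<close>
    converge pointwise to \<open>s n - l\<close> as \<open>m\<close> grows, and their norms are at
    most \<open>\<epsilon>\<close>.\<close>
  have close: "\<exists>M. \<forall>n\<ge>M. (\<lambda>x. s n x - l x) \<in> Lspace \<mu> r \<and> Lnorm \<mu> r (\<lambda>x. s n x - l x) \<le> \<epsilon>" if \<epsilon>: "\<epsilon> > 0" for \<epsilon>
  proof -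
    obtain M where M: "\<And>m n. m \<ge> M \<Longrightarrow> n \<ge> M \<Longrightarrow> Ap_norm \<mu> p (\<lambda>x. s m x - s n x) + Lnorm \<mu> r (\<lambda>x. s m x - s n x) < \<epsilon>"
      using cauchy[OF \<epsilon>] by blast
    have "(\<lambda>x. s n x - l x) \<in> Lspace \<mu> r \<and> Lnorm \<mu> r (\<lambda>x. s n x - l x) \<le> \<epsilon>" if n: "n \<ge> M" for n
    proof -
      have v: "(\<lambda>x. s n x - s (m + M) x) \<in> Lspace \<mu> r" for m using Lspace_diff(1)[OF r sL sL] .
      have vb: "Lnorm \<mu> r (\<lambda>x. s n x - s (m + M) x) \<le> \<epsilon>" for m
        using M[OF n, of "m + M"] Ap_norm_nonneg[OF Ap_diff[OF sA sA], of n "m + M"] by simp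
      have "(\<lambda>m. s n x - s (m + M) x) \<longlonglongrightarrow> s n x - l x" for x
        by (intro tendsto_intros LIMSEQ_ignore_initial_segment pw)
      then show ?thesis using Lspace_fatou[where v = "\<lambda>m x. s n x - s (m + M) x", OF _ v vb] r by simp
    qed
    then show ?thesis by blast
  qed
  obtain M where "(\<lambda>x. s M x - l x) \<in> Lspace \<mu> r" using close[of 1] by auto
  then have lL: "l \<in> Lspace \<mu> r" using Lspace_diff(1)[OF r sL[of M], of "\<lambda>x. s M x - l x"] by simp
  have "(\<lambda>n. Lnorm \<mu> r (\<lambda>x. s n x - l x)) \<longlonglongrightarrow> 0"
  proof (rule LIMSEQ_I)
    fix \<epsilon> :: real assume "\<epsilon> > 0"
    then obtain M where M: "\<And>n. n \<ge> M \<Longrightarrow> Lnorm \<mu> r (\<lambda>x. s n x - l x) \<le> \<epsilon> / 2" using close[of "\<epsilon> / 2"] by auto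
    have "norm (Lnorm \<mu> r (\<lambda>x. s n x - l x) - 0) < \<epsilon>" if "n \<ge> M" for n
      using M[OF that] Lnorm_nonneg[of \<mu> r "\<lambda>x. s n x - l x"] \<open>\<epsilon> > 0\<close> by simp
    then show "\<exists>no. \<forall>n\<ge>no. norm (Lnorm \<mu> r (\<lambda>x. s n x - l x) - 0) < \<epsilon>" by blast
  qed
  then have "(\<lambda>n. Ap_norm \<mu> p (\<lambda>x. s n x - l x) + Lnorm \<mu> r (\<lambda>x. s n x - l x)) \<longlonglongrightarrow> 0"
    using tendsto_add[OF l(2)] by force
  then show "\<exists>l\<in>Ap \<mu> p \<inter> Lspace \<mu> r. (\<lambda>n. Ap_norm \<mu> p (\<lambda>x. s n x - l x) + Lnorm \<mu> r (\<lambda>x. s n x - l x)) \<longlonglongrightarrow> 0"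
    using l(1) lL by blast
qed

end

end

section \<open>The spaces A_p^r and their inclusions\<close>

lemma Apr_finite:
  assumes "t \<noteq> \<infinity>"
  shows "Apr \<mu> p t = Ap \<mu> p \<inter> Lspace \<mu> (enn2real t)"
    "Apr_norm \<mu> p t = (\<lambda>u. Ap_norm \<mu> p u + Lnorm \<mu> (enn2real t) u)"
  using assms by (auto simp: Apr_def Apr_norm_def)

lemma Apr_infinite:
  shows "Apr \<mu> p top = Ap \<mu> p" "Apr_norm \<mu> p top = Ap_norm \<mu> p"
  by (auto simp: Apr_def Apr_norm_def)

lemma enn2real_ge_1: "1 \<le> t \<Longrightarrow> t \<noteq> \<infinity> \<Longrightarrow> 1 \<le> enn2real t"
  using enn2real_mono[of 1 t] by (simp add: less_top)

lemma Apr_function_space: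
  assumes "left_haar_measure \<mu>" "1 < p" "1 \<le> t"
  shows "complex_function_space (Apr \<mu> p t) (Apr_norm \<mu> p t)"
proof (cases "t = \<infinity>")
  case True
  then show ?thesis using Ap_function_space[OF assms(1,2)] by (simp add: Apr_infinite)
next
  case False
  then show ?thesis
    using Ap_Lspace_function_space[OF assms(1,2) enn2real_ge_1[OF assms(3)]] by (simp add: Apr_finite)
qed

lemma Apr_subset_Ap: "Apr \<mu> p t \<subseteq> Ap \<mu> p"
  and Ap_norm_le_Apr_norm: "Ap_norm \<mu> p u \<le> Apr_norm \<mu> p t u"
  by (auto simp: Apr_def Apr_norm_def Lnorm_nonneg)

text \<open>The norm of A_p^r bounds both the supremum and the L^r norm, hence the L^t norm. It also
  bounds the A_p norm, which accounts for the factor 2.\<close>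

lemma Apr_inclusion:
  assumes haar: "left_haar_measure \<mu>" and p: "1 < p" and r: "1 \<le> r" "r \<le> t" and u: "u \<in> Apr \<mu> p r"
  shows "u \<in> Apr \<mu> p t" "Apr_norm \<mu> p t u \<le> 2 * Apr_norm \<mu> p r u"
proof -
  have uA: "u \<in> Ap \<mu> p" using u Apr_subset_Ap by blast
  have A: "0 \<le> Ap_norm \<mu> p u" by (rule Ap_norm_nonneg[OF haar p uA])
  have "u \<in> Apr \<mu> p t \<and> Apr_norm \<mu> p t u \<le> 2 * Apr_norm \<mu> p r u"
  proof (cases "t = \<infinity>")
    case True
    then show ?thesis using uA A Ap_norm_le_Apr_norm[of \<mu> p u r] by (simp add: Apr_infinite)
  next
    case False
    then have rfin: "r \<noteq> \<infinity>" using r(2) by (auto simp: top_unique)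
    have le: "0 < enn2real r" "enn2real r \<le> enn2real t"
      using enn2real_ge_1[OF r(1) rfin] enn2real_mono[OF r(2)] False by (auto simp: less_top)
    have uL: "u \<in> Lspace \<mu> (enn2real r)" using u rfin by (simp add: Apr_finite)
    define a where "a = Ap_norm \<mu> p u + Lnorm \<mu> (enn2real r) u"
    have "Lnorm \<mu> (enn2real r) u \<le> a" using A by (simp add: a_def)
    moreover have "cmod (u x) \<le> a" for x
      using Ap_norm_bound[OF haar p uA, of x] Lnorm_nonneg[of \<mu> "enn2real r" u] by (simp add: a_def)
    ultimately have "u \<in> Lspace \<mu> (enn2real t)" "Lnorm \<mu> (enn2real t) u \<le> a"
      using Lspace_bounded_interpolation[OF le uL] by auto
    then show ?thesis
      using uA False rfin Lnorm_nonneg[of \<mu> "enn2real r" u] by (simp add: Apr_finite a_def)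
  qed
  then show "u \<in> Apr \<mu> p t" "Apr_norm \<mu> p t u \<le> 2 * Apr_norm \<mu> p r u" by auto
qed

lemma RNP_Apr_mono:
  fixes \<mu> :: "'g::{topological_group_add, t2_space, second_countable_topology} measure"
  assumes haar: "left_haar_measure \<mu>" and p: "1 < p" and r: "1 \<le> r" "r \<le> t" "r \<noteq> \<infinity>"
    and rnp: "RNP (Apr \<mu> p t) (Apr_norm \<mu> p t)"
  shows "RNP (Apr \<mu> p r) (Apr_norm \<mu> p r)"
proof -
  define q where "q = enn2real r"
  have q: "1 \<le> q" unfolding q_def by (rule enn2real_ge_1[OF r(1,3)])
  have q0: "0 < q" using q by simp
  have X_eq: "Apr \<mu> p r = Ap \<mu> p \<inter> Lspace \<mu> q" "Apr_norm \<mu> p r = (\<lambda>u. Ap_norm \<mu> p u + Lnorm \<mu> q u)"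
    using Apr_finite[OF r(3)] by (simp_all add: q_def)
  have t1: "1 \<le> t" using r(1,2) by (rule order.trans)
  have Ap_lim: "(\<lambda>n. Ap_norm \<mu> p (\<lambda>x. s n x - l x)) \<longlonglongrightarrow> 0"
    if s: "\<And>n. s n \<in> Ap \<mu> p" and l: "l \<in> Ap \<mu> p" and lim: "(\<lambda>n. Apr_norm \<mu> p t (\<lambda>x. s n x - l x)) \<longlonglongrightarrow> 0"
    for s :: "nat \<Rightarrow> 'g \<Rightarrow> complex" and l
    using Ap_norm_nonneg[OF haar p Ap_diff[OF haar p s l]] Ap_norm_le_Apr_norm
    by (intro tendsto_sandwich[OF _ _ tendsto_const lim]) (auto intro!: always_eventually)
  show ?thesis
  proof (rule RNP_semi_embedding[OF Apr_function_space[OF haar p r(1)] Apr_function_space[OF haar p t1] rnp])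
    show "Apr \<mu> p r \<subseteq> Apr \<mu> p t" using Apr_inclusion(1)[OF haar p r(1,2)] by blast
    show "Apr_norm \<mu> p t f \<le> 2 * Apr_norm \<mu> p r f" if "f \<in> Apr \<mu> p r" for f
      using Apr_inclusion(2)[OF haar p r(1,2) that] .
  next
    fix s :: "nat \<Rightarrow> 'g \<Rightarrow> complex" and c l
    assume s: "\<And>n. s n \<in> Apr \<mu> p r" and c: "\<And>n. Apr_norm \<mu> p r (s n) \<le> c"
      and l: "l \<in> Apr \<mu> p t" and lim: "(\<lambda>n. Apr_norm \<mu> p t (\<lambda>x. s n x - l x)) \<longlonglongrightarrow> 0"
    have sA: "s n \<in> Ap \<mu> p" and sL: "s n \<in> Lspace \<mu> q" for n using s by (auto simp: X_eq)
    have lA: "l \<in> Ap \<mu> p" using l Apr_subset_Ap by blast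
    note limA = Ap_lim[OF sA lA lim]
    note pw = Ap_tendsto_pointwise[OF haar p sA lA limA]
    \<comment> \<open>Fatou controls only the L^r part. The A_p part converges, so up to
      \<open>\<epsilon>\<close> it uses up \<open>Ap_norm \<mu> p l\<close> of the total
      \<open>c\<close>, and the same constant \<open>c\<close> bounds the limit.\<close>
    have bound: "l \<in> Lspace \<mu> q \<and> Lnorm \<mu> q l \<le> (c - Ap_norm \<mu> p l) + \<epsilon>" if \<epsilon>: "\<epsilon> > 0" for \<epsilon>
    proof -
      obtain M where M: "\<And>n. n \<ge> M \<Longrightarrow> Ap_norm \<mu> p (\<lambda>x. s n x - l x) < \<epsilon>"
        using order_tendstoD(2)[OF limA \<epsilon>] by (auto simp: eventually_sequentially)
      have "Lnorm \<mu> q (s (n + M)) \<le> (c - Ap_norm \<mu> p l) + \<epsilon>" for n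
      proof -
        have "Ap_norm \<mu> p l \<le> Ap_norm \<mu> p (s (n + M)) + Ap_norm \<mu> p (\<lambda>x. s (n + M) x - l x)"
          using Ap_norm_diff_le[OF haar p sA Ap_diff[OF haar p sA lA], of "n + M" "n + M"] by simp
        then show ?thesis using M[of "n + M"] c[of "n + M"] by (simp add: X_eq)
      qed
      from Lspace_fatou[where v = "\<lambda>n. s (n + M)", OF q0 sL this LIMSEQ_ignore_initial_segment[OF pw]]
      show ?thesis by simp
    qed
    have "l \<in> Lspace \<mu> q" using bound[of 1] by simp
    moreover have "Lnorm \<mu> q l \<le> c - Ap_norm \<mu> p l"
      by (rule field_le_epsilon) (rule conjunct2[OF bound])
    ultimately show "l \<in> Apr \<mu> p r \<and> Apr_norm \<mu> p r l \<le> c" using lA by (simp add: X_eq)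
  next
    fix \<epsilon> :: real assume \<epsilon>: "\<epsilon> > 0"
    have outer: "emeasure \<mu> A = (INF U\<in>{U. open U \<and> A \<subseteq> U}. emeasure \<mu> U)" if "A \<in> sets borel" for A
      using haar that unfolding left_haar_measure_def by blast
    obtain b :: "nat \<Rightarrow> 'g \<Rightarrow> complex" where b: "\<And>m. b m \<in> Lspace \<mu> q"
      "\<And>f \<epsilon>. f \<in> Lspace \<mu> q \<Longrightarrow> \<epsilon> > 0 \<Longrightarrow> \<exists>m. Lnorm \<mu> q (\<lambda>x. f x - b m x) < \<epsilon>"
      using Lspace_separable[OF haar_sets[OF haar] outer q] by blast
    \<comment> \<open>Closed L^r balls around a dense sequence, whose members need not lie in A_p.
      Two elements of one ball are within \<open>\<epsilon> / 2\<close> for the L^r norm, and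
      \<open>\<rho> = \<epsilon> / 4\<close> controls the A_p part.\<close>
    define F where "F m = {f \<in> Lspace \<mu> q. Lnorm \<mu> q (\<lambda>x. f x - b m x) \<le> \<epsilon> / 4}" for m
    have "\<epsilon> / 4 > 0" using \<epsilon> by simp
    moreover have "Apr \<mu> p r \<subseteq> (\<Union>m. F m)"
    proof
      fix f assume "f \<in> Apr \<mu> p r"
      then have f: "f \<in> Lspace \<mu> q" by (simp add: X_eq)
      from b(2)[OF f \<open>\<epsilon> / 4 > 0\<close>] obtain m where "Lnorm \<mu> q (\<lambda>x. f x - b m x) < \<epsilon> / 4" by blast
      then show "f \<in> (\<Union>m. F m)" using f by (auto simp: F_def intro!: exI[of _ m])
    qed
    moreover have "Apr_norm \<mu> p r (\<lambda>x. f x - g x) < \<epsilon>"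
      if f: "f \<in> F m \<inter> Apr \<mu> p r" and g: "g \<in> F m \<inter> Apr \<mu> p r" and close: "Apr_norm \<mu> p t (\<lambda>x. f x - g x) < \<epsilon> / 4" for m f g
    proof -
      have m: "f \<in> Lspace \<mu> q" "g \<in> Lspace \<mu> q" using f g by (auto simp: F_def)
      have "Lnorm \<mu> q (\<lambda>x. f x - g x) \<le> \<epsilon> / 4 + \<epsilon> / 4"
        using Lnorm_diff_triangle[OF q m(1) b(1) m(2), of m] f g Lnorm_diff_commute[of \<mu> q g "b m"]
        by (simp add: F_def)
      moreover have "Ap_norm \<mu> p (\<lambda>x. f x - g x) < \<epsilon> / 4" using close Ap_norm_le_Apr_norm le_less_trans by blast
      ultimately show ?thesis using \<epsilon> by (simp add: X_eq)
    qed
    moreover have "l \<in> F m"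
      if s: "\<And>k. s k \<in> F m \<inter> Apr \<mu> p r \<and> Apr_norm \<mu> p r (s k) \<le> c" and l: "l \<in> Apr \<mu> p r"
        and lim: "(\<lambda>k. Apr_norm \<mu> p t (\<lambda>x. s k x - l x)) \<longlonglongrightarrow> 0" for m c l and s :: "nat \<Rightarrow> 'g \<Rightarrow> complex"
    proof -
      have sA: "s k \<in> Ap \<mu> p" and sL: "s k \<in> Lspace \<mu> q" and sF: "Lnorm \<mu> q (\<lambda>x. s k x - b m x) \<le> \<epsilon> / 4" for k
        using s[of k] by (auto simp: X_eq F_def)
      have lA: "l \<in> Ap \<mu> p" and lL: "l \<in> Lspace \<mu> q" using l by (auto simp: X_eq)
      have "(\<lambda>k. s k x - b m x) \<longlonglongrightarrow> l x - b m x" for x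
        by (intro tendsto_intros Ap_tendsto_pointwise[OF haar p sA lA Ap_lim[OF sA lA lim]])
      from Lspace_fatou(2)[where v = "\<lambda>k x. s k x - b m x", OF q0 Lspace_diff(1)[OF q sL b(1)] sF this]
      show ?thesis using lL by (simp add: F_def)
    qed
    ultimately show "\<exists>(F :: nat \<Rightarrow> _ set) \<rho>. \<rho> > 0 \<and> Apr \<mu> p r \<subseteq> (\<Union>n. F n) \<and>
      (\<forall>n. \<forall>f\<in>F n \<inter> Apr \<mu> p r. \<forall>g\<in>F n \<inter> Apr \<mu> p r. Apr_norm \<mu> p t (\<lambda>x. f x - g x) < \<rho> \<longrightarrow> Apr_norm \<mu> p r (\<lambda>x. f x - g x) < \<epsilon>) \<and>
      (\<forall>n c s l. (\<forall>k::nat. s k \<in> F n \<inter> Apr \<mu> p r \<and> Apr_norm \<mu> p r (s k) \<le> c) \<longrightarrow> l \<in> Apr \<mu> p r \<longrightarrow>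
        (\<lambda>k. Apr_norm \<mu> p t (\<lambda>x. s k x - l x)) \<longlonglongrightarrow> 0 \<longrightarrow> l \<in> F n)"
      by (intro exI[of _ F] exI[of _ "\<epsilon> / 4"]) blast
  qed
qed

theorem theorem3:
  fixes \<mu> :: "'g::{topological_group_add, t2_space, second_countable_topology} measure"
    and p :: real
    and I :: "'i set" and le :: "'i \<Rightarrow> 'i \<Rightarrow> bool" and e :: "'i \<Rightarrow> 'g \<Rightarrow> complex"
  assumes "1 < p"
    and "locally_compact_space (euclidean :: 'g topology)"
    and "left_haar_measure \<mu>"
    and "multiplier_bai \<mu> p I le e"
  shows "(\<forall>t::ennreal. 1 \<le> t \<and> RNP (Apr \<mu> p t) (Apr_norm \<mu> p t) \<longrightarrow>
           (\<forall>r. 1 \<le> r \<and> r \<le> t \<longrightarrow> RNP (Apr \<mu> p r) (Apr_norm \<mu> p r))) \<and>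
         (RNP (Ap \<mu> p) (Ap_norm \<mu> p) \<longrightarrow>
           (\<forall>r::ennreal. 1 \<le> r \<and> r < \<infinity> \<longrightarrow> RNP (Apr \<mu> p r) (Apr_norm \<mu> p r)))"
proof -
  \<comment> \<open>The infinite exponent is the trivial case: \<open>r = \<infinity>\<close> forces
    \<open>t = \<infinity>\<close>, and both spaces are A_p.\<close>
  have mono: "RNP (Apr \<mu> p r) (Apr_norm \<mu> p r)"
    if "RNP (Apr \<mu> p t) (Apr_norm \<mu> p t)" "1 \<le> r" "r \<le> t" for r t :: ennreal
  proof (cases "r = \<infinity>")
    case True
    then have "t = \<infinity>" using that(3) by (simp add: top_unique)
    then show ?thesis using that(1) True by simp
  next
    case False
    then show ?thesis using RNP_Apr_mono[OF assms(3,1) that(2,3) _ that(1)] by blast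
  qed
  moreover have "RNP (Apr \<mu> p r) (Apr_norm \<mu> p r)"
    if "RNP (Ap \<mu> p) (Ap_norm \<mu> p)" "1 \<le> r" for r :: ennreal
    using mono[of \<infinity> r] that by (simp add: Apr_infinite)
  ultimately show ?thesis by blast
qed

end
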